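(* Let $E$ be a nuclear topological vector space, $\chi:E\to\mathbb{C}$ a continuous characteristic function with $\chi(0)=1$, and $\mu$ the corresponding measure on $(E',\mathcal{S}_E)$. Then for each $1\le p<\infty$ the cocone $(L^p(E',\mu),\varphi_R^* )$ is the colimit in $\mathfrak{Ban}$ of the codiagram $(L^p(R^a,\mu_R),\pi_{RF}^* )$ indexed by $\mathcal{R}$. Moreover, the cocone $(\mathscr{L}^p(\mathfrak{R}),\psi_R)$ is another realization of the colimit, and the map $$\mathfrak{L}_p:(\mathscr{L}^p(\mathfrak{R}),\psi_R)\to(L^p(E',\mu),\varphi_R^* ),\qquad (f_R)_R\mapsto\lim_{R\in\mathcal{R}}\varphi_R^*(f_R),$$ is an isomorphism of cocones with inverse $$\mathfrak{L}_p^{-1}:(L^p(E',\mu),\varphi_R^* )\to(\mathscr{L}^p(\mathfrak{R}),\psi_R),\qquad f\mapsto\big([\varphi_R^*]^{-1}(\mathbb{E}_R(f))\big)_{R\in\mathcal{R}},$$ where $\mathbb{E}_R(f)=\mathbb{E}[f\,|\,\mathcal{B}^R]$ is the conditional expectation of $f\in L^p(E',\mu)$ with respect to $\mathcal{B}^R=\{\varphi_R^{-1}(B):B\in\mathcal{B}_R\}$, $\mathcal{B}_R$ being the Borel $\sigma$-algebra of $R^a$.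
   Context: $E$ is a real space, $E^a$ its algebraic dual, $E'\subset E^a$ its topological dual. For $\xi\in E$ let $\xi_*:E^a\to\mathbb{R}$, $\xi_*(\ell)=\ell(\xi)$; $\mathcal{B}_E=\sigma(\{\xi_*^{-1}(B):\xi\in E,\ B\subset\mathbb{R}\text{ Borel}\})$ and $\mathcal{S}_E=\{B\cap E':B\in\mathcal{B}_E\}$. $\mathcal{R}$ is the set of finite dimensional subspaces of $E$, directed by inclusion (written $R\le F$). A characteristic function is a map $\chi:E\to\mathbb{C}$ such that $\sum_{j,k=1}^n\alpha_j\bar\alpha_k\chi(\xi_j-\xi_k)\ge0$ for all $n\in\mathbb{N}$, $\xi_j\in E$, $\alpha_j\in\mathbb{C}$, and $\chi|_R$ is continuous for the Euclidean topology on each $R\in\mathcal{R}$. By the Bochner–Minlos theorem there is a unique measure $\mu$ on $(E^a,\mathcal{B}_E)$ with $\chi(\xi)=\int e^{i\ell(\xi)}\,\mathrm{d}\mu(\ell)$ for all $\xi\in E$. When $E$ is nuclear and $\chi$ is continuous, a known theorem says that $\mu$ lies on $E'$, and one regards $\mu$ as a measure on $(E',\mathcal{S}_E)$ by $\mu(B\cap E'):=\mu(B)$, $B\in\mathcal{B}_E$; it again satisfies $\chi(\xi)=\int_{E'}e^{i\ell(\xi)}\,\mathrm{d}\mu(\ell)$. For $R\in\mathcal{R}$, $\mu_R$ is the Borel measure on $R^a$ corresponding to $\chi|_R$. For $R\le F$, $\pi_{RF}:F^a\to R^a$, $\pi_{RF}(\ell)=\ell|_R$; and $\varphi_R:E'\to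 R^a$, $\varphi_R(\ell)=\ell|_R$. These maps are measure preserving. $L^p$ spaces are of real-valued functions, $f^*(u)=u\circ f$; $\mathbb{E}_R(f)$ lies in the range of the isometry $\varphi_R^*$. $\mathfrak{R}$ denotes the diagram $(R^a,\mu_R,\pi_{RF})$ indexed by $\mathcal{R}$. A family $(f_R)_R\in\prod_{R}L^p(R^a,\mu_R)$ is co-Cauchy if for every $\varepsilon>0$ there is $R_0\in\mathcal{R}$ with $\|\pi_{RF}^*(f_R)-f_F\|_{L^p(\mu_F)}<\varepsilon$ whenever $R_0\le R\le F$. $\mathscr{L}^p(\mathfrak{R})$ is the vector space of co-Cauchy families modulo $(f_R)\sim(g_R)$ iff $\lim_{R\in\mathcal{R}}\|f_R-g_R\|_{L^p(\mu_R)}=0$ (net limit), with norm $\lim_{R\in\mathcal{R}}\|f_R\|_{L^p(\mu_R)}$. $\psi_R:L^p(R^a,\mu_R)\to\mathscr{L}^p(\mathfrak{R})$ sends $f_R$ to the class of $(g_F)_{F\in\mathcal{R}}$ with $g_F=\pi_{RF}^*(f_R)$ if $R\le F$ and $g_F=0$ otherwise. $\mathfrak{Ban}$ is the category of Banach spaces with linear isometries (not necessarily surjective) as morphisms. A cocone of a codiagram $(Z_R,\varphi_{RF}:Z_R\to Z_F)$ is a Banach space $Y$ with linear isometries $\psi_R:Z_R\to Y$ satisfying $\psi_R=\psi_F\circ\varphi_{RF}$ for $R\le F$; it is a realization of the colimit if for every cocone $(Y',\rho_R)$ there is a unique linear isometry $\varphi:Y\to Y'$ with $\varphi\circ\psi_R=\rho_R$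 for all $R$. An isomorphism of cocones $(Y,\psi_R)\to(Y',\rho_R)$ is a surjective linear isometry $T:Y\to Y'$ with $T\circ\psi_R=\rho_R$ for all $R$. *)

theory Defs
  imports "HOL-Probability.Probability"
begin

section \<open>Banach spaces with linear isometries\<close>

text \<open>The spaces \<open>L\<^sup>p(R\<^sup>a, \<mu>\<^sub>R)\<close> depend on a subspace \<open>R\<close>, so they cannot be types of class
  \<open>banach\<close>; a normed space is therefore given by a carrier set with operations.  What the
  operations do outside the carrier is irrelevant.\<close>

record 'a nspace =
  vcarrier :: "'a set"
  vzero :: 'a
  vadd :: "'a \<Rightarrow> 'a \<Rightarrow> 'a"
  vscale :: "real \<Rightarrow> 'a \<Rightarrow> 'a"
  vnorm :: "'a \<Rightarrow> real"

text \<open>The distance is set to 0 outside the carrier because the locale \<open>Metric_space\<close> asks for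
  symmetry and nonnegativity on the whole type.\<close>

definition vdist :: "'a nspace \<Rightarrow> 'a \<Rightarrow> 'a \<Rightarrow> real" where
  "vdist V x y =
     (if x \<in> vcarrier V \<and> y \<in> vcarrier V then vnorm V (vadd V x (vscale V (-1) y)) else 0)"

definition real_vs :: "'a nspace \<Rightarrow> bool" where
  "real_vs V \<longleftrightarrow>
     vzero V \<in> vcarrier V \<and>
     (\<forall>x\<in>vcarrier V. \<forall>y\<in>vcarrier V. vadd V x y \<in> vcarrier V) \<and>
     (\<forall>a. \<forall>x\<in>vcarrier V. vscale V a x \<in> vcarrier V) \<and>
     (\<forall>x\<in>vcarrier V. \<forall>y\<in>vcarrier V. \<forall>z\<in>vcarrier V.
        vadd V (vadd V x y) z = vadd V x (vadd V y z)) \<and>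
     (\<forall>x\<in>vcarrier V. \<forall>y\<in>vcarrier V. vadd V x y = vadd V y x) \<and>
     (\<forall>x\<in>vcarrier V. vadd V (vzero V) x = x) \<and>
     (\<forall>x\<in>vcarrier V. vadd V x (vscale V (-1) x) = vzero V) \<and>
     (\<forall>a. \<forall>x\<in>vcarrier V. \<forall>y\<in>vcarrier V.
        vscale V a (vadd V x y) = vadd V (vscale V a x) (vscale V a y)) \<and>
     (\<forall>a b. \<forall>x\<in>vcarrier V. vscale V (a + b) x = vadd V (vscale V a x) (vscale V b x)) \<and>
     (\<forall>a b. \<forall>x\<in>vcarrier V. vscale V a (vscale V b x) = vscale V (a * b) x) \<and>
     (\<forall>x\<in>vcarrier V. vscale V 1 x = x)"

definition banach_space :: "'a nspace \<Rightarrow> bool" where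
  "banach_space V \<longleftrightarrow>
     real_vs V \<and>
     (\<forall>x\<in>vcarrier V. 0 \<le> vnorm V x) \<and>
     (\<forall>x\<in>vcarrier V. vnorm V x = 0 \<longleftrightarrow> x = vzero V) \<and>
     (\<forall>a. \<forall>x\<in>vcarrier V. vnorm V (vscale V a x) = \<bar>a\<bar> * vnorm V x) \<and>
     (\<forall>x\<in>vcarrier V. \<forall>y\<in>vcarrier V. vnorm V (vadd V x y) \<le> vnorm V x + vnorm V y) \<and>
     Metric_space.mcomplete (vcarrier V) (vdist V)"

definition lin_isometry :: "'a nspace \<Rightarrow> 'b nspace \<Rightarrow> ('a \<Rightarrow> 'b) \<Rightarrow> bool" where
  "lin_isometry V W T \<longleftrightarrow>
     T \<in> vcarrier V \<rightarrow> vcarrier W \<and>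
     (\<forall>x\<in>vcarrier V. \<forall>y\<in>vcarrier V. T (vadd V x y) = vadd W (T x) (T y)) \<and>
     (\<forall>a. \<forall>x\<in>vcarrier V. T (vscale V a x) = vscale W a (T x)) \<and>
     (\<forall>x\<in>vcarrier V. vnorm W (T x) = vnorm V x)"


section \<open>Codiagrams, cocones and colimits\<close>

definition codiagram ::
  "'i::order set \<Rightarrow> ('i \<Rightarrow> 'z nspace) \<Rightarrow> ('i \<Rightarrow> 'i \<Rightarrow> 'z \<Rightarrow> 'z) \<Rightarrow> bool" where
  "codiagram I Z \<phi> \<longleftrightarrow>
     (\<forall>R\<in>I. banach_space (Z R)) \<and>
     (\<forall>R\<in>I. \<forall>F\<in>I. R \<le> F \<longrightarrow> lin_isometry (Z R) (Z F) (\<phi> R F)) \<and>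
     (\<forall>R\<in>I. \<forall>x\<in>vcarrier (Z R). \<phi> R R x = x) \<and>
     (\<forall>R\<in>I. \<forall>F\<in>I. \<forall>G\<in>I. R \<le> F \<longrightarrow> F \<le> G \<longrightarrow>
        (\<forall>x\<in>vcarrier (Z R). \<phi> F G (\<phi> R F x) = \<phi> R G x))"

definition cocone ::
  "'i::order set \<Rightarrow> ('i \<Rightarrow> 'z nspace) \<Rightarrow> ('i \<Rightarrow> 'i \<Rightarrow> 'z \<Rightarrow> 'z) \<Rightarrow>
   'y nspace \<Rightarrow> ('i \<Rightarrow> 'z \<Rightarrow> 'y) \<Rightarrow> bool" where
  "cocone I Z \<phi> Y \<psi> \<longleftrightarrow>
     banach_space Y \<and>
     (\<forall>R\<in>I. lin_isometry (Z R) Y (\<psi> R)) \<and>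
     (\<forall>R\<in>I. \<forall>F\<in>I. R \<le> F \<longrightarrow> (\<forall>x\<in>vcarrier (Z R). \<psi> R x = \<psi> F (\<phi> R F x)))"

text \<open>The competing cocones range over all Banach spaces whose carrier is a set of elements of
  \<open>'w\<close>.  A theorem with \<open>'w\<close> a free type variable is thus about arbitrary cocones.  Maps out of
  \<open>Y\<close> are made extensional so that \<open>\<exists>!\<close> means uniqueness on the carrier.\<close>

definition colimit ::
  "'w itself \<Rightarrow> 'i::order set \<Rightarrow> ('i \<Rightarrow> 'z nspace) \<Rightarrow> ('i \<Rightarrow> 'i \<Rightarrow> 'z \<Rightarrow> 'z) \<Rightarrow>
   'y nspace \<Rightarrow> ('i \<Rightarrow> 'z \<Rightarrow> 'y) \<Rightarrow> bool" where
  "colimit _ I Z \<phi> Y \<psi> \<longleftrightarrow>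
     codiagram I Z \<phi> \<and>
     cocone I Z \<phi> Y \<psi> \<and>
     (\<forall>(Y' :: 'w nspace) \<rho>. cocone I Z \<phi> Y' \<rho> \<longrightarrow>
        (\<exists>!T. T \<in> extensional (vcarrier Y) \<and> lin_isometry Y Y' T \<and>
              (\<forall>R\<in>I. \<forall>x\<in>vcarrier (Z R). T (\<psi> R x) = \<rho> R x)))"

definition cocone_iso ::
  "'i::order set \<Rightarrow> ('i \<Rightarrow> 'z nspace) \<Rightarrow> 'y nspace \<Rightarrow> ('i \<Rightarrow> 'z \<Rightarrow> 'y) \<Rightarrow>
   'w nspace \<Rightarrow> ('i \<Rightarrow> 'z \<Rightarrow> 'w) \<Rightarrow> ('y \<Rightarrow> 'w) \<Rightarrow> bool" where
  "cocone_iso I Z Y \<psi> Y' \<rho> T \<longleftrightarrow>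
     lin_isometry Y Y' T \<and>
     T ` vcarrier Y = vcarrier Y' \<and>
     (\<forall>R\<in>I. \<forall>x\<in>vcarrier (Z R). T (\<psi> R x) = \<rho> R x)"


section \<open>Co-Cauchy families\<close>

text \<open>For a directed set \<open>I\<close>, convergence along this filter is convergence of nets indexed
  by \<open>I\<close>.\<close>

definition net :: "'i::order set \<Rightarrow> 'i filter" where
  "net I = (INF R0\<in>I. principal {R\<in>I. R0 \<le> R})"

definition co_Cauchy ::
  "'i::order set \<Rightarrow> ('i \<Rightarrow> 'z nspace) \<Rightarrow> ('i \<Rightarrow> 'i \<Rightarrow> 'z \<Rightarrow> 'z) \<Rightarrow> ('i \<Rightarrow> 'z) set" where
  "co_Cauchy I Z \<phi> =
     {f \<in> (\<Pi>\<^sub>E R\<in>I. vcarrier (Z R)).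
        \<forall>\<epsilon>>0. \<exists>R0\<in>I. \<forall>R\<in>I. \<forall>F\<in>I. R0 \<le> R \<and> R \<le> F \<longrightarrow> vdist (Z F) (\<phi> R F (f R)) (f F) < \<epsilon>}"

definition co_Cauchy_rel ::
  "'i::order set \<Rightarrow> ('i \<Rightarrow> 'z nspace) \<Rightarrow> ('i \<Rightarrow> 'i \<Rightarrow> 'z \<Rightarrow> 'z) \<Rightarrow> (('i \<Rightarrow> 'z) \<times> ('i \<Rightarrow> 'z)) set" where
  "co_Cauchy_rel I Z \<phi> =
     {(f, g). f \<in> co_Cauchy I Z \<phi> \<and> g \<in> co_Cauchy I Z \<phi> \<and>
              ((\<lambda>R. vdist (Z R) (f R) (g R)) \<longlongrightarrow> 0) (net I)}"

definition co_Cauchy_space ::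
  "'i::order set \<Rightarrow> ('i \<Rightarrow> 'z nspace) \<Rightarrow> ('i \<Rightarrow> 'i \<Rightarrow> 'z \<Rightarrow> 'z) \<Rightarrow> ('i \<Rightarrow> 'z) set nspace" where
  "co_Cauchy_space I Z \<phi> =
     \<lparr> vcarrier = co_Cauchy I Z \<phi> // co_Cauchy_rel I Z \<phi>,
       vzero = co_Cauchy_rel I Z \<phi> `` {\<lambda>R\<in>I. vzero (Z R)},
       vadd = (\<lambda>X Y. \<Union>f\<in>X. \<Union>g\<in>Y. co_Cauchy_rel I Z \<phi> `` {\<lambda>R\<in>I. vadd (Z R) (f R) (g R)}),
       vscale = (\<lambda>a X. \<Union>f\<in>X. co_Cauchy_rel I Z \<phi> `` {\<lambda>R\<in>I. vscale (Z R) a (f R)}),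
       vnorm = (\<lambda>X. the_elem ((\<lambda>f. Lim (net I) (\<lambda>R. vnorm (Z R) (f R))) ` X)) \<rparr>"

definition co_Cauchy_inj ::
  "'i::order set \<Rightarrow> ('i \<Rightarrow> 'z nspace) \<Rightarrow> ('i \<Rightarrow> 'i \<Rightarrow> 'z \<Rightarrow> 'z) \<Rightarrow> 'i \<Rightarrow> 'z \<Rightarrow> ('i \<Rightarrow> 'z) set" where
  "co_Cauchy_inj I Z \<phi> R x =
     co_Cauchy_rel I Z \<phi> `` {\<lambda>F\<in>I. if R \<le> F then \<phi> R F x else vzero (Z F)}"


section \<open>The spaces \<open>L\<^sup>p\<close>\<close>

definition Lp_fun :: "real \<Rightarrow> 'x measure \<Rightarrow> ('x \<Rightarrow> real) set" where
  "Lp_fun p M = {f \<in> borel_measurable M. integrable M (\<lambda>x. \<bar>f x\<bar> powr p)}"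

definition Lp_rel :: "real \<Rightarrow> 'x measure \<Rightarrow> (('x \<Rightarrow> real) \<times> ('x \<Rightarrow> real)) set" where
  "Lp_rel p M = {(f, g). f \<in> Lp_fun p M \<and> g \<in> Lp_fun p M \<and> (AE x in M. f x = g x)}"

definition Lp_space :: "real \<Rightarrow> 'x measure \<Rightarrow> ('x \<Rightarrow> real) set nspace" where
  "Lp_space p M =
     \<lparr> vcarrier = Lp_fun p M // Lp_rel p M,
       vzero = Lp_rel p M `` {\<lambda>x. 0},
       vadd = (\<lambda>X Y. \<Union>f\<in>X. \<Union>g\<in>Y. Lp_rel p M `` {\<lambda>x. f x + g x}),
       vscale = (\<lambda>a X. \<Union>f\<in>X. Lp_rel p M `` {\<lambda>x. a * f x}),
       vnorm = (\<lambda>X. the_elem ((\<lambda>f. (\<integral>x. \<bar>f x\<bar> powr p \<partial>M) powr (1 / p)) ` X)) \<rparr>"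

text \<open>The map \<open>u\<^sup>*\<close> on classes, where \<open>M\<close> is the measure on the domain of \<open>u\<close>.\<close>

definition Lp_pull ::
  "real \<Rightarrow> 'x measure \<Rightarrow> ('x \<Rightarrow> 'y) \<Rightarrow> ('y \<Rightarrow> real) set \<Rightarrow> ('x \<Rightarrow> real) set" where
  "Lp_pull p M u X = (\<Union>f\<in>X. Lp_rel p M `` {f \<circ> u})"

definition Lp_cond_exp ::
  "real \<Rightarrow> 'x measure \<Rightarrow> 'x measure \<Rightarrow> ('x \<Rightarrow> real) set \<Rightarrow> ('x \<Rightarrow> real) set" where
  "Lp_cond_exp p M F X = (\<Union>f\<in>X. Lp_rel p M `` {real_cond_exp M F f})"


section \<open>Nuclear topological vector spaces\<close>

class topological_real_vector = real_vector + topological_ab_group_add +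
  assumes tendsto_scaleR_Pair:
    "LIM z (nhds (c::real) \<times>\<^sub>F nhds (x::'a)). fst z *\<^sub>R snd z :> nhds (c *\<^sub>R x)"

lemma continuous_on_scaleR_Pair:
  "continuous_on UNIV (\<lambda>z :: real \<times> 'a::topological_real_vector. fst z *\<^sub>R snd z)"
  unfolding continuous_on_def
proof
  fix z :: "real \<times> 'a"
  obtain c x where z: "z = (c, x)" by (cases z)
  have "((\<lambda>z. fst z *\<^sub>R snd z) \<longlongrightarrow> c *\<^sub>R x) (at (c, x))"
    using tendsto_scaleR_Pair[of c x]
    by (intro tendsto_mono[OF at_within_le_nhds]) (simp add: nhds_prod)
  then show "((\<lambda>z. fst z *\<^sub>R snd z) \<longlongrightarrow> fst z *\<^sub>R snd z) (at z within UNIV)"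
    by (simp add: z)
qed

definition seminorm :: "('a::real_vector \<Rightarrow> real) \<Rightarrow> bool" where
  "seminorm p \<longleftrightarrow> (\<forall>x y. p (x + y) \<le> p x + p y) \<and> (\<forall>a x. p (a *\<^sub>R x) = \<bar>a\<bar> * p x)"

text \<open>Let \<open>E\<^sub>p\<close> be \<open>E / {x. p x = 0}\<close> normed by \<open>p\<close>.  For \<open>p \<le> q\<close> the following says that the
  canonical map \<open>E\<^sub>q \<rightarrow> E\<^sub>p\<close>, equivalently its extension to the completions, is nuclear, i.e.\ that
  \<open>x = (\<Sum>k. \<lambda>\<^sub>k f\<^sub>k(x) y\<^sub>k)\<close> in \<open>E\<^sub>p\<close> with \<open>(\<lambda>\<^sub>k)\<close> absolutely summable, \<open>(f\<^sub>k)\<close> bounded in the dual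
  of \<open>E\<^sub>q\<close> and \<open>(y\<^sub>k)\<close> bounded in \<open>E\<^sub>p\<close>.  Vectors \<open>y\<^sub>k\<close> from the completion of \<open>E\<^sub>p\<close> would give
  nothing more, since each of them is the sum of an absolutely convergent series in \<open>E\<^sub>p\<close> whose
  norms add up to at most twice the norm of \<open>y\<^sub>k\<close>.\<close>

definition nuclear_canonical_map :: "('a::real_vector \<Rightarrow> real) \<Rightarrow> ('a \<Rightarrow> real) \<Rightarrow> bool" where
  "nuclear_canonical_map q p \<longleftrightarrow>
     (\<exists>(l :: nat \<Rightarrow> real) (f :: nat \<Rightarrow> 'a \<Rightarrow> real) (y :: nat \<Rightarrow> 'a) C.
        summable (\<lambda>k. \<bar>l k\<bar>) \<and>
        (\<forall>k. linear (f k) \<and> (\<forall>x. \<bar>f k x\<bar> \<le> C * q x)) \<and>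
        (\<forall>k. p (y k) \<le> C) \<and>
        (\<forall>x. (\<lambda>n. p (x - (\<Sum>k<n. (l k * f k x) *\<^sub>R y k))) \<longlonglongrightarrow> 0))"

text \<open>Nuclear spaces in the sense of Grothendieck.  The Hausdorff property, which some authors
  include, is not required.\<close>

definition nuclear_tvs :: "'e::topological_real_vector itself \<Rightarrow> bool" where
  "nuclear_tvs _ \<longleftrightarrow>
     (\<forall>U :: 'e set. open U \<and> 0 \<in> U \<longrightarrow> (\<exists>V. open V \<and> convex V \<and> 0 \<in> V \<and> V \<subseteq> U)) \<and>
     (\<forall>p :: 'e \<Rightarrow> real. seminorm p \<and> continuous_on UNIV p \<longrightarrow>
        (\<exists>q. seminorm q \<and> continuous_on UNIV q \<and> (\<forall>x. p x \<le> q x) \<and> nuclear_canonical_map q p))"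


section \<open>Duals and their \<open>\<sigma>\<close>-algebras\<close>

definition findim_subspaces :: "'e::real_vector set set" where
  "findim_subspaces = {R. subspace R \<and> (\<exists>B. finite B \<and> span B = R)}"

text \<open>Linear functionals on a subspace \<open>R\<close> are extensional functions, so the restriction of
  functionals is literally \<open>restrict\<close>.  The algebraic dual of the whole space is
  \<open>alg_dual UNIV\<close>.\<close>

definition alg_dual :: "'e::real_vector set \<Rightarrow> ('e \<Rightarrow> real) set" where
  "alg_dual R = {l \<in> extensional R.
     (\<forall>x\<in>R. \<forall>y\<in>R. l (x + y) = l x + l y) \<and> (\<forall>a. \<forall>x\<in>R. l (a *\<^sub>R x) = a * l x)}"

lemma alg_dual_UNIV: "alg_dual UNIV = {l. linear l}"
  by (auto simp: alg_dual_def linear_iff)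

definition top_dual :: "('e::topological_real_vector \<Rightarrow> real) set" where
  "top_dual = {l. linear l \<and> continuous_on UNIV l}"

text \<open>The algebra \<open>\<B>\<^sub>E\<close> on \<open>E\<^sup>a\<close>, and its trace \<open>\<S>\<^sub>E\<close> on \<open>E'\<close>.  These are used as measurable spaces
  only.\<close>

definition dual_algebra :: "('e::real_vector \<Rightarrow> real) measure" where
  "dual_algebra =
     sigma (alg_dual UNIV) {(\<lambda>l. l \<xi>) -` B \<inter> alg_dual UNIV |\<xi> B. B \<in> sets borel}"

definition top_dual_algebra :: "('e::topological_real_vector \<Rightarrow> real) measure" where
  "top_dual_algebra = restrict_space dual_algebra top_dual"

text \<open>The topology of pointwise convergence on \<open>R\<^sup>a\<close>.  For finite dimensional \<open>R\<close> this is the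
  Euclidean topology: evaluation at a basis is a homeomorphism onto a power of the real line.\<close>

definition dual_topology :: "'e::real_vector set \<Rightarrow> ('e \<Rightarrow> real) topology" where
  "dual_topology R = subtopology (product_topology (\<lambda>_. euclideanreal) R) (alg_dual R)"

lemma alg_dual_sum:
  assumes "l \<in> alg_dual R" "subspace R" "finite B" "B \<subseteq> R"
  shows "l (\<Sum>b\<in>B. c b *\<^sub>R b) = (\<Sum>b\<in>B. c b * l b)"
  using assms(3,4)
proof (induction B rule: finite_induct)
  case empty
  have "l (0 *\<^sub>R 0) = 0 * l 0"
    using assms(1) subspace_0[OF assms(2)] unfolding alg_dual_def by blast
  then show ?case by simp
next
  case (insert b B)
  have "(\<Sum>b\<in>B. c b *\<^sub>R b) \<in> R"
    using insert.prems by (intro subspace_sum[OF assms(2)] subspace_scale[OF assms(2)]) auto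
  moreover have "c b *\<^sub>R b \<in> R"
    using insert.prems by (intro subspace_scale[OF assms(2)]) auto
  ultimately have "l (c b *\<^sub>R b + (\<Sum>b\<in>B. c b *\<^sub>R b)) = c b * l b + l (\<Sum>b\<in>B. c b *\<^sub>R b)"
    using assms(1) insert.prems by (simp add: alg_dual_def)
  then show ?case using insert by simp
qed

lemma homeomorphic_map_dual_topology:
  fixes B :: "'e::real_vector set"
  assumes "finite B" "independent B"
  shows "homeomorphic_map (dual_topology (span B)) (product_topology (\<lambda>_. euclideanreal) B)
           (\<lambda>l. restrict l B)"
proof -
  let ?g = "\<lambda>c. \<lambda>x\<in>span B. \<Sum>b\<in>B. representation B x b * c b"
  let ?X = "dual_topology (span B)" and ?Y = "product_topology (\<lambda>_. euclideanreal) B"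
  have topX: "topspace ?X = alg_dual (span B)"
    by (auto simp: dual_topology_def alg_dual_def PiE_def)
  have "continuous_map ?X ?Y (\<lambda>l. restrict l B)"
    unfolding continuous_map_componentwise
  proof (intro conjI ballI)
    show "(\<lambda>l. restrict l B) ` topspace ?X \<subseteq> extensional B" by auto
  next
    fix k assume k: "k \<in> B"
    then have "continuous_map (product_topology (\<lambda>_. euclideanreal) (span B)) euclideanreal (\<lambda>l. l k)"
      by (intro continuous_map_product_projection) (auto intro: span_base)
    then show "continuous_map ?X euclideanreal (\<lambda>l. restrict l B k)"
      using k by (simp add: dual_topology_def continuous_map_from_subtopology)
  qed
  moreover have "continuous_map ?Y ?X ?g"
    unfolding dual_topology_def continuous_map_in_subtopology continuous_map_componentwise
  proof (intro conjI ballI)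
    fix k assume "k \<in> span B"
    then show "continuous_map ?Y euclideanreal (\<lambda>c. ?g c k)"
      using assms(1)
      by (auto intro!: continuous_map_sum continuous_map_real_mult_left
          continuous_map_product_projection)
  next
    show "?g \<in> topspace ?Y \<rightarrow> alg_dual (span B)"
      using assms by (auto simp: alg_dual_def span_add span_scale representation_add
          representation_scale algebra_simps sum.distrib sum_distrib_left)
  qed auto
  moreover have "?g (restrict l B) = l" if "l \<in> topspace ?X" for l
  proof
    fix x
    have l: "l \<in> alg_dual (span B)" using that topX by simp
    show "?g (restrict l B) x = l x"
    proof (cases "x \<in> span B")
      case True
      then have "x = (\<Sum>b\<in>B. representation B x b *\<^sub>R b)"
        using assms sum_representation_eq[of B x B] by simp
      then have "l x = l (\<Sum>b\<in>B. representation B x b *\<^sub>R b)" by simp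
      also have "\<dots> = (\<Sum>b\<in>B. representation B x b * l b)"
        using alg_dual_sum[OF l subspace_span assms(1) span_superset] .
      finally show ?thesis using True by simp
    next
      case False
      then show ?thesis using l by (simp add: alg_dual_def extensional_def)
    qed
  qed
  moreover have "restrict (?g c) B = c" if "c \<in> topspace ?Y" for c
  proof
    fix x
    show "restrict (?g c) B x = c x"
    proof (cases "x \<in> B")
      case True
      then have "(\<Sum>b\<in>B. representation B x b * c b) = (\<Sum>b\<in>B. if b = x then c b else 0)"
        using assms by (intro sum.cong) (auto simp: representation_basis)
      then show ?thesis using True assms by (simp add: span_base)
    next
      case False
      then show ?thesis using that by (auto simp: PiE_def extensional_def)
    qed
  qed
  ultimately have "homeomorphic_maps ?X ?Y (\<lambda>l. restrict l B) ?g"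
    by (simp add: homeomorphic_maps_def)
  then show ?thesis by (auto simp: homeomorphic_map_maps)
qed

definition dual_borel :: "'e::real_vector set \<Rightarrow> ('e \<Rightarrow> real) measure" where
  "dual_borel R = sigma (alg_dual R) {U. openin (dual_topology R) U}"


section \<open>Characteristic functions and their measures\<close>

text \<open>Continuity on a finite dimensional subspace is expressed in the coordinates with respect to
  its bases \<open>B\<close>.\<close>

definition characteristic_function :: "('e::real_vector \<Rightarrow> complex) \<Rightarrow> bool" where
  "characteristic_function chi \<longleftrightarrow>
     (\<forall>(n::nat) (\<xi> :: nat \<Rightarrow> 'e) (\<alpha> :: nat \<Rightarrow> complex).
        (\<Sum>j<n. \<Sum>k<n. \<alpha> j * cnj (\<alpha> k) * chi (\<xi> j - \<xi> k)) \<in> \<real>\<^sub>\<ge>\<^sub>0) \<and>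
     (\<forall>B. finite B \<and> independent B \<longrightarrow>
        continuous_map (product_topology (\<lambda>_. euclideanreal) B) euclidean
          (\<lambda>c. chi (\<Sum>b\<in>B. c b *\<^sub>R b)))"

definition has_char_function_on ::
  "('e \<Rightarrow> real) measure \<Rightarrow> ('e \<Rightarrow> complex) \<Rightarrow> 'e set \<Rightarrow> bool" where
  "has_char_function_on M chi R \<longleftrightarrow>
     finite_measure M \<and> (\<forall>\<xi>\<in>R. chi \<xi> = (CLINT l|M. iexp (l \<xi>)))"

text \<open>The first component is the measure on \<open>(E\<^sup>a, \<B>\<^sub>E)\<close> given by the Bochner--Minlos theorem; the
  last says that it lies on \<open>E'\<close> and is regarded as the measure \<open>\<mu>\<close> on \<open>(E', \<S>\<^sub>E)\<close>.\<close>

definition corresponding_measure ::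
  "('e::topological_real_vector \<Rightarrow> complex) \<Rightarrow> ('e \<Rightarrow> real) measure \<Rightarrow> bool" where
  "corresponding_measure chi \<mu> \<longleftrightarrow>
     (\<exists>\<nu>. sets \<nu> = sets dual_algebra \<and> has_char_function_on \<nu> chi UNIV \<and>
          sets \<mu> = sets top_dual_algebra \<and>
          (\<forall>B\<in>sets dual_algebra. emeasure \<mu> (B \<inter> top_dual) = emeasure \<nu> B))"

definition fd_measure :: "('e::real_vector \<Rightarrow> complex) \<Rightarrow> 'e set \<Rightarrow> ('e \<Rightarrow> real) measure" where
  "fd_measure chi R = (THE M. sets M = sets (dual_borel R) \<and> has_char_function_on M chi R)"


section \<open>The codiagram of \<open>L\<^sup>p\<close> spaces and its cocones\<close>

definition Lp_fd :: "real \<Rightarrow> ('e::real_vector \<Rightarrow> complex) \<Rightarrow> 'e set \<Rightarrow> (('e \<Rightarrow> real) \<Rightarrow> real) set nspace"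
  where "Lp_fd p chi R = Lp_space p (fd_measure chi R)"

definition pi_pull ::
  "real \<Rightarrow> ('e::real_vector \<Rightarrow> complex) \<Rightarrow> 'e set \<Rightarrow> 'e set \<Rightarrow>
   (('e \<Rightarrow> real) \<Rightarrow> real) set \<Rightarrow> (('e \<Rightarrow> real) \<Rightarrow> real) set" where
  "pi_pull p chi R F = Lp_pull p (fd_measure chi F) (\<lambda>l. restrict l R)"

definition phi_pull ::
  "real \<Rightarrow> ('e \<Rightarrow> real) measure \<Rightarrow> 'e set \<Rightarrow>
   (('e \<Rightarrow> real) \<Rightarrow> real) set \<Rightarrow> (('e \<Rightarrow> real) \<Rightarrow> real) set" where
  "phi_pull p \<mu> R = Lp_pull p \<mu> (\<lambda>l. restrict l R)"

abbreviation scriptL ::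
  "real \<Rightarrow> ('e::real_vector \<Rightarrow> complex) \<Rightarrow> ('e set \<Rightarrow> (('e \<Rightarrow> real) \<Rightarrow> real) set) set nspace" where
  "scriptL p chi \<equiv> co_Cauchy_space findim_subspaces (Lp_fd p chi) (pi_pull p chi)"

abbreviation psi ::
  "real \<Rightarrow> ('e::real_vector \<Rightarrow> complex) \<Rightarrow> 'e set \<Rightarrow>
   (('e \<Rightarrow> real) \<Rightarrow> real) set \<Rightarrow> ('e set \<Rightarrow> (('e \<Rightarrow> real) \<Rightarrow> real) set) set" where
  "psi p chi \<equiv> co_Cauchy_inj findim_subspaces (Lp_fd p chi) (pi_pull p chi)"

text \<open>The limit \<open>lim\<^bsub>R\<^esub> \<phi>\<^sub>R\<^sup>*(f\<^sub>R) = g\<close> in the norm of \<open>L\<^sup>p(E', \<mu>)\<close>.\<close>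

definition has_phi_limit ::
  "real \<Rightarrow> ('e::real_vector \<Rightarrow> real) measure \<Rightarrow> ('e set \<Rightarrow> (('e \<Rightarrow> real) \<Rightarrow> real) set) \<Rightarrow>
   (('e \<Rightarrow> real) \<Rightarrow> real) set \<Rightarrow> bool" where
  "has_phi_limit p \<mu> f g \<longleftrightarrow>
     limitin (Metric_space.mtopology (vcarrier (Lp_space p \<mu>)) (vdist (Lp_space p \<mu>)))
       (\<lambda>R. phi_pull p \<mu> R (f R)) g (net findim_subspaces)"

definition frakL ::
  "real \<Rightarrow> ('e::real_vector \<Rightarrow> real) measure \<Rightarrow> ('e set \<Rightarrow> (('e \<Rightarrow> real) \<Rightarrow> real) set) set \<Rightarrow>
   (('e \<Rightarrow> real) \<Rightarrow> real) set" where
  "frakL p \<mu> X = (THE g. \<forall>f\<in>X. has_phi_limit p \<mu> f g)"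

definition cyl_algebra ::
  "'e::topological_real_vector set \<Rightarrow> ('e \<Rightarrow> real) measure" where
  "cyl_algebra R = vimage_algebra top_dual (\<lambda>l. restrict l R) (dual_borel R)"

definition cond_E ::
  "real \<Rightarrow> ('e::topological_real_vector \<Rightarrow> real) measure \<Rightarrow> 'e set \<Rightarrow>
   (('e \<Rightarrow> real) \<Rightarrow> real) set \<Rightarrow> (('e \<Rightarrow> real) \<Rightarrow> real) set" where
  "cond_E p \<mu> R = Lp_cond_exp p \<mu> (cyl_algebra R)"

definition frakL_inv ::
  "real \<Rightarrow> ('e::topological_real_vector \<Rightarrow> complex) \<Rightarrow> ('e \<Rightarrow> real) measure \<Rightarrow>
   (('e \<Rightarrow> real) \<Rightarrow> real) set \<Rightarrow> ('e set \<Rightarrow> (('e \<Rightarrow> real) \<Rightarrow> real) set) set" where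
  "frakL_inv p chi \<mu> f =
     co_Cauchy_rel findim_subspaces (Lp_fd p chi) (pi_pull p chi) ``
       {\<lambda>R\<in>findim_subspaces. inv_into (vcarrier (Lp_fd p chi R)) (phi_pull p \<mu> R) (cond_E p \<mu> R f)}"

end

theory Submission
  imports Defs
begin

text \<open>
  The restriction maps are measure preserving, so pulling back along them is isometric and
  \<open>(L\<^sup>p(E', \<mu>), \<phi>\<^sub>R\<^sup>*)\<close> is a cocone.  What makes it the colimit is density: the \<open>\<sigma>\<close>-algebra of \<open>E'\<close>
  is generated by the cylinder sets \<open>\<phi>\<^sub>R\<^sup>-\<^sup>1(B)\<close>, hence functions of the form \<open>h \<circ> \<phi>\<^sub>R\<close> are dense in
  \<open>L\<^sup>p(E', \<mu>)\<close> (\<open>cylinder_functions_dense\<close>).  Conditional expectations contract the norm and fix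
  \<open>h \<circ> \<phi>\<^sub>R\<close> as soon as they are taken over a subspace containing \<open>R\<close>, so density upgrades to
  \<open>\<E>\<^sub>R(f) \<longlongrightarrow> f\<close> along the net (\<open>cond_E_limit\<close>), and \<open>\<E>\<^sub>R(f)\<close> is a function of \<open>\<phi>\<^sub>R\<close>
  (\<open>cond_E_in_range\<close>).  Thus every element of \<open>L\<^sup>p(E', \<mu>)\<close> is the limit of the images of a
  family indexed by \<open>R\<close>, chosen canonically.

  The rest is a general fact about a cocone \<open>(Y, \<psi>\<^sub>R)\<close> in which every element is such a limit
  (locale \<open>approximating_cocone\<close>).  As the injections of a cocone are isometric, a family is
  co-Cauchy exactly if its images converge in one, equivalently in any, cocone; its norm and the
  relation of being equivalent to another family can be read off from the limit.  Therefore
  \<open>lim \<psi>\<^sub>R(f\<^sub>R) \<mapsto> lim \<rho>\<^sub>R(f\<^sub>R)\<close> is a well defined isometry into any cocone \<open>(W, \<rho>\<^sub>R)\<close>, and the only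
  one compatible with the injections; this is the universal property.  The map sending a class of
  co-Cauchy families to its limit is an isometric linear bijection onto \<open>Y\<close>, and through it
  the space of co-Cauchy families inherits completeness and the universal property.

  To see that \<open>\<mu>\<^sub>R\<close>, which is characterised by \<open>\<chi>\<close> restricted to \<open>R\<close>, is the image of \<open>\<mu>\<close>, one needs
  that a finite Borel measure on the dual of a finite dimensional space is determined by its
  characteristic function (\<open>fd_char_function_unique\<close>).  This is deduced from the one-dimensional
  theorem of Levy by replacing the characters \<open>exp(i t l(b))\<close> of the coordinates of \<open>l\<close> with
  indicator functions, one coordinate at a time (\<open>joint_Levy_uniqueness\<close>).
\<close>

section \<open>Normed spaces with a carrier\<close>

locale norm_nspace =
  fixes V :: "'a nspace"
  assumes vs: "real_vs V"
    and norm_nonneg: "\<And>x. x \<in> vcarrier V \<Longrightarrow> 0 \<le> vnorm V x"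
    and norm_eq_0_iff: "\<And>x. x \<in> vcarrier V \<Longrightarrow> vnorm V x = 0 \<longleftrightarrow> x = vzero V"
    and norm_scale: "\<And>a x. x \<in> vcarrier V \<Longrightarrow> vnorm V (vscale V a x) = \<bar>a\<bar> * vnorm V x"
    and norm_triangle: "\<And>x y. \<lbrakk>x \<in> vcarrier V; y \<in> vcarrier V\<rbrakk>
      \<Longrightarrow> vnorm V (vadd V x y) \<le> vnorm V x + vnorm V y"
begin

lemma zero_closed [simp, intro]: "vzero V \<in> vcarrier V"
  and add_closed [simp, intro]: "\<lbrakk>x \<in> vcarrier V; y \<in> vcarrier V\<rbrakk> \<Longrightarrow> vadd V x y \<in> vcarrier V"
  and scale_closed [simp, intro]: "x \<in> vcarrier V \<Longrightarrow> vscale V a x \<in> vcarrier V"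
  and vadd_commute: "\<lbrakk>x \<in> vcarrier V; y \<in> vcarrier V\<rbrakk> \<Longrightarrow> vadd V x y = vadd V y x"
  and add_neg [simp]: "x \<in> vcarrier V \<Longrightarrow> vadd V x (vscale V (-1) x) = vzero V"
  and scale_add: "\<lbrakk>x \<in> vcarrier V; y \<in> vcarrier V\<rbrakk>
    \<Longrightarrow> vscale V a (vadd V x y) = vadd V (vscale V a x) (vscale V a y)"
  and scale_scale: "x \<in> vcarrier V \<Longrightarrow> vscale V a (vscale V b x) = vscale V (a * b) x"
  by (insert vs, simp_all add: real_vs_def)

lemma vadd_assoc: "\<lbrakk>x \<in> vcarrier V; y \<in> vcarrier V; z \<in> vcarrier V\<rbrakk>
    \<Longrightarrow> vadd V (vadd V x y) z = vadd V x (vadd V y z)"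
  using vs unfolding real_vs_def by metis

lemma zero_add [simp]: "x \<in> vcarrier V \<Longrightarrow> vadd V (vzero V) x = x"
  using vs unfolding real_vs_def by metis

lemma left_commute:
  "\<lbrakk>x \<in> vcarrier V; y \<in> vcarrier V; z \<in> vcarrier V\<rbrakk>
    \<Longrightarrow> vadd V x (vadd V y z) = vadd V y (vadd V x z)"
  by (metis vadd_assoc vadd_commute)

lemmas ac = vadd_assoc vadd_commute left_commute

lemma dist_eq:
  "\<lbrakk>x \<in> vcarrier V; y \<in> vcarrier V\<rbrakk> \<Longrightarrow> vdist V x y = vnorm V (vadd V x (vscale V (-1) y))"
  by (simp add: vdist_def)

lemma diff_split:
  assumes "x \<in> vcarrier V" "y \<in> vcarrier V" "z \<in> vcarrier V"
  shows "vadd V x (vscale V (-1) z)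
    = vadd V (vadd V x (vscale V (-1) y)) (vadd V y (vscale V (-1) z))"
proof -
  have "vadd V (vadd V x (vscale V (-1) y)) (vadd V y (vscale V (-1) z))
      = vadd V (vadd V y (vscale V (-1) y)) (vadd V x (vscale V (-1) z))"
    using assms by (simp add: ac del: add_neg)
  then show ?thesis using assms by simp
qed

sublocale Metric_space "vcarrier V" "vdist V"
proof
  fix x y
  show "0 \<le> vdist V x y" by (simp add: vdist_def norm_nonneg)
  show "vdist V x y = vdist V y x"
  proof (cases "x \<in> vcarrier V \<and> y \<in> vcarrier V")
    case True
    have "vscale V (-1) (vadd V x (vscale V (-1) y)) = vadd V y (vscale V (-1) x)"
      using True vs by (simp add: scale_add scale_scale real_vs_def vadd_commute)
    moreover have "vnorm V (vscale V (-1) (vadd V x (vscale V (-1) y)))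
        = vnorm V (vadd V x (vscale V (-1) y))"
      using True by (subst norm_scale) auto
    ultimately show ?thesis using True by (simp add: dist_eq)
  qed (auto simp: vdist_def)
  assume x: "x \<in> vcarrier V" and y: "y \<in> vcarrier V"
  show "vdist V x y = 0 \<longleftrightarrow> x = y"
  proof
    assume "vdist V x y = 0"
    then have "vadd V x (vscale V (-1) y) = vzero V"
      using x y norm_eq_0_iff by (simp add: dist_eq)
    then have "vadd V (vadd V x (vscale V (-1) y)) y = y" using y by simp
    moreover have "vadd V (vadd V x (vscale V (-1) y)) y
        = vadd V (vadd V y (vscale V (-1) y)) x"
      using x y by (simp add: ac del: add_neg)
    ultimately show "x = y" using x y by simp
  next
    assume "x = y"
    then show "vdist V x y = 0" using x norm_eq_0_iff by (simp add: dist_eq)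
  qed
  fix z assume z: "z \<in> vcarrier V"
  show "vdist V x z \<le> vdist V x y + vdist V y z"
    using x y z norm_triangle by (simp add: dist_eq diff_split[of x y z])
qed

lemma dist_add_le:
  assumes "x \<in> vcarrier V" "y \<in> vcarrier V" "x' \<in> vcarrier V" "y' \<in> vcarrier V"
  shows "vdist V (vadd V x y) (vadd V x' y') \<le> vdist V x x' + vdist V y y'"
proof -
  have "vadd V (vadd V x y) (vscale V (-1) (vadd V x' y'))
      = vadd V (vadd V x (vscale V (-1) x')) (vadd V y (vscale V (-1) y'))"
    using assms by (simp add: ac scale_add)
  then show ?thesis using assms norm_triangle by (simp add: dist_eq)
qed

lemma dist_scale:
  assumes "x \<in> vcarrier V" "y \<in> vcarrier V"
  shows "vdist V (vscale V a x) (vscale V a y) = \<bar>a\<bar> * vdist V x y"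
proof -
  have "vadd V (vscale V a x) (vscale V (-1) (vscale V a y))
      = vscale V a (vadd V x (vscale V (-1) y))"
    using assms by (simp add: scale_add scale_scale)
  then show ?thesis using assms norm_scale by (simp add: dist_eq)
qed

lemma norm_diff_le:
  assumes "x \<in> vcarrier V" "y \<in> vcarrier V"
  shows "\<bar>vnorm V x - vnorm V y\<bar> \<le> vdist V x y"
proof -
  have *: "vnorm V u \<le> vdist V u v + vnorm V v" if "u \<in> vcarrier V" "v \<in> vcarrier V" for u v
  proof -
    have "vadd V (vadd V u (vscale V (-1) v)) v = vadd V (vadd V v (vscale V (-1) v)) u"
      using that by (simp add: ac del: add_neg)
    then have "u = vadd V (vadd V u (vscale V (-1) v)) v" using that by simp
    then have "vnorm V u = vnorm V (vadd V (vadd V u (vscale V (-1) v)) v)" by simp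
    also have "\<dots> \<le> vdist V u v + vnorm V v" using that norm_triangle by (simp add: dist_eq)
    finally show ?thesis .
  qed
  show ?thesis using *[OF assms] *[OF assms(2,1)] by (simp add: commute)
qed

end

lemma banach_space_iff:
  "banach_space V \<longleftrightarrow> norm_nspace V \<and> Metric_space.mcomplete (vcarrier V) (vdist V)"
  unfolding banach_space_def norm_nspace_def by blast

abbreviation vlimit :: "'a nspace \<Rightarrow> ('i \<Rightarrow> 'a) \<Rightarrow> 'a \<Rightarrow> 'i filter \<Rightarrow> bool" where
  "vlimit V \<equiv> limitin (Metric_space.mtopology (vcarrier V) (vdist V))"

context norm_nspace
begin

lemma vlimit_iff:
  "vlimit V f l F \<longleftrightarrow> l \<in> vcarrier V \<and> eventually (\<lambda>x. f x \<in> vcarrier V) F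
    \<and> ((\<lambda>x. vdist V (f x) l) \<longlongrightarrow> 0) F"
  by (rule limitin_metric_dist_null)

lemma vlimit_add:
  assumes f: "vlimit V f l F" and g: "vlimit V g m F"
  shows "vlimit V (\<lambda>x. vadd V (f x) (g x)) (vadd V l m) F"
  unfolding vlimit_iff
proof (intro conjI)
  show "vadd V l m \<in> vcarrier V" using f g by (simp add: vlimit_iff)
  have ev: "eventually (\<lambda>x. f x \<in> vcarrier V) F" "eventually (\<lambda>x. g x \<in> vcarrier V) F"
    using f g by (auto simp: vlimit_iff)
  then show "eventually (\<lambda>x. vadd V (f x) (g x) \<in> vcarrier V) F"
    by eventually_elim auto
  have lim: "((\<lambda>x. vdist V (f x) l + vdist V (g x) m) \<longlongrightarrow> 0) F"
    using tendsto_add[of _ 0 F _ 0] f g by (auto simp: vlimit_iff)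
  have "eventually (\<lambda>x. vdist V (vadd V (f x) (g x)) (vadd V l m) \<le> vdist V (f x) l + vdist V (g x) m) F"
    using ev by eventually_elim (use f g in \<open>auto intro!: dist_add_le simp: vlimit_iff\<close>)
  then show "((\<lambda>x. vdist V (vadd V (f x) (g x)) (vadd V l m)) \<longlongrightarrow> 0) F"
    by (intro tendsto_sandwich[OF _ _ tendsto_const lim]) auto
qed

lemma vlimit_scale:
  assumes f: "vlimit V f l F"
  shows "vlimit V (\<lambda>x. vscale V a (f x)) (vscale V a l) F"
  unfolding vlimit_iff
proof (intro conjI)
  show "vscale V a l \<in> vcarrier V" using f by (simp add: vlimit_iff)
  have ev: "eventually (\<lambda>x. f x \<in> vcarrier V) F" using f by (auto simp: vlimit_iff)
  then show "eventually (\<lambda>x. vscale V a (f x) \<in> vcarrier V) F" by eventually_elim auto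
  have "((\<lambda>x. \<bar>a\<bar> * vdist V (f x) l) \<longlongrightarrow> 0) F"
    using f by (auto simp: vlimit_iff intro: tendsto_mult_right_zero)
  moreover have "eventually (\<lambda>x. \<bar>a\<bar> * vdist V (f x) l = vdist V (vscale V a (f x)) (vscale V a l)) F"
    using ev by eventually_elim (use f in \<open>simp add: dist_scale vlimit_iff\<close>)
  ultimately show "((\<lambda>x. vdist V (vscale V a (f x)) (vscale V a l)) \<longlongrightarrow> 0) F"
    by (rule Lim_transform_eventually)
qed

lemma vlimit_norm:
  assumes f: "vlimit V f l F"
  shows "((\<lambda>x. vnorm V (f x)) \<longlongrightarrow> vnorm V l) F"
proof -
  have ev: "eventually (\<lambda>x. norm (vnorm V (f x) - vnorm V l) \<le> vdist V (f x) l) F"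
    using f norm_diff_le by (auto simp: vlimit_iff elim!: eventually_mono)
  have "((\<lambda>x. vnorm V (f x) - vnorm V l) \<longlongrightarrow> 0) F"
    using f by (intro Lim_null_comparison[OF ev]) (auto simp: vlimit_iff)
  then show ?thesis by (simp add: LIM_zero_iff)
qed

lemma vlimit_dist:
  assumes f: "vlimit V f l F" and g: "vlimit V g m F"
  shows "((\<lambda>x. vdist V (f x) (g x)) \<longlongrightarrow> vdist V l m) F"
proof -
  have ev: "eventually (\<lambda>x. f x \<in> vcarrier V) F" "eventually (\<lambda>x. g x \<in> vcarrier V) F"
    using f g by (auto simp: vlimit_iff)
  have "((\<lambda>x. vnorm V (vadd V (f x) (vscale V (-1) (g x)))) \<longlongrightarrow> vdist V l m) F"
    using vlimit_norm[OF vlimit_add[OF f vlimit_scale[OF g, of "-1"]]] f g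
    by (simp add: dist_eq vlimit_iff)
  moreover have "eventually (\<lambda>x. vnorm V (vadd V (f x) (vscale V (-1) (g x))) = vdist V (f x) (g x)) F"
    using ev by eventually_elim (simp add: dist_eq)
  ultimately show ?thesis by (rule Lim_transform_eventually)
qed

end

lemma lin_isometry_dist:
  assumes "norm_nspace V" "norm_nspace W" and T: "lin_isometry V W T"
    and "x \<in> vcarrier V" "y \<in> vcarrier V"
  shows "vdist W (T x) (T y) = vdist V x y"
proof -
  interpret V: norm_nspace V by fact
  interpret W: norm_nspace W by fact
  have "T (vadd V x (vscale V (-1) y)) = vadd W (T x) (vscale W (-1) (T y))"
    using T assms(4,5) by (simp add: lin_isometry_def)
  moreover have "vnorm W (T (vadd V x (vscale V (-1) y))) = vnorm V (vadd V x (vscale V (-1) y))"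
    using T V.add_closed[OF assms(4) V.scale_closed[OF assms(5)]] by (simp add: lin_isometry_def)
  moreover have "T x \<in> vcarrier W" "T y \<in> vcarrier W"
    using T assms(4,5) by (auto simp: lin_isometry_def)
  ultimately show ?thesis using assms(4,5) by (simp add: W.dist_eq V.dist_eq)
qed

lemma lin_isometry_vlimit:
  assumes "norm_nspace V" "norm_nspace W" and T: "lin_isometry V W T"
    and f: "vlimit V f l F"
  shows "vlimit W (\<lambda>x. T (f x)) (T l) F"
proof -
  interpret V: norm_nspace V by fact
  interpret W: norm_nspace W by fact
  have l: "l \<in> vcarrier V" and ev: "eventually (\<lambda>x. f x \<in> vcarrier V) F"
    and lim: "((\<lambda>x. vdist V (f x) l) \<longlongrightarrow> 0) F"
    using f by (auto simp: V.vlimit_iff)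
  have "eventually (\<lambda>x. vdist V (f x) l = vdist W (T (f x)) (T l)) F"
    using ev by eventually_elim (use l in \<open>simp add: lin_isometry_dist[OF assms(1-3)]\<close>)
  with lim have "((\<lambda>x. vdist W (T (f x)) (T l)) \<longlongrightarrow> 0) F"
    by (rule Lim_transform_eventually)
  moreover have "eventually (\<lambda>x. T (f x) \<in> vcarrier W) F"
    using ev by eventually_elim (use T in \<open>auto simp: lin_isometry_def\<close>)
  moreover have "T l \<in> vcarrier W" using T l by (auto simp: lin_isometry_def)
  ultimately show ?thesis by (simp add: W.vlimit_iff)
qed

lemma lin_isometry_compose:
  assumes "lin_isometry U V S" "lin_isometry V W T"
  shows "lin_isometry U W (\<lambda>x. T (S x))"
proof -
  have S: "S x \<in> vcarrier V" if "x \<in> vcarrier U" for x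
    using assms that by (auto simp: lin_isometry_def)
  show ?thesis using assms S unfolding lin_isometry_def by auto
qed

lemma lin_isometry_cong:
  assumes "norm_nspace V" "\<And>x. x \<in> vcarrier V \<Longrightarrow> S x = T x"
  shows "lin_isometry V W S \<longleftrightarrow> lin_isometry V W T"
proof -
  interpret V: norm_nspace V by fact
  show ?thesis using assms(2) unfolding lin_isometry_def by (auto simp: Pi_iff)
qed

lemma lin_isometry_inv:
  assumes "norm_nspace V" "norm_nspace W" and T: "lin_isometry V W T"
    and onto: "T ` vcarrier V = vcarrier W" and S: "\<And>x. x \<in> vcarrier V \<Longrightarrow> S (T x) = x"
  shows "lin_isometry W V S"
proof -
  interpret V: norm_nspace V by fact
  interpret W: norm_nspace W by fact
  have "S (vadd W (T u) (T v)) = vadd V u v" if "u \<in> vcarrier V" "v \<in> vcarrier V" for u v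
  proof -
    have "vadd W (T u) (T v) = T (vadd V u v)" using T that by (simp add: lin_isometry_def)
    then show ?thesis using that S by simp
  qed
  moreover have "S (vscale W a (T u)) = vscale V a u" if "u \<in> vcarrier V" for u a
  proof -
    have "vscale W a (T u) = T (vscale V a u)" using T that by (simp add: lin_isometry_def)
    then show ?thesis using that S by simp
  qed
  ultimately show ?thesis
    using T S unfolding lin_isometry_def onto[symmetric] by auto
qed

text \<open>Completeness of the space of co-Cauchy families is obtained from this lemma, by comparison
  with a space that is known to be complete; a direct proof would need a diagonal argument.\<close>

lemma banach_space_transport:
  assumes Y: "banach_space Y" and T: "lin_isometry V Y T" and bij: "bij_betw T (vcarrier V) (vcarrier Y)"
    and zero: "vzero V \<in> vcarrier V" "T (vzero V) = vzero Y"
    and add: "\<And>x y. \<lbrakk>x \<in> vcarrier V; y \<in> vcarrier V\<rbrakk> \<Longrightarrow> vadd V x y \<in> vcarrier V"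
    and scale: "\<And>a x. x \<in> vcarrier V \<Longrightarrow> vscale V a x \<in> vcarrier V"
  shows "banach_space V"
proof -
  interpret Y: norm_nspace Y using Y by (simp add: banach_space_iff)
  have eq: "x = y" if "x \<in> vcarrier V" "y \<in> vcarrier V" "T x = T y" for x y
    using that bij by (auto simp: bij_betw_def inj_on_def)
  have TC: "T x \<in> vcarrier Y" if "x \<in> vcarrier V" for x
    using T that by (auto simp: lin_isometry_def)
  have Tadd: "T (vadd V x y) = vadd Y (T x) (T y)" if "x \<in> vcarrier V" "y \<in> vcarrier V" for x y
    using T that by (auto simp: lin_isometry_def)
  have Tscale: "T (vscale V a x) = vscale Y a (T x)" if "x \<in> vcarrier V" for x a
    using T that by (auto simp: lin_isometry_def)
  have Tnorm: "vnorm V x = vnorm Y (T x)" if "x \<in> vcarrier V" for x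
    using T that by (auto simp: lin_isometry_def)
  have vsY: "vscale Y (a + b) x = vadd Y (vscale Y a x) (vscale Y b x)" "vscale Y 1 x = x"
    if "x \<in> vcarrier Y" for x a b
    using Y.vs that by (auto simp: real_vs_def)
  have vs: "real_vs V"
    unfolding real_vs_def
    using zero add scale
    by (auto intro!: eq Y.vadd_commute simp: Tadd Tscale TC Y.vadd_assoc Y.scale_add vsY Y.scale_scale)
  interpret V: norm_nspace V
  proof
    show "real_vs V" by (rule vs)
    fix x assume x: "x \<in> vcarrier V"
    show "0 \<le> vnorm V x" using x Tnorm TC Y.norm_nonneg by simp
    show "vnorm V x = 0 \<longleftrightarrow> x = vzero V"
      using x Tnorm TC[OF x] Y.norm_eq_0_iff[of "T x"] eq[of x "vzero V"] zero by auto
    show "vnorm V (vscale V a x) = \<bar>a\<bar> * vnorm V x" for a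
      using x scale Tnorm TC Y.norm_scale Tscale by simp
    show "vnorm V (vadd V x y) \<le> vnorm V x + vnorm V y" if "y \<in> vcarrier V" for y
      using x that add Tnorm TC Y.norm_triangle Tadd by simp
  qed
  have dist: "vdist Y (T x) (T y) = vdist V x y" if "x \<in> vcarrier V" "y \<in> vcarrier V" for x y
    using lin_isometry_dist[OF V.norm_nspace_axioms Y.norm_nspace_axioms T that] .
  have "V.mcomplete"
    unfolding V.mcomplete_def
  proof (intro allI impI)
    fix s assume s: "V.MCauchy s"
    then have sV: "s n \<in> vcarrier V" for n by (auto simp: V.MCauchy_def)
    have "Y.MCauchy (\<lambda>n. T (s n))"
      using s TC sV by (auto simp: V.MCauchy_def Y.MCauchy_def dist)
    then obtain y where y: "vlimit Y (\<lambda>n. T (s n)) y sequentially"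
      using Y by (auto simp: banach_space_iff Y.mcomplete_def)
    then obtain x where x: "x \<in> vcarrier V" "y = T x"
      using bij by (auto simp: Y.vlimit_iff bij_betw_def)
    have "vlimit V s x sequentially"
      using y x sV by (simp add: Y.vlimit_iff V.vlimit_iff dist)
    then show "\<exists>x. vlimit V s x sequentially" ..
  qed
  then show ?thesis by (simp add: banach_space_iff V.norm_nspace_axioms)
qed

section \<open>Limits over a directed diagram\<close>

locale directed_codiagram =
  fixes I :: "'i::order set" and Z :: "'i \<Rightarrow> 'z nspace" and \<phi> :: "'i \<Rightarrow> 'i \<Rightarrow> 'z \<Rightarrow> 'z"
  assumes codiagram: "codiagram I Z \<phi>"
    and nonempty: "I \<noteq> {}"
    and directed: "\<And>R S. \<lbrakk>R \<in> I; S \<in> I\<rbrakk> \<Longrightarrow> \<exists>F\<in>I. R \<le> F \<and> S \<le> F"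
begin

lemma eventually_net: "eventually P (net I) \<longleftrightarrow> (\<exists>R0\<in>I. \<forall>R\<in>I. R0 \<le> R \<longrightarrow> P R)"
proof -
  have "\<exists>x\<in>I. principal {R \<in> I. x \<le> R} \<le> principal {R \<in> I. a \<le> R} \<sqinter> principal {R \<in> I. b \<le> R}"
    if ab: "a \<in> I" "b \<in> I" for a b
  proof -
    obtain F where "F \<in> I" "a \<le> F" "b \<le> F" using directed[OF ab] by blast
    then show ?thesis by (intro bexI[of _ F]) auto
  qed
  then show ?thesis
    unfolding net_def by (subst eventually_INF_base[OF nonempty]) (auto simp: eventually_principal)
qed

lemma eventually_netI: "\<lbrakk>R0 \<in> I; \<And>R. \<lbrakk>R \<in> I; R0 \<le> R\<rbrakk> \<Longrightarrow> P R\<rbrakk> \<Longrightarrow> eventually P (net I)"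
  by (auto simp: eventually_net)

lemma net_nontrivial [simp]: "net I \<noteq> bot"
proof
  assume "net I = bot"
  then have "eventually (\<lambda>_. False) (net I)" by simp
  then show False by (auto simp: eventually_net)
qed

lemma norm_Z: "R \<in> I \<Longrightarrow> norm_nspace (Z R)"
  using codiagram by (auto simp: codiagram_def banach_space_iff)

lemma \<phi>_closed:
  assumes "R \<in> I" "F \<in> I" "R \<le> F" "x \<in> vcarrier (Z R)"
  shows "\<phi> R F x \<in> vcarrier (Z F)"
proof -
  have "lin_isometry (Z R) (Z F) (\<phi> R F)" using codiagram assms unfolding codiagram_def by blast
  then show ?thesis using assms(4) by (simp add: lin_isometry_def Pi_iff)
qed

end

locale directed_cocone = directed_codiagram I Z \<phi>
  for I :: "'i::order set" and Z :: "'i \<Rightarrow> 'z nspace" and \<phi> :: "'i \<Rightarrow> 'i \<Rightarrow> 'z \<Rightarrow> 'z" +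
  fixes W :: "'w nspace" and \<rho> :: "'i \<Rightarrow> 'z \<Rightarrow> 'w"
  assumes cocone: "cocone I Z \<phi> W \<rho>"
begin

sublocale W: norm_nspace W
  using cocone by (simp add: cocone_def banach_space_iff)

lemma isometry: "R \<in> I \<Longrightarrow> lin_isometry (Z R) W (\<rho> R)"
  using cocone by (simp add: cocone_def)

lemma \<rho>_closed: "\<lbrakk>R \<in> I; x \<in> vcarrier (Z R)\<rbrakk> \<Longrightarrow> \<rho> R x \<in> vcarrier W"
  using isometry[of R] by (simp add: lin_isometry_def Pi_iff)

lemma \<rho>_dist:
  "\<lbrakk>R \<in> I; x \<in> vcarrier (Z R); y \<in> vcarrier (Z R)\<rbrakk> \<Longrightarrow> vdist W (\<rho> R x) (\<rho> R y) = vdist (Z R) x y"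
  by (intro lin_isometry_dist norm_Z W.norm_nspace_axioms isometry)

lemma \<rho>_dist_le:
  assumes "R \<in> I" "F \<in> I" "R \<le> F" "x \<in> vcarrier (Z R)" "y \<in> vcarrier (Z F)"
  shows "vdist W (\<rho> R x) (\<rho> F y) = vdist (Z F) (\<phi> R F x) y"
proof -
  have "\<rho> R x = \<rho> F (\<phi> R F x)" using cocone assms unfolding cocone_def by blast
  then show ?thesis using \<rho>_dist[OF assms(2) \<phi>_closed[OF assms(1-4)] assms(5)] by simp
qed

text \<open>The injections are isometric, so the images form a Cauchy net.  For every \<open>n\<close> pick an index
  \<open>S n\<close> from which on the net stays within \<open>1/(n+1)\<close> of its value at \<open>S n\<close>.  The \<open>S n\<close> need not be
  increasing: the values at \<open>S n\<close> and \<open>S m\<close> are compared through a common upper bound.\<close>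

lemma co_Cauchy_has_limit:
  assumes f: "f \<in> co_Cauchy I Z \<phi>"
  shows "\<exists>w. vlimit W (\<lambda>R. \<rho> R (f R)) w (net I)"
proof -
  have fZ: "f R \<in> vcarrier (Z R)" if "R \<in> I" for R using f that by (auto simp: co_Cauchy_def)
  let ?x = "\<lambda>R. \<rho> R (f R)"
  have "\<exists>R0\<in>I. \<forall>R\<in>I. R0 \<le> R \<longrightarrow> vdist W (?x R0) (?x R) < inverse (real (Suc n))" for n
  proof -
    have "inverse (real (Suc n)) > 0" by simp
    then obtain R0 where R0: "R0 \<in> I"
      "\<forall>R\<in>I. \<forall>F\<in>I. R0 \<le> R \<and> R \<le> F \<longrightarrow> vdist (Z F) (\<phi> R F (f R)) (f F) < inverse (real (Suc n))"
      using f unfolding co_Cauchy_def by blast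
    then show ?thesis using \<rho>_dist_le fZ by (intro bexI[of _ R0]) auto
  qed
  then obtain S where S: "\<And>n. S n \<in> I"
    "\<And>n R. \<lbrakk>R \<in> I; S n \<le> R\<rbrakk> \<Longrightarrow> vdist W (?x (S n)) (?x R) < inverse (real (Suc n))"
    by metis
  have xW: "?x R \<in> vcarrier W" if "R \<in> I" for R using that \<rho>_closed fZ by auto
  have close: "vdist W (?x (S n)) (?x (S m)) < inverse (real (Suc n)) + inverse (real (Suc m))" for n m
  proof -
    obtain F where F: "F \<in> I" "S n \<le> F" "S m \<le> F" using directed S(1) by metis
    have "vdist W (?x (S n)) (?x (S m)) \<le> vdist W (?x (S n)) (?x F) + vdist W (?x (S m)) (?x F)"
      using W.triangle'[of "?x (S n)" "?x F" "?x (S m)"] xW F S(1) by (simp add: W.commute)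
    then show ?thesis using S(2)[OF F(1,2)] S(2)[OF F(1,3)] by linarith
  qed
  have small: "\<exists>N. \<forall>n\<ge>N. inverse (real (Suc n)) < e" if "e > 0" for e :: real
    using LIMSEQ_inverse_real_of_nat that by (auto simp: LIMSEQ_iff)
  have "W.MCauchy (\<lambda>n. ?x (S n))"
    unfolding W.MCauchy_def
  proof (intro conjI allI impI)
    show "range (\<lambda>n. ?x (S n)) \<subseteq> vcarrier W" using xW S(1) by auto
    fix e :: real assume "e > 0"
    then obtain N where N: "\<forall>n\<ge>N. inverse (real (Suc n)) < e/2" using small[of "e/2"] by auto
    show "\<exists>N. \<forall>n n'. N \<le> n \<longrightarrow> N \<le> n' \<longrightarrow> vdist W (?x (S n)) (?x (S n')) < e"
    proof (intro exI[of _ N] allI impI)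
      fix n n' assume "N \<le> n" "N \<le> n'"
      then have "inverse (real (Suc n)) < e/2" "inverse (real (Suc n')) < e/2" using N by auto
      then show "vdist W (?x (S n)) (?x (S n')) < e" using close[of n n'] by linarith
    qed
  qed
  then obtain w where w: "vlimit W (\<lambda>n. ?x (S n)) w sequentially"
    using cocone by (auto simp: cocone_def banach_space_iff W.mcomplete_def)
  have "vlimit W ?x w (net I)"
    unfolding W.limitin_metric
  proof (intro conjI allI impI)
    show wW: "w \<in> vcarrier W" using w by (simp add: W.vlimit_iff)
    fix e :: real assume e: "e > 0"
    obtain N1 where N1: "\<forall>n\<ge>N1. inverse (real (Suc n)) < e/2" using small[of "e/2"] e by auto
    obtain N2 where N2: "\<forall>n\<ge>N2. vdist W (?x (S n)) w < e/2"
      using w e unfolding W.limitin_metric eventually_sequentially by (meson half_gt_zero)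
    define n where "n = max N1 N2"
    show "eventually (\<lambda>R. ?x R \<in> vcarrier W \<and> vdist W (?x R) w < e) (net I)"
    proof (rule eventually_netI[OF S(1)[of n]])
      fix R assume R: "R \<in> I" "S n \<le> R"
      have "vdist W (?x R) w \<le> vdist W (?x (S n)) (?x R) + vdist W (?x (S n)) w"
        using W.triangle'[of "?x R" "?x (S n)" w] xW R S(1) wW by (simp add: W.commute)
      moreover have "vdist W (?x (S n)) (?x R) < e/2"
      proof -
        have "inverse (real (Suc n)) < e/2" using N1 unfolding n_def by (meson max.cobounded1)
        then show ?thesis using S(2)[OF R] by linarith
      qed
      moreover have "vdist W (?x (S n)) w < e/2" using N2 by (auto simp: n_def)
      ultimately show "?x R \<in> vcarrier W \<and> vdist W (?x R) w < e" using xW R by auto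
    qed
  qed
  then show ?thesis ..
qed

text \<open>Together with the previous lemma: being co-Cauchy, which refers to the diagram only, amounts to
  convergence of the images, in whichever cocone.\<close>

lemma has_limit_co_Cauchy:
  assumes f: "f \<in> (\<Pi>\<^sub>E R\<in>I. vcarrier (Z R))" and w: "vlimit W (\<lambda>R. \<rho> R (f R)) w (net I)"
  shows "f \<in> co_Cauchy I Z \<phi>"
  unfolding co_Cauchy_def
proof (intro CollectI conjI f allI impI)
  fix e :: real assume "e > 0"
  then have "e/2 > 0" by simp
  then have "eventually (\<lambda>R. \<rho> R (f R) \<in> vcarrier W \<and> vdist W (\<rho> R (f R)) w < e/2) (net I)"
    using w unfolding W.limitin_metric by blast
  then obtain R0 where R0: "R0 \<in> I" "\<And>R. \<lbrakk>R \<in> I; R0 \<le> R\<rbrakk> \<Longrightarrow> vdist W (\<rho> R (f R)) w < e/2"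
    unfolding eventually_net by blast
  have wW: "w \<in> vcarrier W" using w by (simp add: W.vlimit_iff)
  show "\<exists>R0\<in>I. \<forall>R\<in>I. \<forall>F\<in>I. R0 \<le> R \<and> R \<le> F \<longrightarrow> vdist (Z F) (\<phi> R F (f R)) (f F) < e"
  proof (intro bexI[OF _ R0(1)] ballI impI)
    fix R F assume RF: "R \<in> I" "F \<in> I" "R0 \<le> R \<and> R \<le> F"
    then have fZ: "f R \<in> vcarrier (Z R)" "f F \<in> vcarrier (Z F)" using f by auto
    have "vdist (Z F) (\<phi> R F (f R)) (f F) = vdist W (\<rho> R (f R)) (\<rho> F (f F))"
      using \<rho>_dist_le RF fZ by simp
    also have "\<dots> \<le> vdist W (\<rho> R (f R)) w + vdist W (\<rho> F (f F)) w"
      using W.triangle'[of "\<rho> R (f R)" w "\<rho> F (f F)"] \<rho>_closed RF fZ wW by (simp add: W.commute)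
    also have "\<dots> < e" using R0(2)[of R] R0(2)[of F] RF order_trans[of R0 R F] by linarith
    finally show "vdist (Z F) (\<phi> R F (f R)) (f F) < e" .
  qed
qed

definition net_lim :: "('i \<Rightarrow> 'z) \<Rightarrow> 'w" where
  "net_lim f = (THE w. vlimit W (\<lambda>R. \<rho> R (f R)) w (net I))"

lemma net_lim_unique: "vlimit W (\<lambda>R. \<rho> R (f R)) w (net I) \<Longrightarrow> net_lim f = w"
  unfolding net_lim_def by (rule the_equality) (auto intro: W.limitin_metric_unique)

lemma vlimit_net_lim: "f \<in> co_Cauchy I Z \<phi> \<Longrightarrow> vlimit W (\<lambda>R. \<rho> R (f R)) (net_lim f) (net I)"
  using co_Cauchy_has_limit net_lim_unique by metis

lemma net_lim_closed: "f \<in> co_Cauchy I Z \<phi> \<Longrightarrow> net_lim f \<in> vcarrier W"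
  using vlimit_net_lim W.vlimit_iff by blast

lemma eventually_in_I: "eventually (\<lambda>R. R \<in> I) (net I)"
  using nonempty by (auto simp: eventually_net)

lemma vlimit_cong_I:
  assumes "\<And>R. R \<in> I \<Longrightarrow> f R = g R" "vlimit W f w (net I)"
  shows "vlimit W g w (net I)"
  using assms(2) by (rule limitin_transform_eventually[rotated])
    (auto intro: eventually_mono[OF eventually_in_I] simp: assms(1))

lemma co_Cauchy_add:
  assumes f: "f \<in> co_Cauchy I Z \<phi>" and g: "g \<in> co_Cauchy I Z \<phi>"
  shows "(\<lambda>R\<in>I. vadd (Z R) (f R) (g R)) \<in> co_Cauchy I Z \<phi>"
    and "net_lim (\<lambda>R\<in>I. vadd (Z R) (f R) (g R)) = vadd W (net_lim f) (net_lim g)"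
proof -
  have fg: "f R \<in> vcarrier (Z R)" "g R \<in> vcarrier (Z R)" if "R \<in> I" for R
    using f g that by (auto simp: co_Cauchy_def)
  let ?h = "\<lambda>R\<in>I. vadd (Z R) (f R) (g R)"
  have lim: "vlimit W (\<lambda>R. \<rho> R (?h R)) (vadd W (net_lim f) (net_lim g)) (net I)"
    by (rule vlimit_cong_I[OF _ W.vlimit_add[OF vlimit_net_lim[OF f] vlimit_net_lim[OF g]]])
      (use isometry fg in \<open>simp add: lin_isometry_def\<close>)
  have "?h \<in> (\<Pi>\<^sub>E R\<in>I. vcarrier (Z R))"
    using fg norm_Z by (auto intro: norm_nspace.add_closed)
  from has_limit_co_Cauchy[OF this lim] show "?h \<in> co_Cauchy I Z \<phi>" .
  show "net_lim ?h = vadd W (net_lim f) (net_lim g)" using lim by (rule net_lim_unique)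
qed

lemma co_Cauchy_scale:
  assumes f: "f \<in> co_Cauchy I Z \<phi>"
  shows "(\<lambda>R\<in>I. vscale (Z R) a (f R)) \<in> co_Cauchy I Z \<phi>"
    and "net_lim (\<lambda>R\<in>I. vscale (Z R) a (f R)) = vscale W a (net_lim f)"
proof -
  have fg: "f R \<in> vcarrier (Z R)" if "R \<in> I" for R
    using f that by (auto simp: co_Cauchy_def)
  let ?h = "\<lambda>R\<in>I. vscale (Z R) a (f R)"
  have lim: "vlimit W (\<lambda>R. \<rho> R (?h R)) (vscale W a (net_lim f)) (net I)"
    by (rule vlimit_cong_I[OF _ W.vlimit_scale[OF vlimit_net_lim[OF f]]])
      (use isometry fg in \<open>simp add: lin_isometry_def\<close>)
  have "?h \<in> (\<Pi>\<^sub>E R\<in>I. vcarrier (Z R))"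
    using fg norm_Z by (auto intro: norm_nspace.scale_closed)
  from has_limit_co_Cauchy[OF this lim] show "?h \<in> co_Cauchy I Z \<phi>" .
  show "net_lim ?h = vscale W a (net_lim f)" using lim by (rule net_lim_unique)
qed

lemma co_Cauchy_zero:
  shows "(\<lambda>R\<in>I. vzero (Z R)) \<in> co_Cauchy I Z \<phi>"
    and "net_lim (\<lambda>R\<in>I. vzero (Z R)) = vzero W"
proof -
  have zero: "\<rho> R (vzero (Z R)) = vzero W" if R: "R \<in> I" for R
  proof -
    have "vnorm W (\<rho> R (vzero (Z R))) = 0"
      using isometry[OF R] norm_nspace.norm_eq_0_iff[OF norm_Z[OF R]]
        norm_nspace.zero_closed[OF norm_Z[OF R]] by (auto simp: lin_isometry_def)
    then show ?thesis
      using W.norm_eq_0_iff \<rho>_closed[OF R] norm_nspace.zero_closed[OF norm_Z[OF R]] by blast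
  qed
  let ?h = "\<lambda>R\<in>I. vzero (Z R)"
  have lim: "vlimit W (\<lambda>R. \<rho> R (?h R)) (vzero W) (net I)"
    by (rule vlimit_cong_I[of "\<lambda>_. vzero W"]) (auto simp: zero)
  have "?h \<in> (\<Pi>\<^sub>E R\<in>I. vcarrier (Z R))"
    using norm_Z by (auto intro: norm_nspace.zero_closed)
  from has_limit_co_Cauchy[OF this lim] show "?h \<in> co_Cauchy I Z \<phi>" .
  show "net_lim ?h = vzero W" using lim by (rule net_lim_unique)
qed

text \<open>Above \<open>R\<close> the image of the family that represents \<open>x\<close> is constantly \<open>\<rho> R x\<close>, and a limit along
  the net depends on a tail only.\<close>

lemma co_Cauchy_tail:
  assumes R: "R \<in> I" and x: "x \<in> vcarrier (Z R)"
  shows "(\<lambda>F\<in>I. if R \<le> F then \<phi> R F x else vzero (Z F)) \<in> co_Cauchy I Z \<phi>"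
    and "net_lim (\<lambda>F\<in>I. if R \<le> F then \<phi> R F x else vzero (Z F)) = \<rho> R x"
proof -
  let ?h = "\<lambda>F\<in>I. if R \<le> F then \<phi> R F x else vzero (Z F)"
  have ev: "eventually (\<lambda>F. \<rho> R x = \<rho> F (?h F)) (net I)"
    using cocone x by (intro eventually_netI[OF R]) (use R in \<open>auto simp: cocone_def\<close>)
  have "vlimit W (\<lambda>F. \<rho> R x) (\<rho> R x) (net I)"
    using \<rho>_closed[OF R x] by simp
  with ev have lim: "vlimit W (\<lambda>F. \<rho> F (?h F)) (\<rho> R x) (net I)"
    by (rule limitin_transform_eventually)
  have "?h \<in> (\<Pi>\<^sub>E R\<in>I. vcarrier (Z R))"
    using x by (auto intro: norm_nspace.zero_closed[OF norm_Z] \<phi>_closed[OF R])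
  from has_limit_co_Cauchy[OF this lim] show "?h \<in> co_Cauchy I Z \<phi>" .
  show "net_lim ?h = \<rho> R x" using lim by (rule net_lim_unique)
qed

lemma co_Cauchy_norm:
  assumes f: "f \<in> co_Cauchy I Z \<phi>"
  shows "((\<lambda>R. vnorm (Z R) (f R)) \<longlongrightarrow> vnorm W (net_lim f)) (net I)"
proof -
  have fZ: "f R \<in> vcarrier (Z R)" if "R \<in> I" for R using f that by (auto simp: co_Cauchy_def)
  show ?thesis
    by (rule Lim_transform_eventually[OF W.vlimit_norm[OF vlimit_net_lim[OF f]]])
      (rule eventually_mono[OF eventually_in_I], use isometry fZ in \<open>simp add: lin_isometry_def\<close>)
qed

text \<open>The distances between the members of two families converge to the distance of the limits.\<close>

lemma co_Cauchy_rel_iff: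
  "(f, g) \<in> co_Cauchy_rel I Z \<phi> \<longleftrightarrow>
    f \<in> co_Cauchy I Z \<phi> \<and> g \<in> co_Cauchy I Z \<phi> \<and> net_lim f = net_lim g"
proof (cases "f \<in> co_Cauchy I Z \<phi> \<and> g \<in> co_Cauchy I Z \<phi>")
  case True
  then have fg: "f R \<in> vcarrier (Z R)" "g R \<in> vcarrier (Z R)" if "R \<in> I" for R
    using that by (auto simp: co_Cauchy_def)
  have "((\<lambda>R. vdist W (\<rho> R (f R)) (\<rho> R (g R))) \<longlongrightarrow> vdist W (net_lim f) (net_lim g)) (net I)"
    using True by (intro W.vlimit_dist vlimit_net_lim) auto
  then have lim: "((\<lambda>R. vdist (Z R) (f R) (g R)) \<longlongrightarrow> vdist W (net_lim f) (net_lim g)) (net I)"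
    by (rule Lim_transform_eventually)
      (rule eventually_mono[OF eventually_in_I], simp add: \<rho>_dist fg)
  have "((\<lambda>R. vdist (Z R) (f R) (g R)) \<longlongrightarrow> 0) (net I) \<longleftrightarrow> vdist W (net_lim f) (net_lim g) = 0"
    using lim tendsto_unique[OF net_nontrivial lim] by metis
  then show ?thesis using True net_lim_closed by (simp add: co_Cauchy_rel_def)
qed (auto simp: co_Cauchy_rel_def)

lemma equiv_co_Cauchy: "equiv (co_Cauchy I Z \<phi>) (co_Cauchy_rel I Z \<phi>)"
  by (intro equivI refl_onI symI transI) (auto simp: co_Cauchy_rel_iff)

end

text \<open>The assumption \<open>approx\<close> is density of the union of the images of the injections, in the form of
  an approximating family with one member for each index.\<close>

locale approximating_cocone = directed_cocone I Z \<phi> Y \<psi>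
  for I :: "'i::order set" and Z :: "'i \<Rightarrow> 'z nspace" and \<phi> and Y :: "'y nspace" and \<psi> +
  assumes approx: "\<And>y. y \<in> vcarrier Y \<Longrightarrow>
    \<exists>f\<in>(\<Pi>\<^sub>E R\<in>I. vcarrier (Z R)). vlimit Y (\<lambda>R. \<psi> R (f R)) y (net I)"
begin

abbreviation "CC \<equiv> co_Cauchy I Z \<phi>"
abbreviation "cls f \<equiv> co_Cauchy_rel I Z \<phi> `` {f}"
abbreviation "\<Z> \<equiv> co_Cauchy_space I Z \<phi>"

lemma ex_family: "y \<in> vcarrier Y \<Longrightarrow> \<exists>f\<in>CC. net_lim f = y"
  using approx has_limit_co_Cauchy net_lim_unique by metis

text \<open>The mediating map must send \<open>lim \<psi>\<^sub>R(f\<^sub>R)\<close> to \<open>lim \<rho>\<^sub>R(f\<^sub>R)\<close>, which proves uniqueness.  It is well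
  defined because equality of either limit means that the families are equivalent, and isometric
  because both limits have norm \<open>lim \<parallel>f\<^sub>R\<parallel>\<close>.\<close>

lemma universal:
  assumes "cocone I Z \<phi> W \<rho>"
  shows "\<exists>!T. T \<in> extensional (vcarrier Y) \<and> lin_isometry Y W T \<and>
    (\<forall>R\<in>I. \<forall>x\<in>vcarrier (Z R). T (\<psi> R x) = \<rho> R x)"
proof -
  interpret C: directed_cocone I Z \<phi> W \<rho> by unfold_locales fact
  define T where "T = (\<lambda>y\<in>vcarrier Y. C.net_lim (SOME f. f \<in> CC \<and> net_lim f = y))"
  have T: "T (net_lim f) = C.net_lim f" if f: "f \<in> CC" for f
  proof -
    let ?g = "SOME g. g \<in> CC \<and> net_lim g = net_lim f"
    have "?g \<in> CC \<and> net_lim ?g = net_lim f" by (rule someI[of _ f]) (simp add: f)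
    then have "(?g, f) \<in> co_Cauchy_rel I Z \<phi>" using f co_Cauchy_rel_iff by blast
    then have "C.net_lim ?g = C.net_lim f" using C.co_Cauchy_rel_iff by blast
    then show ?thesis using net_lim_closed[OF f] by (simp add: T_def)
  qed
  have norm: "vnorm W (C.net_lim f) = vnorm Y (net_lim f)" if "f \<in> CC" for f
    by (rule tendsto_unique[OF net_nontrivial C.co_Cauchy_norm[OF that] co_Cauchy_norm[OF that]])
  show ?thesis
  proof (intro ex1I[of _ T] conjI ballI)
    show "T \<in> extensional (vcarrier Y)" by (simp add: T_def)
    show "lin_isometry Y W T"
      unfolding lin_isometry_def
    proof (intro conjI ballI allI funcsetI)
      fix x assume "x \<in> vcarrier Y"
      then obtain f where f: "f \<in> CC" "x = net_lim f" using ex_family by blast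
      show "T x \<in> vcarrier W" using f T C.net_lim_closed by simp
      show "T (vscale Y a x) = vscale W a (T x)" for a
        using T[OF co_Cauchy_scale(1)[OF f(1), of a]] co_Cauchy_scale(2)[OF f(1), of a]
          C.co_Cauchy_scale(2)[OF f(1), of a] T[OF f(1)] f(2) by metis
      show "vnorm W (T x) = vnorm Y x" using norm f T by simp
      fix y assume "y \<in> vcarrier Y"
      then obtain g where g: "g \<in> CC" "y = net_lim g" using ex_family by blast
      show "T (vadd Y x y) = vadd W (T x) (T y)"
        using T[OF co_Cauchy_add(1)[OF f(1) g(1)]] co_Cauchy_add(2)[OF f(1) g(1)]
          C.co_Cauchy_add(2)[OF f(1) g(1)] T[OF f(1)] T[OF g(1)] f(2) g(2) by metis
    qed
    show "T (\<psi> R x) = \<rho> R x" if "R \<in> I" "x \<in> vcarrier (Z R)" for R x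
      using T[OF co_Cauchy_tail(1)[OF that]] co_Cauchy_tail(2)[OF that] C.co_Cauchy_tail(2)[OF that]
      by metis
    fix U assume U: "U \<in> extensional (vcarrier Y) \<and> lin_isometry Y W U \<and>
      (\<forall>R\<in>I. \<forall>x\<in>vcarrier (Z R). U (\<psi> R x) = \<rho> R x)"
    have "U y = T y" if y: "y \<in> vcarrier Y" for y
    proof -
      obtain f where f: "f \<in> CC" "y = net_lim f" using ex_family[OF y] by blast
      have fZ: "f R \<in> vcarrier (Z R)" if "R \<in> I" for R using f(1) that by (auto simp: co_Cauchy_def)
      have "vlimit W (\<lambda>R. U (\<psi> R (f R))) (U y) (net I)"
        using lin_isometry_vlimit[OF W.norm_nspace_axioms C.W.norm_nspace_axioms _ vlimit_net_lim[OF f(1)]] U f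
        by blast
      then have "vlimit W (\<lambda>R. \<rho> R (f R)) (U y) (net I)"
        by (rule C.vlimit_cong_I[rotated]) (use U fZ in blast)
      then show ?thesis using C.net_lim_unique T f by metis
    qed
    then show "U = T" using U by (intro extensionalityI[of _ "vcarrier Y"]) (auto simp: T_def)
  qed
qed

theorem colimit_Y: "colimit TYPE('w) I Z \<phi> Y \<psi>"
  unfolding colimit_def using codiagram cocone universal by blast

lemma cls_eq_iff: "\<lbrakk>f \<in> CC; g \<in> CC\<rbrakk> \<Longrightarrow> cls f = cls g \<longleftrightarrow> net_lim f = net_lim g"
  using eq_equiv_class_iff[OF equiv_co_Cauchy] co_Cauchy_rel_iff by blast

lemma carrier_eq: "vcarrier \<Z> = cls ` CC"
  by (auto simp: co_Cauchy_space_def quotient_def)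

lemma zero_cls: "vzero \<Z> = cls (\<lambda>R\<in>I. vzero (Z R))"
  by (simp add: co_Cauchy_space_def)

lemma add_cls:
  assumes "f \<in> CC" "g \<in> CC"
  shows "vadd \<Z> (cls f) (cls g) = cls (\<lambda>R\<in>I. vadd (Z R) (f R) (g R))"
proof -
  have "congruent2 (co_Cauchy_rel I Z \<phi>) (co_Cauchy_rel I Z \<phi>)
      (\<lambda>f g. cls (\<lambda>R\<in>I. vadd (Z R) (f R) (g R)))"
    by (rule congruent2I') (simp add: co_Cauchy_rel_iff co_Cauchy_add cls_eq_iff)
  from UN_equiv_class2[OF equiv_co_Cauchy equiv_co_Cauchy this assms]
  show ?thesis by (simp add: co_Cauchy_space_def)
qed

lemma scale_cls:
  assumes "f \<in> CC"
  shows "vscale \<Z> a (cls f) = cls (\<lambda>R\<in>I. vscale (Z R) a (f R))"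
proof -
  have "congruent (co_Cauchy_rel I Z \<phi>) (\<lambda>f. cls (\<lambda>R\<in>I. vscale (Z R) a (f R)))"
    by (rule congruentI) (simp add: co_Cauchy_rel_iff co_Cauchy_scale cls_eq_iff)
  from UN_equiv_class[OF equiv_co_Cauchy this assms]
  show ?thesis by (simp add: co_Cauchy_space_def)
qed

lemma norm_cls:
  assumes "f \<in> CC"
  shows "vnorm \<Z> (cls f) = vnorm Y (net_lim f)"
proof -
  have "Lim (net I) (\<lambda>R. vnorm (Z R) (g R)) = vnorm Y (net_lim f)" if "g \<in> cls f" for g
    using that co_Cauchy_rel_iff co_Cauchy_norm[of g] by (intro tendsto_Lim) auto
  moreover have "f \<in> cls f" using assms co_Cauchy_rel_iff by blast
  ultimately have "(\<lambda>g. Lim (net I) (\<lambda>R. vnorm (Z R) (g R))) ` cls f = {vnorm Y (net_lim f)}" by auto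
  then show ?thesis by (simp add: co_Cauchy_space_def)
qed

definition limit_map :: "('i \<Rightarrow> 'z) set \<Rightarrow> 'y" where
  "limit_map X = (THE y. \<forall>f\<in>X. vlimit Y (\<lambda>R. \<psi> R (f R)) y (net I))"

lemma limit_map_cls: "f \<in> CC \<Longrightarrow> limit_map (cls f) = net_lim f"
  unfolding limit_map_def
proof (rule the_equality)
  assume f: "f \<in> CC"
  show "\<forall>g\<in>cls f. vlimit Y (\<lambda>R. \<psi> R (g R)) (net_lim f) (net I)"
    using co_Cauchy_rel_iff vlimit_net_lim by auto
  fix y assume "\<forall>g\<in>cls f. vlimit Y (\<lambda>R. \<psi> R (g R)) y (net I)"
  moreover have "f \<in> cls f" using f co_Cauchy_rel_iff by blast
  ultimately show "y = net_lim f" using net_lim_unique by blast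
qed

lemma limit_map_limit: "\<lbrakk>X \<in> vcarrier \<Z>; f \<in> X\<rbrakk> \<Longrightarrow> vlimit Y (\<lambda>R. \<psi> R (f R)) (limit_map X) (net I)"
  using limit_map_cls co_Cauchy_rel_iff vlimit_net_lim by (auto simp: carrier_eq)

lemma limit_map_bij: "bij_betw limit_map (vcarrier \<Z>) (vcarrier Y)"
proof (rule bij_betw_imageI)
  show "inj_on limit_map (vcarrier \<Z>)"
    unfolding carrier_eq by (auto simp: inj_on_def limit_map_cls cls_eq_iff)
  show "limit_map ` vcarrier \<Z> = vcarrier Y"
    unfolding carrier_eq image_image using ex_family net_lim_closed by (force simp: limit_map_cls)
qed

lemma limit_map_isometry: "lin_isometry \<Z> Y limit_map"
  unfolding lin_isometry_def carrier_eq
  by (auto simp: limit_map_cls net_lim_closed add_cls co_Cauchy_add scale_cls co_Cauchy_scale norm_cls)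

lemma banach_co_Cauchy_space: "banach_space \<Z>"
proof (rule banach_space_transport[OF _ limit_map_isometry limit_map_bij])
  show "banach_space Y" using cocone by (simp add: cocone_def)
qed (auto simp: carrier_eq zero_cls limit_map_cls add_cls scale_cls co_Cauchy_zero co_Cauchy_add co_Cauchy_scale)

lemma norm_co_Cauchy_space: "norm_nspace \<Z>"
  using banach_co_Cauchy_space by (simp add: banach_space_iff)

lemma inj_closed:
  assumes "R \<in> I" "x \<in> vcarrier (Z R)"
  shows "co_Cauchy_inj I Z \<phi> R x \<in> vcarrier \<Z>" "limit_map (co_Cauchy_inj I Z \<phi> R x) = \<psi> R x"
  using co_Cauchy_tail[OF assms] unfolding co_Cauchy_inj_def carrier_eq by (auto simp: limit_map_cls)

lemma limit_map_iso: "cocone_iso I Z \<Z> (co_Cauchy_inj I Z \<phi>) Y \<psi> limit_map"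
  unfolding cocone_iso_def using limit_map_isometry limit_map_bij inj_closed by (auto simp: bij_betw_def)

text \<open>Only a left inverse on the carrier is assumed, so that the lemma applies to an inverse given by
  an explicit formula.\<close>

lemma inverse_iso:
  assumes "\<And>X. X \<in> vcarrier \<Z> \<Longrightarrow> S (limit_map X) = X"
  shows "cocone_iso I Z Y \<psi> \<Z> (co_Cauchy_inj I Z \<phi>) S"
proof -
  have onto: "limit_map ` vcarrier \<Z> = vcarrier Y" using limit_map_bij by (simp add: bij_betw_def)
  have "S ` vcarrier Y = vcarrier \<Z>" unfolding onto[symmetric] image_image using assms by simp
  moreover have "lin_isometry Y \<Z> S"
    by (rule lin_isometry_inv[OF norm_co_Cauchy_space W.norm_nspace_axioms limit_map_isometry onto assms])
  moreover have "S (\<psi> R x) = co_Cauchy_inj I Z \<phi> R x" if "R \<in> I" "x \<in> vcarrier (Z R)" for R x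
    using inj_closed[OF that] assms by metis
  ultimately show ?thesis by (simp add: cocone_iso_def)
qed

text \<open>The injections are those of \<open>Y\<close> followed by the inverse of the limit map.\<close>

lemma cocone_co_Cauchy_space: "cocone I Z \<phi> \<Z> (co_Cauchy_inj I Z \<phi>)"
proof -
  let ?S = "inv_into (vcarrier \<Z>) limit_map"
  have S: "?S (limit_map X) = X" if "X \<in> vcarrier \<Z>" for X
    using limit_map_bij that by (simp add: bij_betw_def inv_into_f_f)
  have iso: "cocone_iso I Z Y \<psi> \<Z> (co_Cauchy_inj I Z \<phi>) ?S" by (rule inverse_iso) (rule S)
  have inj: "?S (\<psi> R x) = co_Cauchy_inj I Z \<phi> R x" if "R \<in> I" "x \<in> vcarrier (Z R)" for R x
    using iso that unfolding cocone_iso_def by blast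
  have "lin_isometry (Z R) \<Z> (co_Cauchy_inj I Z \<phi> R)" if R: "R \<in> I" for R
  proof -
    have "lin_isometry (Z R) \<Z> (\<lambda>x. ?S (\<psi> R x))"
      by (rule lin_isometry_compose[OF isometry[OF R]]) (use iso in \<open>simp add: cocone_iso_def\<close>)
    then show ?thesis
      using lin_isometry_cong[OF norm_Z[OF R], of "\<lambda>x. ?S (\<psi> R x)"] inj[OF R] by blast
  qed
  moreover have "co_Cauchy_inj I Z \<phi> R x = co_Cauchy_inj I Z \<phi> F (\<phi> R F x)"
    if "R \<in> I" "F \<in> I" "R \<le> F" "x \<in> vcarrier (Z R)" for R F x
  proof -
    have "\<psi> R x = \<psi> F (\<phi> R F x)" using cocone that unfolding cocone_def by blast
    then show ?thesis using inj[OF that(1,4)] inj[OF that(2) \<phi>_closed[OF that]] by simp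
  qed
  ultimately show ?thesis by (simp add: cocone_def banach_co_Cauchy_space)
qed

text \<open>The class of \<open>f\<close> is approximated by the members of \<open>f\<close> itself, because the limit map is
  isometric and turns the claim into the convergence that defines the limit.\<close>

lemma co_Cauchy_space_approx:
  assumes X: "X \<in> vcarrier \<Z>"
  shows "\<exists>f\<in>(\<Pi>\<^sub>E R\<in>I. vcarrier (Z R)). vlimit \<Z> (\<lambda>R. co_Cauchy_inj I Z \<phi> R (f R)) X (net I)"
proof -
  interpret C: norm_nspace \<Z> by (rule norm_co_Cauchy_space)
  obtain f where f: "f \<in> CC" "X = cls f" using X by (auto simp: carrier_eq)
  have fZ: "f R \<in> vcarrier (Z R)" if "R \<in> I" for R using f that by (auto simp: co_Cauchy_def)
  have lim: "((\<lambda>R. vdist Y (\<psi> R (f R)) (limit_map X)) \<longlongrightarrow> 0) (net I)"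
    using vlimit_net_lim[OF f(1)] f limit_map_cls by (simp add: W.vlimit_iff)
  have "vdist Y (\<psi> R (f R)) (limit_map X) = vdist \<Z> (co_Cauchy_inj I Z \<phi> R (f R)) X" if "R \<in> I" for R
    using inj_closed[OF that fZ[OF that]]
      lin_isometry_dist[OF C.norm_nspace_axioms W.norm_nspace_axioms limit_map_isometry _ X] by metis
  then have "eventually (\<lambda>R. vdist Y (\<psi> R (f R)) (limit_map X)
      = vdist \<Z> (co_Cauchy_inj I Z \<phi> R (f R)) X) (net I)"
    by (intro eventually_mono[OF eventually_in_I])
  with lim have "((\<lambda>R. vdist \<Z> (co_Cauchy_inj I Z \<phi> R (f R)) X) \<longlongrightarrow> 0) (net I)"
    by (rule Lim_transform_eventually)
  moreover have "eventually (\<lambda>R. co_Cauchy_inj I Z \<phi> R (f R) \<in> vcarrier \<Z>) (net I)"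
    using eventually_in_I by eventually_elim (simp add: inj_closed fZ)
  ultimately have "vlimit \<Z> (\<lambda>R. co_Cauchy_inj I Z \<phi> R (f R)) X (net I)"
    using X by (simp add: C.vlimit_iff)
  then show ?thesis using f(1) by (auto simp: co_Cauchy_def)
qed

text \<open>The space of co-Cauchy families is itself an approximating cocone.\<close>

theorem colimit_co_Cauchy_space: "colimit TYPE('w) I Z \<phi> \<Z> (co_Cauchy_inj I Z \<phi>)"
proof -
  interpret C: approximating_cocone I Z \<phi> \<Z> "co_Cauchy_inj I Z \<phi>"
    by unfold_locales (use cocone_co_Cauchy_space co_Cauchy_space_approx in auto)
  show ?thesis by (rule C.colimit_Y)
qed

text \<open>This computes the inverse of the limit map from any approximating family, for instance from
  conditional expectations.\<close>

lemma family_cls: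
  assumes f: "f \<in> (\<Pi>\<^sub>E R\<in>I. vcarrier (Z R))" and y: "vlimit Y (\<lambda>R. \<psi> R (f R)) y (net I)"
  shows "cls f \<in> vcarrier \<Z>" "limit_map (cls f) = y"
  using has_limit_co_Cauchy[OF f y] net_lim_unique[OF y] limit_map_cls by (auto simp: carrier_eq)

end

section \<open>The spaces \<open>L\<^sup>p\<close>\<close>

text \<open>Convexity on the open half line is extended to 0, where it reduces to \<open>t\<^sup>p \<le> t\<close>, and then to the
  real line by the triangle inequality, as the power is increasing.\<close>

lemma convex_on_abs_powr:
  fixes p :: real
  assumes p: "1 \<le> p"
  shows "convex_on UNIV (\<lambda>x::real. \<bar>x\<bar> powr p)"
proof -
  have nonneg: "(t * x + (1 - t) * y) powr p \<le> t * x powr p + (1 - t) * y powr p"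
    if "0 \<le> x" "0 \<le> y" "0 < t" "t < 1" for t x y :: real
  proof -
    have small: "t powr p \<le> t" if "0 < t" "t < 1" for t :: real
      using powr_mono'[of 1 p t] p that by simp
    consider "x = 0" | "y = 0" | "0 < x" "0 < y" using \<open>0 \<le> x\<close> \<open>0 \<le> y\<close> by linarith
    then show ?thesis
    proof cases
      case 1
      then show ?thesis
        using small[of "1 - t"] that by (simp add: powr_mult mult_right_mono)
    next
      case 2
      then show ?thesis using small[of t] that by (simp add: powr_mult mult_right_mono)
    next
      case 3
      then show ?thesis
        using convex_onD[OF powr_convex[OF p], of "1 - t" x y] that by simp
    qed
  qed
  show ?thesis
  proof (rule convex_onI)
    fix t x y :: real assume t: "0 < t" "t < 1"
    have "\<bar>(1 - t) * x + t * y\<bar> \<le> (1 - t) * \<bar>x\<bar> + t * \<bar>y\<bar>"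
      using abs_triangle_ineq[of "(1 - t) * x" "t * y"] t by (simp add: abs_mult)
    then have "\<bar>(1 - t) * x + t * y\<bar> powr p \<le> ((1 - t) * \<bar>x\<bar> + t * \<bar>y\<bar>) powr p"
      using p by (intro powr_mono2) auto
    also have "\<dots> \<le> (1 - t) * \<bar>x\<bar> powr p + t * \<bar>y\<bar> powr p"
      using nonneg[of "\<bar>x\<bar>" "\<bar>y\<bar>" "1 - t"] t by simp
    finally show "\<bar>(1 - t) *\<^sub>R x + t *\<^sub>R y\<bar> powr p \<le> (1 - t) * \<bar>x\<bar> powr p + t * \<bar>y\<bar> powr p"
      by simp
  qed simp
qed

definition Lp_norm :: "real \<Rightarrow> 'x measure \<Rightarrow> ('x \<Rightarrow> real) \<Rightarrow> real" where
  "Lp_norm p M f = (\<integral>x. \<bar>f x\<bar> powr p \<partial>M) powr (1 / p)"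

abbreviation Lp_class :: "real \<Rightarrow> 'x measure \<Rightarrow> ('x \<Rightarrow> real) \<Rightarrow> ('x \<Rightarrow> real) set" where
  "Lp_class p M f \<equiv> Lp_rel p M `` {f}"

locale Lp =
  fixes p :: real and M :: "'x measure"
  assumes p: "1 \<le> p"
begin

lemma Lp_fun_measurable [measurable_dest]: "f \<in> Lp_fun p M \<Longrightarrow> f \<in> borel_measurable M"
  and Lp_fun_integrable: "f \<in> Lp_fun p M \<Longrightarrow> integrable M (\<lambda>x. \<bar>f x\<bar> powr p)"
  by (auto simp: Lp_fun_def)

lemma Lp_fun_zero: "(\<lambda>x. 0) \<in> Lp_fun p M"
  by (simp add: Lp_fun_def)

lemma Lp_fun_bound:
  assumes g: "g \<in> Lp_fun p M" and f [measurable]: "f \<in> borel_measurable M"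
    and le: "AE x in M. \<bar>f x\<bar> \<le> \<bar>g x\<bar>"
  shows "f \<in> Lp_fun p M"
proof -
  have "integrable M (\<lambda>x. \<bar>f x\<bar> powr p)"
  proof (rule Bochner_Integration.integrable_bound[OF Lp_fun_integrable[OF g]])
    show "AE x in M. norm (\<bar>f x\<bar> powr p) \<le> norm (\<bar>g x\<bar> powr p)"
      using le by eventually_elim (use p in \<open>simp add: powr_mono2\<close>)
  qed measurable
  then show ?thesis by (simp add: Lp_fun_def f)
qed

lemma Lp_fun_scale:
  assumes f: "f \<in> Lp_fun p M"
  shows "(\<lambda>x. a * f x) \<in> Lp_fun p M"
proof -
  note [measurable] = Lp_fun_measurable[OF f]
  have "integrable M (\<lambda>x. \<bar>a * f x\<bar> powr p)"
    using Lp_fun_integrable[OF f] by (simp add: abs_mult powr_mult)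
  then show ?thesis by (simp add: Lp_fun_def)
qed

lemma Lp_fun_add:
  assumes f: "f \<in> Lp_fun p M" and g: "g \<in> Lp_fun p M"
  shows "(\<lambda>x. f x + g x) \<in> Lp_fun p M"
proof -
  note [measurable] = Lp_fun_measurable[OF f] Lp_fun_measurable[OF g]
  have "integrable M (\<lambda>x. \<bar>f x + g x\<bar> powr p)"
  proof (rule Bochner_Integration.integrable_bound)
    show "integrable M (\<lambda>x. 2 powr p * (\<bar>f x\<bar> powr p + \<bar>g x\<bar> powr p))"
      using Lp_fun_integrable[OF f] Lp_fun_integrable[OF g] by simp
    have "\<bar>f x + g x\<bar> powr p \<le> 2 powr p * (\<bar>f x\<bar> powr p + \<bar>g x\<bar> powr p)" for x
    proof -
      have "\<bar>f x + g x\<bar> powr p \<le> (2 * max \<bar>f x\<bar> \<bar>g x\<bar>) powr p"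
        using p by (intro powr_mono2) auto
      also have "\<dots> \<le> 2 powr p * (\<bar>f x\<bar> powr p + \<bar>g x\<bar> powr p)"
        by (auto simp: powr_mult max_def)
      finally show ?thesis .
    qed
    then show "AE x in M. norm (\<bar>f x + g x\<bar> powr p)
        \<le> norm (2 powr p * (\<bar>f x\<bar> powr p + \<bar>g x\<bar> powr p))"
      by (auto intro!: AE_I2 order_trans[OF _ abs_ge_self])
  qed measurable
  then show ?thesis by (simp add: Lp_fun_def)
qed

lemma Lp_fun_uminus: "f \<in> Lp_fun p M \<Longrightarrow> (\<lambda>x. - f x) \<in> Lp_fun p M"
  using Lp_fun_scale[of f "-1"] by simp

lemma Lp_fun_diff:
  assumes "f \<in> Lp_fun p M" "g \<in> Lp_fun p M"
  shows "(\<lambda>x. f x - g x) \<in> Lp_fun p M"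
  using Lp_fun_add[OF assms(1) Lp_fun_scale[OF assms(2), of "-1"]] by simp

lemma Lp_norm_nonneg: "0 \<le> Lp_norm p M f"
  by (simp add: Lp_norm_def)

lemma Lp_norm_powr: "Lp_norm p M f powr p = (\<integral>x. \<bar>f x\<bar> powr p \<partial>M)"
  using p by (simp add: Lp_norm_def powr_powr)

lemma Lp_norm_le_iff: "0 \<le> c \<Longrightarrow> Lp_norm p M f \<le> c \<longleftrightarrow> (\<integral>x. \<bar>f x\<bar> powr p \<partial>M) \<le> c powr p"
proof -
  assume c: "0 \<le> c"
  show ?thesis
    unfolding Lp_norm_powr[symmetric]
    using powr_mono2[of p "Lp_norm p M f" c] powr_less_mono2[of p c "Lp_norm p M f"] c p
      Lp_norm_nonneg[of f] by linarith
qed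

lemma Lp_norm_cong:
  assumes "AE x in M. \<bar>f x\<bar> = \<bar>g x\<bar>" "f \<in> borel_measurable M" "g \<in> borel_measurable M"
  shows "Lp_norm p M f = Lp_norm p M g"
  unfolding Lp_norm_def
  using assms by (intro arg_cong2[where f="(powr)"] integral_cong_AE) auto

lemma Lp_norm_scale: "Lp_norm p M (\<lambda>x. a * f x) = \<bar>a\<bar> * Lp_norm p M f"
  using p by (simp add: Lp_norm_def abs_mult powr_mult powr_powr)

lemma Lp_norm_eq_0_iff:
  assumes f: "f \<in> Lp_fun p M"
  shows "Lp_norm p M f = 0 \<longleftrightarrow> (AE x in M. f x = 0)"
  using integral_nonneg_eq_0_iff_AE[OF Lp_fun_integrable[OF f]] by (simp add: Lp_norm_def)

text \<open>Minkowski's inequality: after normalising, \<open>f + g\<close> is a convex combination of two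
  functions of norm one, so it follows from the convexity of \<open>\<bar>x\<bar>\<^sup>p\<close>.\<close>

lemma Lp_norm_triangle:
  assumes f: "f \<in> Lp_fun p M" and g: "g \<in> Lp_fun p M"
  shows "Lp_norm p M (\<lambda>x. f x + g x) \<le> Lp_norm p M f + Lp_norm p M g"
proof -
  note meas [measurable] = Lp_fun_measurable[OF f] Lp_fun_measurable[OF g]
  define a where "a = Lp_norm p M f"
  define b where "b = Lp_norm p M g"
  have ab: "0 \<le> a" "0 \<le> b" by (simp_all add: a_def b_def Lp_norm_nonneg)
  consider "a = 0" | "b = 0" | "0 < a" "0 < b" using ab by linarith
  then show ?thesis
  proof cases
    case 1
    then have "AE x in M. f x = 0" using Lp_norm_eq_0_iff[OF f] by (simp add: a_def)
    then have "Lp_norm p M (\<lambda>x. f x + g x) = Lp_norm p M g"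
      by (intro Lp_norm_cong) auto
    then show ?thesis using Lp_norm_nonneg[of f] by simp
  next
    case 2
    then have "AE x in M. g x = 0" using Lp_norm_eq_0_iff[OF g] by (simp add: b_def)
    then have "Lp_norm p M (\<lambda>x. f x + g x) = Lp_norm p M f"
      by (intro Lp_norm_cong) auto
    then show ?thesis using Lp_norm_nonneg[of g] by simp
  next
    case 3
    define t where "t = b / (a + b)"
    have t: "0 \<le> t" "t \<le> 1" "1 - t = a / (a + b)" using 3 by (auto simp: t_def field_simps)
    \<comment> \<open>\<open>f + g = (a + b) ((1 - t) f/a + t g/b)\<close>, where \<open>f/a\<close> and \<open>g/b\<close> have norm one.\<close>
    have pw: "\<bar>f x + g x\<bar> powr p
        \<le> (a + b) powr p * ((1 - t) * (\<bar>f x\<bar> powr p / a powr p) + t * (\<bar>g x\<bar> powr p / b powr p))" for x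
    proof -
      have "f x + g x = (a + b) * ((1 - t) * (f x / a) + t * (g x / b))"
        unfolding t(3) unfolding t_def using 3 by (simp add: add_divide_distrib[symmetric])
      then have "\<bar>f x + g x\<bar> powr p = (a + b) powr p * \<bar>(1 - t) * (f x / a) + t * (g x / b)\<bar> powr p"
        using 3 by (simp add: abs_mult powr_mult)
      also have "\<dots> \<le> (a + b) powr p * ((1 - t) * \<bar>f x / a\<bar> powr p + t * \<bar>g x / b\<bar> powr p)"
        using convex_onD[OF convex_on_abs_powr[OF p], of t "f x / a" "g x / b"] t
        by (intro mult_left_mono) auto
      finally show ?thesis using 3 by (simp add: powr_divide)
    qed
    have "(\<integral>x. \<bar>f x + g x\<bar> powr p \<partial>M)
        \<le> (\<integral>x. (a + b) powr p * ((1 - t) * (\<bar>f x\<bar> powr p / a powr p) + t * (\<bar>g x\<bar> powr p / b powr p)) \<partial>M)"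
      using Lp_fun_integrable[OF f] Lp_fun_integrable[OF g] Lp_fun_integrable[OF Lp_fun_add[OF f g]]
      by (intro integral_mono pw) auto
    also have "\<dots> = (a + b) powr p * ((1 - t) * (a powr p / a powr p) + t * (b powr p / b powr p))"
      using Lp_fun_integrable[OF f] Lp_fun_integrable[OF g] by (simp add: a_def b_def Lp_norm_powr)
    also have "\<dots> = (a + b) powr p" using 3 by simp
    finally show ?thesis using Lp_norm_le_iff[of "a + b"] ab by (simp add: a_def b_def)
  qed
qed

lemma Lp_norm_diff_triangle:
  assumes "f \<in> Lp_fun p M" "g \<in> Lp_fun p M" "h \<in> Lp_fun p M"
  shows "Lp_norm p M (\<lambda>x. f x - h x) \<le> Lp_norm p M (\<lambda>x. f x - g x) + Lp_norm p M (\<lambda>x. g x - h x)"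
  using Lp_norm_triangle[OF Lp_fun_diff[OF assms(1,2)] Lp_fun_diff[OF assms(2,3)]] by simp

lemma Lp_norm_minus: "Lp_norm p M (\<lambda>x. f x - g x) = Lp_norm p M (\<lambda>x. g x - f x)"
  by (simp add: Lp_norm_def abs_minus_commute)

lemma Lp_dominated_convergence:
  assumes w: "w \<in> Lp_fun p M" and f [measurable]: "f \<in> borel_measurable M"
    and s [measurable]: "\<And>i. s i \<in> borel_measurable M"
    and lim: "AE x in M. (\<lambda>i. s i x) \<longlonglongrightarrow> f x"
    and bound: "\<And>i. AE x in M. \<bar>s i x - f x\<bar> \<le> \<bar>w x\<bar>"
  shows "(\<lambda>i. Lp_norm p M (\<lambda>x. s i x - f x)) \<longlonglongrightarrow> 0"
proof -
  have "(\<lambda>i. \<integral>x. \<bar>s i x - f x\<bar> powr p \<partial>M) \<longlonglongrightarrow> (\<integral>x. 0 \<partial>M)"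
  proof (rule integral_dominated_convergence[where w="\<lambda>x. \<bar>w x\<bar> powr p"])
    show "integrable M (\<lambda>x. \<bar>w x\<bar> powr p)" by (rule Lp_fun_integrable[OF w])
    show "AE x in M. (\<lambda>i. \<bar>s i x - f x\<bar> powr p) \<longlonglongrightarrow> 0"
      using lim
    proof eventually_elim
      case (elim x)
      then have "(\<lambda>i. \<bar>s i x - f x\<bar>) \<longlonglongrightarrow> 0" by (simp add: LIM_zero tendsto_rabs_zero)
      then have "(\<lambda>i. \<bar>s i x - f x\<bar> powr p) \<longlonglongrightarrow> 0 powr p"
        using p by (intro tendsto_powr' tendsto_const) auto
      then show ?case by simp
    qed
    show "AE x in M. norm (\<bar>s i x - f x\<bar> powr p) \<le> \<bar>w x\<bar> powr p" for i
      using bound[of i] by eventually_elim (use p in \<open>simp add: powr_mono2\<close>)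
  qed auto
  then have "(\<lambda>i. (\<integral>x. \<bar>s i x - f x\<bar> powr p \<partial>M) powr (1 / p)) \<longlonglongrightarrow> 0 powr (1 / p)"
    using p by (intro tendsto_powr' tendsto_const) auto
  then show ?thesis by (simp add: Lp_norm_def)
qed

text \<open>The Riesz-Fischer theorem.  Along a subsequence with \<open>\<parallel>f\<^sub>k\<^sub>+\<^sub>1 - f\<^sub>k\<parallel> \<le> 4\<^sup>-\<^sup>k\<close>, Markov's inequality and
  the Borel-Cantelli lemma give \<open>\<bar>f\<^sub>k\<^sub>+\<^sub>1 - f\<^sub>k\<bar> < 2\<^sup>-\<^sup>k\<close> eventually, almost everywhere, hence
  pointwise convergence; Fatou's lemma turns the pointwise limit into a limit in norm.\<close>

lemma Lp_complete:
  assumes f: "\<And>n. f n \<in> Lp_fun p M"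
    and Cauchy: "\<And>e. e > 0 \<Longrightarrow> \<exists>N. \<forall>m\<ge>N. \<forall>n\<ge>N. Lp_norm p M (\<lambda>x. f m x - f n x) < e"
  shows "\<exists>g\<in>Lp_fun p M. (\<lambda>n. Lp_norm p M (\<lambda>x. f n x - g x)) \<longlonglongrightarrow> 0"
proof -
  have [measurable]: "f n \<in> borel_measurable M" for n using f by (rule Lp_fun_measurable)
  have "\<exists>N. \<forall>m\<ge>N. \<forall>n\<ge>N. Lp_norm p M (\<lambda>x. f m x - f n x) < (1/4) ^ k" for k
    by (rule Cauchy) simp
  then obtain N where N: "\<And>k m n. \<lbrakk>m \<ge> N k; n \<ge> N k\<rbrakk> \<Longrightarrow> Lp_norm p M (\<lambda>x. f m x - f n x) < (1/4) ^ k"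
    by metis
  \<comment> \<open>The sum makes \<open>r\<close> increasing and at least \<open>N\<close>; adding \<open>k\<close> makes it unbounded.\<close>
  define r where "r k = (\<Sum>j\<le>k. N j) + k" for k
  have r: "r k \<ge> N k" "r k \<le> r (Suc k)" "r k \<ge> k" for k
    using member_le_sum[of k "{..k}" N] by (auto simp: r_def)
  have step: "Lp_norm p M (\<lambda>x. f (r (Suc k)) x - f (r k) x) < (1/4) ^ k" for k
    using N[of k "r (Suc k)" "r k"] r(1,2)[of k] by simp
  \<comment> \<open>The norms are below \<open>4\<^sup>-\<^sup>k\<close>, so Markov at the level \<open>2\<^sup>-\<^sup>k\<close> leaves the summable bound \<open>2\<^sup>-\<^sup>k\<close>.\<close>
  define A where "A k = {x\<in>space M. ((1/2) ^ k) powr p \<le> \<bar>f (r (Suc k)) x - f (r k) x\<bar> powr p}" for k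
  have A [measurable]: "A k \<in> sets M" for k unfolding A_def by measurable
  have Ale: "emeasure M (A k) \<le> ennreal ((1/2) ^ k)" for k
  proof -
    have "emeasure M (A k)
        \<le> ennreal (1 / ((1/2) ^ k) powr p * (\<integral>x. \<bar>f (r (Suc k)) x - f (r k) x\<bar> powr p \<partial>M))"
      unfolding A_def
      by (rule integral_Markov_inequality) (auto intro!: Lp_fun_integrable Lp_fun_diff f)
    also have "1 / ((1/2) ^ k) powr p * (\<integral>x. \<bar>f (r (Suc k)) x - f (r k) x\<bar> powr p \<partial>M)
        \<le> 1 / ((1/2) ^ k) powr p * ((1/4) ^ k) powr p"
      using step[of k] p
      by (intro mult_left_mono) (auto simp: Lp_norm_powr[symmetric] intro!: powr_mono2 Lp_norm_nonneg)
    also have "\<dots> = ((1/4) ^ k / (1/2) ^ k) powr p" by (simp add: powr_divide)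
    also have "(1/4) ^ k / (1/2) ^ k = ((1/2) ^ k :: real)"
      by (simp add: power_divide[symmetric] flip: power_mult_distrib)
    also have "((1/2) ^ k) powr p \<le> ((1/2) ^ k :: real) powr 1"
      using p by (intro powr_mono') (auto simp: power_le_one)
    finally show ?thesis by (simp add: ennreal_leI)
  qed
  have "AE x in M. eventually (\<lambda>k. x \<in> space M - A k) sequentially"
  proof (rule borel_cantelli_AE1[OF A])
    show "emeasure M (A k) < \<infinity>" for k using Ale[of k] by (auto intro: le_less_trans)
    have "measure M (A k) \<le> (1/2) ^ k" for k
      using Ale[of k] by (simp add: measure_def enn2real_leI)
    then show "summable (\<lambda>k. measure M (A k))"
      by (intro summable_comparison_test'[OF summable_geometric[of "1/2"]]) auto
  qed
  then have conv: "AE x in M. convergent (\<lambda>k. f (r k) x)"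
  proof eventually_elim
    case (elim x)
    have "eventually (\<lambda>k. norm (f (r (Suc k)) x - f (r k) x) \<le> (1/2) ^ k) sequentially"
      using elim
    proof eventually_elim
      case (elim k)
      then show ?case
        using powr_mono2[of p "(1/2) ^ k" "\<bar>f (r (Suc k)) x - f (r k) x\<bar>"] p
        by (cases "(1/2) ^ k \<le> \<bar>f (r (Suc k)) x - f (r k) x\<bar>") (auto simp: A_def not_le)
    qed
    then have "summable (\<lambda>k. f (r (Suc k)) x - f (r k) x)"
      by (rule summable_comparison_test_ev) (simp add: summable_geometric)
    then have "convergent (\<lambda>n. \<Sum>k<n. f (r (Suc k)) x - f (r k) x)"
      by (simp add: summable_iff_convergent)
    then have "convergent (\<lambda>n. f (r n) x - f (r 0) x)" by (simp only: sum_lessThan_telescope[of "\<lambda>k. f (r k) x"])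
    then have "convergent (\<lambda>n. (f (r n) x - f (r 0) x) + f (r 0) x)"
      by (intro convergent_add convergent_const)
    then show ?case by simp
  qed
  define g where "g x = lim (\<lambda>k. f (r k) x)" for x
  have g [measurable]: "g \<in> borel_measurable M" unfolding g_def by measurable
  have lim: "AE x in M. (\<lambda>k. f (r k) x) \<longlonglongrightarrow> g x"
    using conv by eventually_elim (simp add: g_def convergent_LIMSEQ_iff)
  have fatou: "(\<integral>\<^sup>+x. ennreal (\<bar>f m x - g x\<bar> powr p) \<partial>M) \<le> ennreal (((1/4) ^ k) powr p)"
    if m: "m \<ge> N k" for m k
  proof -
    have "(\<integral>\<^sup>+x. ennreal (\<bar>f m x - g x\<bar> powr p) \<partial>M)
        \<le> (\<integral>\<^sup>+x. liminf (\<lambda>j. ennreal (\<bar>f m x - f (r j) x\<bar> powr p)) \<partial>M)"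
    proof (rule nn_integral_mono_AE)
      show "AE x in M. ennreal (\<bar>f m x - g x\<bar> powr p)
          \<le> liminf (\<lambda>j. ennreal (\<bar>f m x - f (r j) x\<bar> powr p))"
        using lim
      proof eventually_elim
        case (elim x)
        have "(\<lambda>j. ennreal (\<bar>f m x - f (r j) x\<bar> powr p)) \<longlonglongrightarrow> ennreal (\<bar>f m x - g x\<bar> powr p)"
          using p by (intro tendsto_ennrealI tendsto_powr' tendsto_const tendsto_rabs tendsto_diff elim) auto
        from lim_imp_Liminf[OF sequentially_bot this] show ?case by (simp only: order_refl)
      qed
    qed
    also have "\<dots> \<le> liminf (\<lambda>j. \<integral>\<^sup>+x. ennreal (\<bar>f m x - f (r j) x\<bar> powr p) \<partial>M)"
      by (rule nn_integral_liminf) measurable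
    also have "\<dots> \<le> ennreal (((1/4) ^ k) powr p)"
    proof (rule Liminf_le)
      show "eventually (\<lambda>j. (\<integral>\<^sup>+x. ennreal (\<bar>f m x - f (r j) x\<bar> powr p) \<partial>M)
          \<le> ennreal (((1/4) ^ k) powr p)) sequentially"
        unfolding eventually_sequentially
      proof (intro exI[of _ "N k"] allI impI)
        fix j assume "N k \<le> j"
        then have "N k \<le> r j" using r(3)[of j] by simp
        then have "(\<integral>x. \<bar>f m x - f (r j) x\<bar> powr p \<partial>M) \<le> ((1/4) ^ k) powr p"
          using less_imp_le[OF N[OF m, of "r j"]]
              Lp_norm_le_iff[of "(1/4) ^ k" "\<lambda>x. f m x - f (r j) x"] by simp
        then show "(\<integral>\<^sup>+x. ennreal (\<bar>f m x - f (r j) x\<bar> powr p) \<partial>M) \<le> ennreal (((1/4) ^ k) powr p)"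
          by (subst nn_integral_eq_integral) (auto intro!: Lp_fun_integrable Lp_fun_diff f ennreal_leI)
      qed
    qed simp
    finally show ?thesis .
  qed
  \<comment> \<open>Membership of \<open>g\<close> in \<open>L\<^sup>p\<close> is obtained at the end as \<open>f m - (f m - g)\<close>.\<close>
  have fg: "(\<lambda>x. f m x - g x) \<in> Lp_fun p M" if "m \<ge> N k" for m k
  proof -
    have "integrable M (\<lambda>x. \<bar>f m x - g x\<bar> powr p)"
      using fatou[OF that] by (intro integrableI_nonneg) (auto intro: le_less_trans)
    then show ?thesis by (simp add: Lp_fun_def)
  qed
  have le: "Lp_norm p M (\<lambda>x. f m x - g x) \<le> (1/4) ^ k" if "m \<ge> N k" for m k
    using fatou[OF that] Lp_fun_integrable[OF fg[OF that]]
    by (subst Lp_norm_le_iff) (simp_all add: nn_integral_eq_integral)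
  have "(\<lambda>n. Lp_norm p M (\<lambda>x. f n x - g x)) \<longlonglongrightarrow> 0"
  proof (rule LIMSEQ_I)
    fix e :: real assume "e > 0"
    then obtain k where k: "(1/4) ^ k < e" using real_arch_pow_inv[of e "1/4"] by auto
    show "\<exists>no. \<forall>n\<ge>no. norm (Lp_norm p M (\<lambda>x. f n x - g x) - 0) < e"
      using le[of k] k Lp_norm_nonneg by (intro exI[of _ "N k"]) (auto intro: le_less_trans)
  qed
  moreover have "g \<in> Lp_fun p M"
    using Lp_fun_diff[OF f fg[of 0 "N 0"], of "N 0"] by simp
  ultimately show ?thesis by blast
qed

lemma equiv_Lp: "equiv (Lp_fun p M) (Lp_rel p M)"
  by (intro equivI refl_onI symI transI) (auto simp: Lp_rel_def)

lemma Lp_class_eq_iff: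
  "\<lbrakk>f \<in> Lp_fun p M; g \<in> Lp_fun p M\<rbrakk> \<Longrightarrow> Lp_class p M f = Lp_class p M g \<longleftrightarrow> (AE x in M. f x = g x)"
  using eq_equiv_class_iff[OF equiv_Lp] by (simp add: Lp_rel_def)

lemma carrier_Lp: "vcarrier (Lp_space p M) = Lp_class p M ` Lp_fun p M"
  by (auto simp: Lp_space_def quotient_def)

lemma Lp_class_closed: "f \<in> Lp_fun p M \<Longrightarrow> Lp_class p M f \<in> vcarrier (Lp_space p M)"
  by (simp add: carrier_Lp)

lemma zero_Lp: "vzero (Lp_space p M) = Lp_class p M (\<lambda>x. 0)"
  by (simp add: Lp_space_def)

lemma add_Lp:
  assumes "f \<in> Lp_fun p M" "g \<in> Lp_fun p M"
  shows "vadd (Lp_space p M) (Lp_class p M f) (Lp_class p M g) = Lp_class p M (\<lambda>x. f x + g x)"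
proof -
  have "congruent2 (Lp_rel p M) (Lp_rel p M) (\<lambda>f g. Lp_class p M (\<lambda>x. f x + g x))"
    by (rule congruent2I') (auto simp: Lp_rel_def Lp_class_eq_iff Lp_fun_add simp del: Image_singleton_iff intro!: Lp_class_eq_iff[THEN iffD2])
  from UN_equiv_class2[OF equiv_Lp equiv_Lp this assms] show ?thesis by (simp add: Lp_space_def)
qed

lemma scale_Lp:
  assumes "f \<in> Lp_fun p M"
  shows "vscale (Lp_space p M) a (Lp_class p M f) = Lp_class p M (\<lambda>x. a * f x)"
proof -
  have "congruent (Lp_rel p M) (\<lambda>f. Lp_class p M (\<lambda>x. a * f x))"
    by (rule congruentI) (auto simp: Lp_rel_def Lp_fun_scale intro!: Lp_class_eq_iff[THEN iffD2])
  from UN_equiv_class[OF equiv_Lp this assms] show ?thesis by (simp add: Lp_space_def)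
qed

lemma mem_Lp_class: "g \<in> Lp_class p M f \<longleftrightarrow> f \<in> Lp_fun p M \<and> g \<in> Lp_fun p M \<and> (AE x in M. f x = g x)"
  by (simp add: Lp_rel_def)

lemma norm_Lp:
  assumes "f \<in> Lp_fun p M"
  shows "vnorm (Lp_space p M) (Lp_class p M f) = Lp_norm p M f"
proof -
  have "Lp_norm p M g = Lp_norm p M f" if "g \<in> Lp_class p M f" for g
    using that unfolding mem_Lp_class by (intro Lp_norm_cong) (auto simp: Lp_fun_measurable)
  moreover have "f \<in> Lp_class p M f" using assms by (simp add: Lp_rel_def)
  ultimately have "Lp_norm p M ` Lp_class p M f = {Lp_norm p M f}" by blast
  then show ?thesis by (simp add: Lp_space_def Lp_norm_def)
qed

lemma dist_Lp:
  assumes "f \<in> Lp_fun p M" "g \<in> Lp_fun p M"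
  shows "vdist (Lp_space p M) (Lp_class p M f) (Lp_class p M g) = Lp_norm p M (\<lambda>x. f x - g x)"
  using assms Lp_fun_diff[OF assms] Lp_fun_scale[of g "-1"]
  by (simp add: vdist_def carrier_Lp scale_Lp add_Lp norm_Lp)

lemma norm_nspace_Lp: "norm_nspace (Lp_space p M)"
proof
  show "real_vs (Lp_space p M)"
    unfolding real_vs_def carrier_Lp zero_Lp
    by (auto simp: add_Lp scale_Lp Lp_fun_add Lp_fun_scale Lp_fun_uminus Lp_fun_zero algebra_simps
        simp del: Image_singleton_iff)
  fix x assume "x \<in> vcarrier (Lp_space p M)"
  then obtain f where f: "f \<in> Lp_fun p M" "x = Lp_class p M f" by (auto simp: carrier_Lp)
  show "vnorm (Lp_space p M) x = 0 \<longleftrightarrow> x = vzero (Lp_space p M)"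
    unfolding f(2) norm_Lp[OF f(1)] zero_Lp Lp_class_eq_iff[OF f(1) Lp_fun_zero]
    by (rule Lp_norm_eq_0_iff[OF f(1)])
qed (auto simp: carrier_Lp zero_Lp add_Lp scale_Lp norm_Lp Lp_fun_add Lp_fun_scale Lp_fun_zero
      Lp_norm_nonneg Lp_norm_scale Lp_norm_triangle
      simp del: Image_singleton_iff)

theorem banach_Lp: "banach_space (Lp_space p M)"
proof -
  interpret V: norm_nspace "Lp_space p M" by (rule norm_nspace_Lp)
  have "V.mcomplete"
    unfolding V.mcomplete_def
  proof (intro allI impI)
    fix s assume s: "V.MCauchy s"
    then have "range s \<subseteq> Lp_class p M ` Lp_fun p M"
      unfolding V.MCauchy_def unfolding carrier_Lp by blast
    then have "\<forall>n. \<exists>f\<in>Lp_fun p M. s n = Lp_class p M f" by blast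
    then obtain f where f: "\<And>n. f n \<in> Lp_fun p M" "\<And>n. s n = Lp_class p M (f n)" by metis
    have "\<exists>N. \<forall>m\<ge>N. \<forall>n\<ge>N. Lp_norm p M (\<lambda>x. f m x - f n x) < e" if "e > 0" for e
    proof -
      obtain N where "\<And>m n. \<lbrakk>N \<le> m; N \<le> n\<rbrakk> \<Longrightarrow> vdist (Lp_space p M) (s m) (s n) < e"
        using s \<open>e > 0\<close> unfolding V.MCauchy_def by metis
      then show ?thesis
        by (intro exI[of _ N] allI impI) (simp only: f(2) dist_Lp[OF f(1) f(1)])
    qed
    from Lp_complete[OF f(1) this] obtain g where g: "g \<in> Lp_fun p M"
      "(\<lambda>n. Lp_norm p M (\<lambda>x. f n x - g x)) \<longlonglongrightarrow> 0" by blast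
    then have "vlimit (Lp_space p M) s (Lp_class p M g) sequentially"
      using f(1) unfolding V.vlimit_iff by (simp add: f(2) dist_Lp Lp_class_closed)
    then show "\<exists>x. vlimit (Lp_space p M) s x sequentially" ..
  qed
  then show ?thesis by (simp add: banach_space_iff norm_nspace_Lp)
qed

end

subsection \<open>Pull-backs along measure preserving maps\<close>

text \<open>The measure \<open>N\<close> is assumed to equal the image measure of \<open>M\<close>, so all integrals over \<open>N\<close> are
  integrals over \<open>M\<close> of the composed functions.\<close>

lemma Lp_pull_class:
  assumes p: "1 \<le> p" and u [measurable]: "u \<in> measurable M N" and N: "distr M N u = N"
    and f: "f \<in> Lp_fun p N"
  shows "f \<circ> u \<in> Lp_fun p M" "Lp_norm p M (f \<circ> u) = Lp_norm p N f"
    and "Lp_pull p M u (Lp_class p N f) = Lp_class p M (f \<circ> u)"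
proof -
  interpret M: Lp p M by unfold_locales (rule p)
  interpret N: Lp p N by unfold_locales (rule p)
  have closed: "g \<circ> u \<in> Lp_fun p M" if g: "g \<in> Lp_fun p N" for g
  proof -
    note [measurable] = N.Lp_fun_measurable[OF g]
    have "integrable (distr M N u) (\<lambda>x. \<bar>g x\<bar> powr p)" unfolding N by (rule N.Lp_fun_integrable[OF g])
    then have "integrable M (\<lambda>x. \<bar>g (u x)\<bar> powr p)" by (subst (asm) integrable_distr_eq) auto
    then show ?thesis by (simp add: Lp_fun_def comp_def)
  qed
  show "f \<circ> u \<in> Lp_fun p M" by (rule closed[OF f])
  have [measurable]: "f \<in> borel_measurable N" by (rule N.Lp_fun_measurable[OF f])
  have "(\<integral>x. \<bar>f x\<bar> powr p \<partial>distr M N u) = (\<integral>x. \<bar>f (u x)\<bar> powr p \<partial>M)"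
    by (rule integral_distr) auto
  then show "Lp_norm p M (f \<circ> u) = Lp_norm p N f" by (simp add: N Lp_norm_def)
  have "congruent (Lp_rel p N) (\<lambda>f. Lp_class p M (f \<circ> u))"
  proof (rule congruentI)
    fix g h assume "(g, h) \<in> Lp_rel p N"
    then have gh: "g \<in> Lp_fun p N" "h \<in> Lp_fun p N" and ae: "AE x in N. g x = h x"
      by (auto simp: Lp_rel_def)
    note [measurable] = N.Lp_fun_measurable[OF gh(1)] N.Lp_fun_measurable[OF gh(2)]
    have "AE x in distr M N u. g x = h x" using ae by (subst N)
    then have "AE x in M. g (u x) = h (u x)" by (subst (asm) AE_distr_iff) auto
    then show "Lp_class p M (g \<circ> u) = Lp_class p M (h \<circ> u)"
      using M.Lp_class_eq_iff[OF closed[OF gh(1)] closed[OF gh(2)]] by simp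
  qed
  from UN_equiv_class[OF N.equiv_Lp this f]
  show "Lp_pull p M u (Lp_class p N f) = Lp_class p M (f \<circ> u)" by (simp add: Lp_pull_def)
qed

lemma lin_isometry_Lp_pull:
  assumes p: "1 \<le> p" and u: "u \<in> measurable M N" "distr M N u = N"
  shows "lin_isometry (Lp_space p N) (Lp_space p M) (Lp_pull p M u)"
proof -
  interpret M: Lp p M by unfold_locales (rule p)
  interpret N: Lp p N by unfold_locales (rule p)
  note pull = Lp_pull_class[OF p u]
  have eqs: "(\<lambda>x. f x + g x) \<circ> u = (\<lambda>x. (f \<circ> u) x + (g \<circ> u) x)"
    "(\<lambda>x. a * f x) \<circ> u = (\<lambda>x. a * (f \<circ> u) x)" for f g a by auto
  show ?thesis
    unfolding lin_isometry_def N.carrier_Lp M.carrier_Lp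
    by (auto simp: eqs pull N.add_Lp M.add_Lp N.scale_Lp M.scale_Lp N.norm_Lp M.norm_Lp
        N.Lp_fun_add N.Lp_fun_scale simp del: comp_apply Image_singleton_iff)
qed

section \<open>Uniqueness of measures with a given characteristic function\<close>

lemma integrable_bounded:
  fixes f :: "_ \<Rightarrow> 'b::{banach, second_countable_topology}"
  assumes "finite_measure M" "f \<in> borel_measurable M" "\<And>x. norm (f x) \<le> C"
  shows "integrable M f"
  using assms by (intro finite_measure.integrable_const_bound[where B=C]) auto

text \<open>If \<open>v\<close> has positive integral, normalising \<open>v M\<close> and pushing it forward along \<open>X\<close> gives a probability
  measure on the line whose characteristic function is known by assumption, and Levy's theorem
  applies.  Otherwise \<open>v\<close> vanishes almost everywhere for both measures.\<close>

lemma Levy_uniqueness_weighted: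
  fixes X v :: "'x \<Rightarrow> real"
  assumes M: "finite_measure M" and N: "finite_measure N" and sets: "sets N = sets M"
    and X [measurable]: "X \<in> borel_measurable M" and v [measurable]: "v \<in> borel_measurable M"
    and bound: "\<And>x. 0 \<le> v x" "\<And>x. v x \<le> C"
    and char: "\<And>s. (CLINT x|M. v x *\<^sub>R iexp (s * X x)) = (CLINT x|N. v x *\<^sub>R iexp (s * X x))"
    and A [measurable]: "A \<in> sets borel"
  shows "(LINT x|M. v x * indicator A (X x)) = (LINT x|N. v x * indicator A (X x))"
proof -
  define m where "m = (LINT x|M. v x)"
  have int: "integrable K v" if "finite_measure K" "sets K = sets M" for K
    using that bound measurable_cong_sets[OF that(2) refl] v
    by (intro integrable_bounded[of K v C]) auto
  have "complex_of_real (LINT x|M. v x) = complex_of_real (LINT x|N. v x)"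
    using char[of 0] by (simp add: scaleR_conv_of_real)
  then have mN: "m = (LINT x|N. v x)" by (simp add: m_def)
  show ?thesis
  proof (cases "m = 0")
    case True
    have "(LINT x|K. v x * indicator A (X x)) = 0"
      if K: "finite_measure K" and sK [measurable_cong]: "sets K = sets M" and "(LINT x|K. v x) = 0" for K
    proof -
      have "AE x in K. v x = 0"
        using that integral_nonneg_eq_0_iff_AE[OF int[OF K sK]] bound by simp
      then have "AE x in K. v x * indicator A (X x) = 0" by eventually_elim simp
      then have "(LINT x|K. v x * indicator A (X x)) = (LINT x|K. 0)" by (intro integral_cong_AE) auto
      then show ?thesis by simp
    qed
    from this[OF M refl] this[OF N sets] True mN show ?thesis by (simp add: m_def)
  next
    case False
    have "0 \<le> m" unfolding m_def using bound by simp
    with False have m: "0 < m" by simp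
    define D where "D K = distr (density K (\<lambda>x. ennreal (v x / m))) borel X" for K
    have D: "real_distribution (D K)"
        "char (D K) s = (CLINT x|K. v x *\<^sub>R iexp (s * X x)) / m"
        "measure (D K) A = (LINT x|K. v x * indicator A (X x)) / m"
      if K: "finite_measure K" and sK [measurable_cong]: "sets K = sets M" and mK: "(LINT x|K. v x) = m" for K s
    proof -
      interpret P: prob_space "density K (\<lambda>x. ennreal (v x / m))"
      proof
        have "emeasure (density K (\<lambda>x. ennreal (v x / m))) (space (density K (\<lambda>x. ennreal (v x / m))))
            = (\<integral>\<^sup>+x. ennreal (v x / m) \<partial>K)"
          by (subst emeasure_density) (auto intro!: nn_integral_cong)
        also have "\<dots> = ennreal (LINT x|K. v x / m)"
          using int[OF K sK] bound m by (intro nn_integral_eq_integral) auto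
        also have "\<dots> = 1" using mK m by simp
        finally show "emeasure (density K (\<lambda>x. ennreal (v x / m)))
          (space (density K (\<lambda>x. ennreal (v x / m)))) = 1" .
      qed
      have XK: "X \<in> borel_measurable (density K (\<lambda>x. ennreal (v x / m)))" by measurable
      show rd: "real_distribution (D K)"
        unfolding D_def by (rule P.real_distribution_distr[OF XK])
      have "char (D K) s = (CLINT x|density K (\<lambda>x. ennreal (v x / m)). iexp (s * X x))"
        unfolding char_def D_def by (subst integral_distr[OF XK]) auto
      also have "\<dots> = (CLINT x|K. (v x / m) *\<^sub>R iexp (s * X x))"
        using bound m by (intro integral_density) auto
      also have "\<dots> = (CLINT x|K. (v x *\<^sub>R iexp (s * X x)) / m)"
        by (intro Bochner_Integration.integral_cong) (auto simp: scaleR_conv_of_real)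
      finally show "char (D K) s = (CLINT x|K. v x *\<^sub>R iexp (s * X x)) / m" by simp
      have "measure (D K) A = (LINT x|D K. indicator A x)"
        by (simp add: D_def)
      also have "\<dots> = (LINT x|density K (\<lambda>x. ennreal (v x / m)). indicator A (X x))"
        unfolding D_def by (subst integral_distr[OF XK]) auto
      also have "\<dots> = (LINT x|K. (v x / m) *\<^sub>R indicator A (X x))"
        using bound m by (intro integral_density) auto
      also have "\<dots> = (LINT x|K. (v x * indicator A (X x)) / m)"
        by (intro Bochner_Integration.integral_cong) auto
      finally show "measure (D K) A = (LINT x|K. v x * indicator A (X x)) / m" by simp
    qed
    have "D M = D N"
      using D(1,2)[OF M refl] D(1,2)[OF N sets] mN m_def char
      by (intro Levy_uniqueness ext) auto
    then have "measure (D M) A = measure (D N) A" by simp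
    then show ?thesis
      using D(3)[OF M refl] D(3)[OF N sets] mN m_def m by simp
  qed
qed

text \<open>The induction step from \<open>exp(i(sX + Y))\<close> for all \<open>s\<close> to \<open>1\<^sub>A(X) exp(iY)\<close>.  The previous lemma needs
  nonnegative weights, hence the real and the imaginary part of \<open>exp(iY)\<close> are replaced by
  \<open>1 + cos Y\<close> and \<open>1 + sin Y\<close>, and the constant weight 1 is subtracted at the end.  The assumption
  for \<open>c = 1\<close> and \<open>c = -1\<close> supplies the integrals against \<open>cos Y\<close> and \<open>sin Y\<close>, and \<open>c = 0\<close> the one
  against 1.\<close>

lemma indicator_replaces_character:
  fixes X Y :: "'x \<Rightarrow> real"
  assumes M: "finite_measure M" and N: "finite_measure N" and sets: "sets N = sets M"
    and X [measurable]: "X \<in> borel_measurable M" and Y [measurable]: "Y \<in> borel_measurable M"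
    and S [measurable]: "S \<in> sets M" and A [measurable]: "A \<in> sets borel"
    and char: "\<And>s c. c \<in> {-1, 0, 1} \<Longrightarrow>
      (CLINT x|M. indicator S x *\<^sub>R iexp (s * X x + c * Y x))
        = (CLINT x|N. indicator S x *\<^sub>R iexp (s * X x + c * Y x))"
  shows "(CLINT x|M. (indicator S x * indicator A (X x)) *\<^sub>R iexp (Y x))
    = (CLINT x|N. (indicator S x * indicator A (X x)) *\<^sub>R iexp (Y x))"
proof -
  define J where "J K s c = (CLINT x|K. indicator S x *\<^sub>R iexp (s * X x + c * Y x))" for K and s c :: real
  have J: "J M s c = J N s c" if "c \<in> {-1, 0, 1}" for s c using char[OF that] by (simp add: J_def)
  define v0 vc vs :: "'x \<Rightarrow> real" where "v0 x = indicator S x"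
    and "vc x = indicator S x * (1 + cos (Y x))" and "vs x = indicator S x * (1 + sin (Y x))" for x
  have [measurable]: "v0 \<in> borel_measurable M" "vc \<in> borel_measurable M" "vs \<in> borel_measurable M"
    unfolding v0_def vc_def vs_def by measurable
  have bounds: "0 \<le> v0 x" "v0 x \<le> 2" "0 \<le> vc x" "vc x \<le> 2" "0 \<le> vs x" "vs x \<le> 2" for x
    using cos_ge_minus_one[of "Y x"] sin_ge_minus_one[of "Y x"] cos_le_one[of "Y x"] sin_le_one[of "Y x"]
    by (auto simp: v0_def vc_def vs_def indicator_def simp del: cos_ge_minus_one sin_ge_minus_one cos_le_one sin_le_one)
  have int: "integrable K (\<lambda>x. indicator S x *\<^sub>R iexp (s * X x + c * Y x))"
    if "finite_measure K" and [measurable_cong]: "sets K = sets M" for K s c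
    by (rule integrable_bounded[OF that(1), of _ 1]) (auto simp: indicator_def)
  have decomp: "(CLINT x|K. v0 x *\<^sub>R iexp (s * X x)) = J K s 0"
      "(CLINT x|K. vc x *\<^sub>R iexp (s * X x)) = J K s 0 + (J K s 1 + J K s (-1)) / 2"
      "(CLINT x|K. vs x *\<^sub>R iexp (s * X x)) = J K s 0 + (J K s 1 - J K s (-1)) / (2 * \<i>)"
    if K: "finite_measure K" and sK [measurable_cong]: "sets K = sets M" for K s
  proof -
    note int = int[OF K sK]
    show "(CLINT x|K. v0 x *\<^sub>R iexp (s * X x)) = J K s 0" by (simp add: J_def v0_def)
    have cosY: "complex_of_real (cos y) = (iexp y + iexp (- y)) / 2"
      and sinY: "complex_of_real (sin y) = (iexp y - iexp (- y)) / (2 * \<i>)" for y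
      by (simp_all add: cos_exp_eq sin_exp_eq mult.commute flip: cos_of_real sin_of_real)
    have "vc x *\<^sub>R iexp (s * X x) = indicator S x *\<^sub>R iexp (s * X x + 0 * Y x)
        + (indicator S x *\<^sub>R iexp (s * X x + 1 * Y x) + indicator S x *\<^sub>R iexp (s * X x + (-1) * Y x)) / 2" for x
      by (simp add: vc_def scaleR_conv_of_real cosY field_simps exp_add exp_diff exp_minus)
    then show "(CLINT x|K. vc x *\<^sub>R iexp (s * X x)) = J K s 0 + (J K s 1 + J K s (-1)) / 2"
      unfolding J_def using int[of s 0] int[of s 1] int[of s "-1"]
      by (simp only: Bochner_Integration.integral_add Bochner_Integration.integrable_add
          integral_divide_zero integrable_divide_zero)
    have "vs x *\<^sub>R iexp (s * X x) = indicator S x *\<^sub>R iexp (s * X x + 0 * Y x)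
        + (indicator S x *\<^sub>R iexp (s * X x + 1 * Y x) - indicator S x *\<^sub>R iexp (s * X x + (-1) * Y x)) / (2 * \<i>)" for x
      by (simp add: vs_def scaleR_conv_of_real sinY field_simps exp_add exp_diff exp_minus)
    then show "(CLINT x|K. vs x *\<^sub>R iexp (s * X x)) = J K s 0 + (J K s 1 - J K s (-1)) / (2 * \<i>)"
      unfolding J_def using int[of s 0] int[of s 1] int[of s "-1"]
      by (simp only: Bochner_Integration.integral_add Bochner_Integration.integrable_add
          Bochner_Integration.integral_diff Bochner_Integration.integrable_diff
          integral_divide_zero integrable_divide_zero)
  qed
  have eq: "(LINT x|M. v x * indicator A (X x)) = (LINT x|N. v x * indicator A (X x))"
    if "v \<in> {v0, vc, vs}" for v
  proof (rule Levy_uniqueness_weighted[OF M N sets X, where C=2])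
    show "v \<in> borel_measurable M" "0 \<le> v x" "v x \<le> 2" for x using that bounds by auto
    show "(CLINT x|M. v x *\<^sub>R iexp (s * X x)) = (CLINT x|N. v x *\<^sub>R iexp (s * X x))" for s
      using that decomp[OF M refl] decomp[OF N sets] J by auto
  qed fact
  have recomp: "(CLINT x|K. (indicator S x * indicator A (X x)) *\<^sub>R iexp (Y x))
      = complex_of_real ((LINT x|K. vc x * indicator A (X x)) - (LINT x|K. v0 x * indicator A (X x)))
        + \<i> * complex_of_real ((LINT x|K. vs x * indicator A (X x)) - (LINT x|K. v0 x * indicator A (X x)))"
    if K: "finite_measure K" and sK [measurable_cong]: "sets K = sets M" for K
  proof -
    have int: "integrable K (\<lambda>x. v x * indicator A (X x))" if "v \<in> {v0, vc, vs}" for v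
    proof (rule integrable_bounded[OF K, of _ 2])
      show "(\<lambda>x. v x * indicator A (X x)) \<in> borel_measurable K" using that by auto
      show "norm (v x * indicator A (X x)) \<le> 2" for x using that bounds[of x] by (auto simp: indicator_def)
    qed
    define f where "f x = vc x * indicator A (X x) - v0 x * indicator A (X x)" for x
    define g where "g x = vs x * indicator A (X x) - v0 x * indicator A (X x)" for x
    have fg: "integrable K f" "integrable K g"
      unfolding f_def g_def by (intro Bochner_Integration.integrable_diff int; simp)+
    have "(CLINT x|K. (indicator S x * indicator A (X x)) *\<^sub>R iexp (Y x))
        = (CLINT x|K. complex_of_real (f x) + \<i> * complex_of_real (g x))"
      by (intro Bochner_Integration.integral_cong refl)
        (auto simp: f_def g_def v0_def vc_def vs_def indicator_def exp_Euler cos_of_real sin_of_real)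
    also have "\<dots> = complex_of_real (LINT x|K. f x) + \<i> * complex_of_real (LINT x|K. g x)"
      using fg by (subst Bochner_Integration.integral_add) auto
    also have "(LINT x|K. f x) = (LINT x|K. vc x * indicator A (X x)) - (LINT x|K. v0 x * indicator A (X x))"
      unfolding f_def by (intro Bochner_Integration.integral_diff int) simp_all
    also have "(LINT x|K. g x) = (LINT x|K. vs x * indicator A (X x)) - (LINT x|K. v0 x * indicator A (X x))"
      unfolding g_def by (intro Bochner_Integration.integral_diff int) simp_all
    finally show ?thesis .
  qed
  show ?thesis using recomp[OF M refl] recomp[OF N sets] eq by simp
qed

text \<open>Induction over the set \<open>S\<close> of those coordinates whose character has been replaced by an indicator
  function; at the end \<open>S = B\<close> and the integral is the measure of the box.\<close>

lemma joint_Levy_uniqueness: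
  fixes X :: "'i \<Rightarrow> 'x \<Rightarrow> real"
  assumes M: "finite_measure M" and N: "finite_measure N" and sets: "sets N = sets M"
    and B: "finite B" and X: "\<And>i. i \<in> B \<Longrightarrow> X i \<in> borel_measurable M"
    and char: "\<And>t. (CLINT x|M. iexp (\<Sum>i\<in>B. t i * X i x)) = (CLINT x|N. iexp (\<Sum>i\<in>B. t i * X i x))"
    and A: "\<And>i. i \<in> B \<Longrightarrow> A i \<in> sets borel"
  shows "emeasure M {x\<in>space M. \<forall>i\<in>B. X i x \<in> A i} = emeasure N {x\<in>space M. \<forall>i\<in>B. X i x \<in> A i}"
proof -
  define G where "G S = {x\<in>space M. \<forall>i\<in>S. X i x \<in> A i}" for S
  have G: "G S \<in> sets M" if "S \<subseteq> B" for S
  proof -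
    have "G S = space M \<inter> (\<Inter>i\<in>S. X i -` A i \<inter> space M)" by (auto simp: G_def)
    also have "\<dots> \<in> sets M"
    proof (cases "S = {}")
      case False
      then show ?thesis
        using that B X A
        by (intro sets.Int sets.top sets.finite_INT measurable_sets[of _ M borel]) (auto intro: finite_subset)
    qed simp
    finally show ?thesis .
  qed
  have "(CLINT x|M. indicator (G S) x *\<^sub>R iexp (\<Sum>i\<in>B - S. t i * X i x))
      = (CLINT x|N. indicator (G S) x *\<^sub>R iexp (\<Sum>i\<in>B - S. t i * X i x))"
    if "S \<subseteq> B" for S t
    using finite_subset[OF that B] that
  proof (induction S arbitrary: t rule: finite_induct)
    case empty
    have "(CLINT x|K. indicator (G {}) x *\<^sub>R iexp (\<Sum>i\<in>B. t i * X i x)) = (CLINT x|K. iexp (\<Sum>i\<in>B. t i * X i x))"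
      if "sets K = sets M" for K
      using sets_eq_imp_space_eq[OF that]
      by (intro Bochner_Integration.integral_cong) (auto simp: G_def)
    from this[OF refl] this[OF sets] char show ?case by simp
  next
    case (insert j S)
    then have j: "j \<in> B" "j \<in> B - S" and S: "S \<subseteq> B" by auto
    define Y where "Y x = (\<Sum>i\<in>B - insert j S. t i * X i x)" for x
    have Y: "Y \<in> borel_measurable M" unfolding Y_def using X by measurable
    \<comment> \<open>The induction hypothesis for these coefficients is the assumption of the one-coordinate step.\<close>
    have sum: "(\<Sum>i\<in>B - S. (if i = j then s else c * t i) * X i x) = s * X j x + c * Y x" for s c x
    proof -
      have "B - S - {j} = B - insert j S" by blast
      then show ?thesis
        using B j by (subst sum.remove[of _ j]) (auto simp: Y_def sum_distrib_left mult.assoc intro!: sum.cong)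
    qed
    have "(CLINT x|M. (indicator (G S) x * indicator (A j) (X j x)) *\<^sub>R iexp (Y x))
        = (CLINT x|N. (indicator (G S) x * indicator (A j) (X j x)) *\<^sub>R iexp (Y x))"
    proof (rule indicator_replaces_character[OF M N sets X[OF j(1)] Y G[OF S] A[OF j(1)]])
      fix s c :: real
      show "(CLINT x|M. indicator (G S) x *\<^sub>R iexp (s * X j x + c * Y x))
          = (CLINT x|N. indicator (G S) x *\<^sub>R iexp (s * X j x + c * Y x))"
        using insert.IH[OF S, of "\<lambda>i. if i = j then s else c * t i"] unfolding sum .
    qed
    moreover have "indicator (G S) x * indicator (A j) (X j x) = (indicator (G (insert j S)) x :: real)" for x
      by (auto simp: G_def indicator_def)
    ultimately show ?case by (simp add: Y_def)
  qed
  from this[of B] have "complex_of_real (measure M (G B)) = complex_of_real (measure N (G B))"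
    using G[of B] sets sets_eq_imp_space_eq[OF sets]
    by (simp add: scaleR_conv_of_real)
  then have "measure M (G B) = measure N (G B)" by simp
  then show ?thesis
    using M N by (simp add: finite_measure.emeasure_eq_measure G_def)
qed

section \<open>The dual of a finite dimensional space\<close>

lemma space_dual_borel [simp]: "space (dual_borel R) = alg_dual R"
  and openin_dual_borel: "openin (dual_topology R) U \<Longrightarrow> U \<in> sets (dual_borel R)"
proof -
  have "{U. openin (dual_topology R) U} \<subseteq> Pow (alg_dual R)"
    using openin_subset[of "dual_topology R"] by (auto simp: dual_topology_def)
  then show "space (dual_borel R) = alg_dual R" "openin (dual_topology R) U \<Longrightarrow> U \<in> sets (dual_borel R)"
    by (auto simp: dual_borel_def space_measure_of_conv)
qed

lemma topspace_dual_topology: "topspace (dual_topology R) = alg_dual R"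
  by (auto simp: dual_topology_def alg_dual_def PiE_def)

lemma measurable_eval_dual_borel:
  assumes "\<xi> \<in> R"
  shows "(\<lambda>l. l \<xi>) \<in> borel_measurable (dual_borel R)"
proof (rule borel_measurableI)
  fix S :: "real set" assume "open S"
  have "continuous_map (dual_topology R) euclideanreal (\<lambda>l. l \<xi>)"
    unfolding dual_topology_def
    using assms by (intro continuous_map_from_subtopology continuous_map_product_projection)
  then have "openin (dual_topology R) {l \<in> topspace (dual_topology R). l \<xi> \<in> S}"
    using \<open>open S\<close> by (intro openin_continuous_map_preimage) auto
  moreover have "{l \<in> topspace (dual_topology R). l \<xi> \<in> S} = (\<lambda>l. l \<xi>) -` S \<inter> space (dual_borel R)"
    by (auto simp: topspace_dual_topology)
  ultimately show "(\<lambda>l. l \<xi>) -` S \<inter> space (dual_borel R) \<in> sets (dual_borel R)"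
    using openin_dual_borel by metis
qed

definition dual_boxes :: "'e::real_vector set \<Rightarrow> 'e set \<Rightarrow> ('e \<Rightarrow> real) set set" where
  "dual_boxes R B = {{l \<in> alg_dual R. \<forall>b\<in>B. l b \<in> A b} |A. \<forall>b\<in>B. A b \<in> sets borel}"

lemma dual_boxes_in_dual_borel:
  assumes "finite B" "B \<subseteq> R" "U \<in> dual_boxes R B"
  shows "U \<in> sets (dual_borel R)"
proof -
  obtain A where A: "\<And>b. b \<in> B \<Longrightarrow> A b \<in> sets borel" "U = {l \<in> alg_dual R. \<forall>b\<in>B. l b \<in> A b}"
    using assms by (auto simp: dual_boxes_def)
  have "U = {l \<in> space (dual_borel R). \<forall>b\<in>B. l b \<in> A b}" by (simp add: A)
  also have "\<dots> \<in> sets (dual_borel R)"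
  proof (rule sets.sets_Collect_finite_All[OF _ assms(1)])
    fix b assume "b \<in> B"
    then show "{l \<in> space (dual_borel R). l b \<in> A b} \<in> sets (dual_borel R)"
      using measurable_sets[OF measurable_eval_dual_borel A(1), of b R b] assms(2)
      by (auto simp: vimage_def Int_def conj_commute)
  qed
  finally show ?thesis .
qed

text \<open>In coordinates an open set is a union of open boxes, and it is a countable union because the
  sides of the boxes can be taken from a countable basis of the real line.  Hence the Borel sets are
  generated by a class of sets that is stable under intersection and consists of events that a joint
  characteristic function determines.\<close>

lemma sets_dual_borel:
  fixes B :: "'e::real_vector set"
  assumes B: "finite B" "independent B"
  shows "sets (dual_borel (span B)) = sigma_sets (alg_dual (span B)) (dual_boxes (span B) B)"
proof
  let ?R = "span B" and ?E = "dual_boxes (span B) B"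
  have E: "?E \<subseteq> Pow (alg_dual ?R)" by (auto simp: dual_boxes_def)
  interpret S: sigma_algebra "alg_dual ?R" "sigma_sets (alg_dual ?R) ?E"
    using E by (rule sigma_algebra_sigma_sets)
  show "sigma_sets (alg_dual ?R) ?E \<subseteq> sets (dual_borel ?R)"
    using dual_boxes_in_dual_borel[OF B(1) span_superset]
      sets.sigma_sets_subset[of ?E "dual_borel ?R"] by (auto simp: subset_iff)
  have "U \<in> sigma_sets (alg_dual ?R) ?E" if U: "openin (dual_topology ?R) U" for U
  proof -
    let ?h = "\<lambda>l. restrict l B"
    have hom: "homeomorphic_map (dual_topology ?R) (product_topology (\<lambda>_. euclideanreal) B) ?h"
      by (rule homeomorphic_map_dual_topology[OF B])
    have UR: "U \<subseteq> alg_dual ?R" using openin_subset[OF U] by (simp add: topspace_dual_topology)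
    have V: "openin (product_topology (\<lambda>_. euclideanreal) B) (?h ` U)"
      using homeomorphic_map_openness_eq[OF hom] U by blast
    have inj: "inj_on ?h (alg_dual ?R)"
      using homeomorphic_imp_injective_map[OF hom] by (simp add: topspace_dual_topology)
    obtain \<B> :: "real set set" where \<B>: "countable \<B>" "topological_basis \<B>"
      using ex_countable_basis by blast
    define K where "K = {k \<in> (\<Pi>\<^sub>E b\<in>B. \<B>). Pi\<^sub>E B k \<subseteq> ?h ` U}"
    define W where "W k = {l \<in> alg_dual ?R. \<forall>b\<in>B. l b \<in> k b}" for k :: "'e \<Rightarrow> real set"
    have K: "countable K"
      by (rule countable_subset[OF _ countable_PiE[OF B(1) \<B>(1)]]) (auto simp: K_def)
    have "U = (\<Union>k\<in>K. W k)"
    proof (intro equalityI subsetI)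
      fix l assume l: "l \<in> U"
      then have "?h l \<in> ?h ` U" by blast
      then obtain O' where O': "finite {i \<in> B. O' i \<noteq> topspace euclideanreal}"
        "\<forall>i\<in>B. openin euclideanreal (O' i)" "?h l \<in> Pi\<^sub>E B O'" "Pi\<^sub>E B O' \<subseteq> ?h ` U"
        using V unfolding openin_product_topology_alt by blast
      have "\<exists>k\<in>\<B>. l b \<in> k \<and> k \<subseteq> O' b" if b: "b \<in> B" for b
      proof -
        have "open (O' b)" "l b \<in> O' b" using O'(2,3) b by (auto simp: PiE_iff)
        then show ?thesis using topological_basisE[OF \<B>(2)] by metis
      qed
      then obtain k where k: "\<And>b. b \<in> B \<Longrightarrow> k b \<in> \<B> \<and> l b \<in> k b \<and> k b \<subseteq> O' b" by metis
      have "Pi\<^sub>E B (restrict k B) \<subseteq> Pi\<^sub>E B O'" using k by (force simp: PiE_iff)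
      then have "restrict k B \<in> K" using k O'(4) by (auto simp: K_def)
      moreover have "l \<in> W (restrict k B)" using k l UR by (auto simp: W_def)
      ultimately show "l \<in> (\<Union>k\<in>K. W k)" by blast
    next
      fix l assume "l \<in> (\<Union>k\<in>K. W k)"
      then obtain k where k: "k \<in> K" "l \<in> alg_dual ?R" "\<forall>b\<in>B. l b \<in> k b" by (auto simp: W_def)
      then have "?h l \<in> Pi\<^sub>E B k" by auto
      then have "?h l \<in> ?h ` U" using k(1) unfolding K_def by blast
      then show "l \<in> U" using inj_on_image_mem_iff[OF inj k(2) UR] by blast
    qed
    moreover have "W k \<in> sigma_sets (alg_dual ?R) ?E" if "k \<in> K" for k
    proof -
      have "k b \<in> sets borel" if "b \<in> B" for b
        using \<open>k \<in> K\<close> that topological_basis_open[OF \<B>(2)] by (auto simp: K_def PiE_iff)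
      then show ?thesis by (intro sigma_sets.Basic) (auto simp: W_def dual_boxes_def)
    qed
    ultimately show ?thesis using K by (auto intro!: S.countable_UN')
  qed
  then have "{U. openin (dual_topology ?R) U} \<subseteq> sigma_sets (alg_dual ?R) ?E" by blast
  moreover have "{U. openin (dual_topology ?R) U} \<subseteq> Pow (alg_dual ?R)"
    using openin_subset[of "dual_topology ?R"] by (auto simp: topspace_dual_topology)
  ultimately show "sets (dual_borel ?R) \<subseteq> sigma_sets (alg_dual ?R) ?E"
    unfolding dual_borel_def by (simp add: S.sigma_sets_subset)
qed

lemma findim_basis:
  assumes "R \<in> findim_subspaces"
  obtains B where "finite B" "independent B" "span B = R"
proof -
  obtain C where C: "finite C" "span C = R" using assms by (auto simp: findim_subspaces_def)
  obtain B where "B \<subseteq> C" "independent B" "C \<subseteq> span B" by (rule maximal_independent_subset)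
  then have "span B = R" using C by (metis span_mono span_span subset_antisym)
  then show thesis using that \<open>B \<subseteq> C\<close> C(1) \<open>independent B\<close> finite_subset by blast
qed

text \<open>Used for functionals on \<open>E\<close> and for functionals on a larger finite dimensional space.\<close>

lemma measurable_restrict_dual_borel:
  fixes R :: "'e::real_vector set"
  assumes R: "R \<in> findim_subspaces" and dual: "\<And>l. l \<in> space M \<Longrightarrow> restrict l R \<in> alg_dual R"
    and eval: "\<And>\<xi>. \<xi> \<in> R \<Longrightarrow> (\<lambda>l. l \<xi>) \<in> borel_measurable M"
  shows "(\<lambda>l. restrict l R) \<in> measurable M (dual_borel R)"
proof -
  obtain B where B: "finite B" "independent B" "span B = R" using findim_basis[OF R] .
  have BR: "B \<subseteq> R" using B(3) span_superset by blast
  show ?thesis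
  proof (rule measurable_sigma_sets[OF sets_dual_borel[OF B(1,2), unfolded B(3)]])
    show "dual_boxes R B \<subseteq> Pow (alg_dual R)" by (auto simp: dual_boxes_def)
    show "(\<lambda>l. restrict l R) \<in> space M \<rightarrow> alg_dual R" using dual by auto
    fix U assume "U \<in> dual_boxes R B"
    then obtain A where A: "\<And>b. b \<in> B \<Longrightarrow> A b \<in> sets borel" "U = {l \<in> alg_dual R. \<forall>b\<in>B. l b \<in> A b}"
      by (auto simp: dual_boxes_def)
    have "(\<lambda>l. restrict l R) -` U \<inter> space M = {l \<in> space M. \<forall>b\<in>B. l b \<in> A b}"
      using dual BR by (auto simp: A(2) subset_iff)
    also have "\<dots> \<in> sets M"
    proof (rule sets.sets_Collect_finite_All[OF _ B(1)])
      fix b assume "b \<in> B"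
      then show "{l \<in> space M. l b \<in> A b} \<in> sets M"
        using measurable_sets[OF eval A(1), of b b] BR by (auto simp: vimage_def Int_def conj_commute)
    qed
    finally show "(\<lambda>l. restrict l R) -` U \<inter> space M \<in> sets M" .
  qed
qed

lemma fd_char_function_unique:
  fixes R :: "'e::real_vector set"
  assumes R: "R \<in> findim_subspaces"
    and M: "sets M = sets (dual_borel R)" "has_char_function_on M chi R"
    and N: "sets N = sets (dual_borel R)" "has_char_function_on N chi R"
  shows "M = N"
proof -
  obtain B where B: "finite B" "independent B" "span B = R" using findim_basis[OF R] .
  have BR: "B \<subseteq> R" using B(3) span_superset by blast
  have sR: "subspace R" using R by (auto simp: findim_subspaces_def)
  have sp: "space M = alg_dual R" "space N = alg_dual R"
    using sets_eq_imp_space_eq[OF M(1)] sets_eq_imp_space_eq[OF N(1)] by simp_all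
  have fin: "finite_measure M" "finite_measure N"
    using M N by (auto simp: has_char_function_on_def)
  note gen = sets_dual_borel[OF B(1,2), unfolded B(3)]
  show ?thesis
  proof (rule measure_eqI_generator_eq[where E="dual_boxes R B" and \<Omega>="alg_dual R" and A="\<lambda>_. alg_dual R"])
    show "dual_boxes R B \<subseteq> Pow (alg_dual R)" by (auto simp: dual_boxes_def)
    show "sets M = sigma_sets (alg_dual R) (dual_boxes R B)" "sets N = sigma_sets (alg_dual R) (dual_boxes R B)"
      using M(1) N(1) gen by simp_all
    show "Int_stable (dual_boxes R B)"
    proof (rule Int_stableI)
      fix U V assume "U \<in> dual_boxes R B" "V \<in> dual_boxes R B"
      then obtain A A' where A: "\<forall>b\<in>B. A b \<in> sets borel" "U = {l \<in> alg_dual R. \<forall>b\<in>B. l b \<in> A b}"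
          "\<forall>b\<in>B. A' b \<in> sets borel" "V = {l \<in> alg_dual R. \<forall>b\<in>B. l b \<in> A' b}"
        by (auto simp: dual_boxes_def)
      then show "U \<inter> V \<in> dual_boxes R B"
        unfolding dual_boxes_def by (intro CollectI exI[of _ "\<lambda>b. A b \<inter> A' b"]) auto
    qed
    have "alg_dual R \<in> dual_boxes R B"
      unfolding dual_boxes_def by (intro CollectI exI[of _ "\<lambda>_. UNIV"]) auto
    then show "range (\<lambda>_::nat. alg_dual R) \<subseteq> dual_boxes R B" by auto
    show "emeasure M (alg_dual R) \<noteq> \<infinity>"
      using fin(1) by (simp add: finite_measure.emeasure_finite)
    fix U assume "U \<in> dual_boxes R B"
    then obtain A where A: "\<And>b. b \<in> B \<Longrightarrow> A b \<in> sets borel" "U = {l \<in> alg_dual R. \<forall>b\<in>B. l b \<in> A b}"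
      by (auto simp: dual_boxes_def)
    have "emeasure M {l \<in> space M. \<forall>b\<in>B. l b \<in> A b} = emeasure N {l \<in> space M. \<forall>b\<in>B. l b \<in> A b}"
    proof (rule joint_Levy_uniqueness[where X="\<lambda>b l. l b", OF fin _ B(1) _ _ A(1)])
      show "sets N = sets M" using M N by simp
      show "(\<lambda>l. l b) \<in> borel_measurable M" if "b \<in> B" for b
        using measurable_eval_dual_borel[of b R] that BR measurable_cong_sets[OF M(1) refl] by auto
      fix t
      let ?\<xi> = "\<Sum>b\<in>B. t b *\<^sub>R b"
      have \<xi>: "?\<xi> \<in> R" using BR by (intro subspace_sum[OF sR] subspace_scale[OF sR]) auto
      have eq: "(CLINT l|K. iexp (\<Sum>b\<in>B. t b * l b)) = (CLINT l|K. iexp (l ?\<xi>))" if "space K = alg_dual R" for K :: "('e \<Rightarrow> real) measure"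
        using that by (intro Bochner_Integration.integral_cong) (auto simp: alg_dual_sum[OF _ sR B(1) BR])
      have "chi ?\<xi> = (CLINT l|M. iexp (l ?\<xi>))" "chi ?\<xi> = (CLINT l|N. iexp (l ?\<xi>))"
        using M(2) N(2) \<xi> unfolding has_char_function_on_def by blast+
      then show "(CLINT l|M. iexp (\<Sum>b\<in>B. t b * l b)) = (CLINT l|N. iexp (\<Sum>b\<in>B. t b * l b))"
        unfolding eq[OF sp(1)] eq[OF sp(2)] by (rule trans[OF sym])
    qed
    then show "emeasure M U = emeasure N U" by (simp add: A(2) sp)
  qed simp
qed

section \<open>Conditional expectations\<close>

text \<open>The Doob-Dynkin lemma.  Level sets of simple functions are preimages of measurable sets, so
  simple functions factor through \<open>u\<close>, and the pointwise limit of the factors serves for \<open>f\<close>.  The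
  limit exists on the image of \<open>X\<close>, and the totalised \<open>lim\<close> is measurable on all of \<open>N\<close>.\<close>

lemma factor_through_vimage_algebra:
  fixes f :: "'x \<Rightarrow> real"
  assumes f: "f \<in> borel_measurable (vimage_algebra X u N)" and u: "u \<in> X \<rightarrow> space N"
  shows "\<exists>g\<in>borel_measurable N. \<forall>x\<in>X. f x = g (u x)"
proof -
  let ?V = "vimage_algebra X u N"
  have simple: "\<exists>g\<in>borel_measurable N. \<forall>x\<in>X. s x = g (u x)" if s: "simple_function ?V s" for s :: "'x \<Rightarrow> real"
  proof -
    have V: "s -` {y} \<inter> X \<in> sets ?V" for y using simple_functionD(2)[OF s, of "{y}"] by simp
    have "\<exists>B\<in>sets N. s -` {y} \<inter> X = u -` B \<inter> X" for y
      using V[of y] unfolding sets_vimage_algebra2[OF u] by auto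
    then obtain B where B: "\<And>y. B y \<in> sets N" "\<And>y. s -` {y} \<inter> X = u -` B y \<inter> X" by metis
    define g where "g z = (\<Sum>y\<in>s ` X. indicator (B y) z *\<^sub>R y)" for z
    have "g \<in> borel_measurable N" unfolding g_def using B(1) by measurable
    moreover have "s x = g (u x)" if x: "x \<in> X" for x
    proof -
      have ind: "indicator (s -` {y} \<inter> X) x = (indicator (B y) (u x) :: real)" for y
        unfolding B(2) using x by (simp add: indicator_def)
      have "s x = (\<Sum>y\<in>s ` X. indicator (s -` {y} \<inter> X) x *\<^sub>R y)"
        using simple_function_indicator_representation_banach[OF s] x by (simp only: space_vimage_algebra)
      then show ?thesis by (simp only: g_def ind)
    qed
    ultimately show ?thesis by blast
  qed
  obtain F where F: "\<And>i. simple_function ?V (F i)" "\<And>x. x \<in> X \<Longrightarrow> (\<lambda>i. F i x) \<longlonglongrightarrow> f x"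
    using borel_measurable_implies_sequence_metric[OF f, of 0] unfolding space_vimage_algebra by blast
  obtain G where G: "\<And>i. G i \<in> borel_measurable N" "\<And>i x. x \<in> X \<Longrightarrow> F i x = G i (u x)"
    using simple[OF F(1)] by metis
  define g where "g z = lim (\<lambda>i. G i z)" for z
  have "g \<in> borel_measurable N" unfolding g_def by (rule borel_measurable_lim_metric[OF G(1)])
  moreover have "f x = g (u x)" if "x \<in> X" for x
    using F(2)[OF that] G(2)[OF that] by (simp add: g_def limI)
  ultimately show ?thesis by blast
qed

locale Lp_finite = Lp p M + finite_measure M for p :: real and M :: "'x measure"
begin

lemma Lp_fun_integrable1:
  assumes f: "f \<in> Lp_fun p M"
  shows "integrable M f"
proof (rule Bochner_Integration.integrable_bound)
  show "integrable M (\<lambda>x. 1 + \<bar>f x\<bar> powr p)" using Lp_fun_integrable[OF f] by simp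
  show "f \<in> borel_measurable M" by (rule Lp_fun_measurable[OF f])
  have "\<bar>f x\<bar> \<le> 1 + \<bar>f x\<bar> powr p" for x
  proof (cases "\<bar>f x\<bar> \<le> 1")
    case True
    then show ?thesis by (rule order_trans) simp
  next
    case False
    then have "\<bar>f x\<bar> powr 1 \<le> \<bar>f x\<bar> powr p" using p by (intro powr_mono) auto
    then show ?thesis using False by simp
  qed
  then show "AE x in M. norm (f x) \<le> norm (1 + \<bar>f x\<bar> powr p)"
    by (auto intro!: AE_I2)
qed

lemma Lp_fun_bounded: "\<lbrakk>f \<in> borel_measurable M; \<And>x. \<bar>f x\<bar> \<le> C\<rbrakk> \<Longrightarrow> f \<in> Lp_fun p M"
proof -
  assume [measurable]: "f \<in> borel_measurable M" and C: "\<And>x. \<bar>f x\<bar> \<le> C"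
  have "integrable M (\<lambda>x. \<bar>f x\<bar> powr p)"
    using p C by (intro integrable_const_bound[where B="C powr p"]) (auto intro!: powr_mono2 AE_I2)
  then show ?thesis by (simp add: Lp_fun_def)
qed

end

locale Lp_subalgebra = Lp p M + finite_measure_subalgebra M F
  for p :: real and M :: "'x measure" and F
begin

sublocale Lp_finite p M ..

abbreviation "E \<equiv> real_cond_exp M F"

text \<open>Jensen's inequality for \<open>\<bar>x\<bar>\<^sup>p\<close> makes the conditional expectation a contraction.\<close>

lemma cond_exp_contraction:
  assumes f: "f \<in> Lp_fun p M"
  shows "E f \<in> Lp_fun p M" "Lp_norm p M (E f) \<le> Lp_norm p M f"
proof -
  let ?q = "\<lambda>x::real. \<bar>x\<bar> powr p"
  note jensen = Lp_fun_integrable1[OF f] _ _ Lp_fun_integrable[OF f] convex_on_abs_powr[OF p]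
  have q: "?q \<in> borel_measurable borel" by measurable
  have int: "integrable M (\<lambda>x. ?q (E f x))"
    by (rule integrable_convex_cond_exp[OF jensen q]) auto
  then show Ef: "E f \<in> Lp_fun p M" by (simp add: Lp_fun_def)
  have "AE x in M. ?q (E f x) \<le> E (\<lambda>x. ?q (f x)) x"
    by (rule real_cond_exp_jensens_inequality(2)[OF jensen q]) auto
  then have "(\<integral>x. ?q (E f x) \<partial>M) \<le> (\<integral>x. E (\<lambda>x. ?q (f x)) x \<partial>M)"
    using int by (intro integral_mono_AE real_cond_exp_int Lp_fun_integrable[OF f])
  also have "\<dots> = (\<integral>x. ?q (f x) \<partial>M)" by (rule real_cond_exp_int(2)[OF Lp_fun_integrable[OF f]])
  finally show "Lp_norm p M (E f) \<le> Lp_norm p M f"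
    unfolding Lp_norm_def using p by (intro powr_mono2) auto
qed

lemma Lp_cond_exp_class:
  assumes f: "f \<in> Lp_fun p M"
  shows "Lp_cond_exp p M F (Lp_class p M f) = Lp_class p M (E f)"
proof -
  have "congruent (Lp_rel p M) (\<lambda>f. Lp_class p M (E f))"
  proof (rule congruentI)
    fix g h assume "(g, h) \<in> Lp_rel p M"
    then have gh: "g \<in> Lp_fun p M" "h \<in> Lp_fun p M" "AE x in M. g x = h x" by (auto simp: Lp_rel_def)
    then have "AE x in M. E g x = E h x" by (intro real_cond_exp_cong Lp_fun_measurable)
    then show "Lp_class p M (E g) = Lp_class p M (E h)"
      using gh by (simp only: Lp_class_eq_iff cond_exp_contraction)
  qed
  from UN_equiv_class[OF equiv_Lp this f] show ?thesis by (simp add: Lp_cond_exp_def)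
qed

text \<open>As \<open>E\<close> fixes \<open>g\<close> and is a contraction, it moves \<open>f\<close> by at most twice the distance from \<open>f\<close>
  to \<open>g\<close>.\<close>

lemma cond_exp_close:
  assumes f: "f \<in> Lp_fun p M" and g: "g \<in> Lp_fun p M" "g \<in> borel_measurable F"
  shows "Lp_norm p M (\<lambda>x. E f x - f x) \<le> 2 * Lp_norm p M (\<lambda>x. f x - g x)"
proof -
  have fg: "(\<lambda>x. f x - g x) \<in> Lp_fun p M" using f g(1) by (rule Lp_fun_diff)
  have "AE x in M. E (\<lambda>x. f x - g x) x = E f x - E g x"
    using f g by (intro real_cond_exp_diff Lp_fun_integrable1)
  moreover have "AE x in M. E g x = g x" using g by (intro real_cond_exp_F_meas Lp_fun_integrable1)
  ultimately have "AE x in M. \<bar>E f x - g x\<bar> = \<bar>E (\<lambda>x. f x - g x) x\<bar>" by eventually_elim simp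
  then have "Lp_norm p M (\<lambda>x. E f x - g x) = Lp_norm p M (E (\<lambda>x. f x - g x))"
    by (rule Lp_norm_cong) (use f g cond_exp_contraction in \<open>auto intro!: Lp_fun_measurable Lp_fun_diff\<close>)
  also have "\<dots> \<le> Lp_norm p M (\<lambda>x. f x - g x)" by (rule cond_exp_contraction(2)[OF fg])
  finally have "Lp_norm p M (\<lambda>x. E f x - g x) \<le> Lp_norm p M (\<lambda>x. f x - g x)" .
  moreover have "Lp_norm p M (\<lambda>x. E f x - f x)
      \<le> Lp_norm p M (\<lambda>x. E f x - g x) + Lp_norm p M (\<lambda>x. g x - f x)"
    using f g cond_exp_contraction by (intro Lp_norm_diff_triangle)
  ultimately show ?thesis using Lp_norm_minus[of g f] by simp
qed

end

section \<open>The measure on the topological dual and its finite dimensional marginals\<close>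

lemma findim_span: "finite B \<Longrightarrow> span B \<in> findim_subspaces"
  by (auto simp: findim_subspaces_def)

lemma findim_directed:
  assumes "R \<in> findim_subspaces" "S \<in> findim_subspaces"
  shows "\<exists>F\<in>findim_subspaces. R \<subseteq> F \<and> S \<subseteq> F"
proof -
  obtain B C where "finite B" "span B = R" "finite C" "span C = S"
    using assms by (auto simp: findim_subspaces_def)
  then show ?thesis
    by (intro bexI[of _ "span (B \<union> C)"]) (auto simp: findim_span intro: span_mono[THEN subsetD])
qed



lemma restrict_alg_dual: "\<lbrakk>subspace R; R \<subseteq> F; l \<in> alg_dual F\<rbrakk> \<Longrightarrow> restrict l R \<in> alg_dual R"
  by (auto simp: alg_dual_def subspace_add subspace_scale subset_iff)

lemma top_dual_subset: "top_dual \<subseteq> alg_dual UNIV"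
  by (auto simp: top_dual_def alg_dual_UNIV)

lemma sets_dual_algebra:
  "sets dual_algebra = sigma_sets (alg_dual UNIV) {(\<lambda>l. l \<xi>) -` B \<inter> alg_dual UNIV |\<xi> B. B \<in> sets borel}"
  and space_dual_algebra: "space dual_algebra = alg_dual UNIV"
  unfolding dual_algebra_def by (rule sets_measure_of space_measure_of, blast)+

lemma measurable_eval_dual_algebra: "(\<lambda>l. l \<xi>) \<in> borel_measurable dual_algebra"
proof (rule measurableI)
  fix A :: "real set" assume "A \<in> sets borel"
  then show "(\<lambda>l. l \<xi>) -` A \<inter> space dual_algebra \<in> sets dual_algebra"
    unfolding sets_dual_algebra space_dual_algebra by (intro sigma_sets.Basic) blast
qed simp

locale dual_measure =
  fixes chi :: "'e::topological_real_vector \<Rightarrow> complex" and \<mu> :: "('e \<Rightarrow> real) measure" and p :: real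
  assumes corresponding: "corresponding_measure chi \<mu>" and p: "1 \<le> p"
begin

lemma sets_\<mu>: "sets \<mu> = sets (restrict_space dual_algebra top_dual)"
  using corresponding by (auto simp: corresponding_measure_def top_dual_algebra_def)

lemma space_\<mu>: "space \<mu> = top_dual"
  using sets_eq_imp_space_eq[OF sets_\<mu>] top_dual_subset
  by (auto simp: space_restrict_space space_dual_algebra)

lemma measurable_eval: "(\<lambda>l. l \<xi>) \<in> borel_measurable \<mu>"
  using measurable_restrict_space1[OF measurable_eval_dual_algebra] measurable_cong_sets[OF sets_\<mu> refl]
  by blast

text \<open>Writing \<open>\<nu>\<close> for the measure on the algebraic dual whose trace is \<open>\<mu>\<close>, the relation between the two
  says that \<open>\<nu>\<close> is the image of \<open>\<mu>\<close> under the inclusion \<open>E' \<subseteq> E\<^sup>a\<close>, so integrals are preserved.\<close>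

lemma char_\<mu>: "has_char_function_on \<mu> chi UNIV"
proof -
  obtain \<nu> where \<nu>: "sets \<nu> = sets dual_algebra" "has_char_function_on \<nu> chi UNIV"
    "\<And>B. B \<in> sets dual_algebra \<Longrightarrow> emeasure \<mu> (B \<inter> top_dual) = emeasure \<nu> B"
    using corresponding by (auto simp: corresponding_measure_def)
  interpret \<nu>: finite_measure \<nu> using \<nu>(2) by (simp add: has_char_function_on_def)
  have incl: "(\<lambda>l. l) \<in> measurable \<mu> dual_algebra"
  proof (rule measurableI)
    fix A assume "A \<in> sets (dual_algebra :: ('e \<Rightarrow> real) measure)"
    then show "(\<lambda>l. l) -` A \<inter> space \<mu> \<in> sets \<mu>"
      unfolding sets_\<mu> space_\<mu> sets_restrict_space by auto
  qed (use top_dual_subset in \<open>auto simp: space_\<mu> space_dual_algebra\<close>)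
  have dist: "distr \<mu> dual_algebra (\<lambda>l. l) = \<nu>"
    by (rule measure_eqI) (simp_all add: \<nu>(1,3) emeasure_distr[OF incl] space_\<mu>)
  have "emeasure \<mu> (space \<mu>) = emeasure \<nu> (space \<nu>)"
    using \<nu>(3)[OF sets.top] sets_eq_imp_space_eq[OF \<nu>(1)]
    by (simp add: space_\<mu> space_dual_algebra Int_absorb1[OF top_dual_subset])
  then have "finite_measure \<mu>" by (intro finite_measureI) simp
  moreover have "chi \<xi> = (CLINT l|\<mu>. iexp (l \<xi>))" for \<xi>
  proof -
    have [measurable]: "(\<lambda>l. l \<xi>) \<in> borel_measurable dual_algebra" by (rule measurable_eval_dual_algebra)
    have "chi \<xi> = (CLINT l|\<nu>. iexp (l \<xi>))" using \<nu>(2) by (simp add: has_char_function_on_def)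
    also have "\<dots> = (CLINT l|\<mu>. iexp (l \<xi>))"
      unfolding dist[symmetric] by (rule integral_distr[OF incl]) measurable
    finally show ?thesis .
  qed
  ultimately show ?thesis by (simp add: has_char_function_on_def)
qed

sublocale finite_measure \<mu>
  using char_\<mu> by (simp add: has_char_function_on_def)

sublocale Lp_finite p \<mu>
  by unfold_locales (rule p)

lemma subspace_findim: "R \<in> findim_subspaces \<Longrightarrow> subspace R"
  by (simp add: findim_subspaces_def)

lemma measurable_restrict_\<mu>:
  assumes R: "R \<in> findim_subspaces"
  shows "(\<lambda>l. restrict l R) \<in> measurable \<mu> (dual_borel R)"
  using R
proof (rule measurable_restrict_dual_borel)
  show "restrict l R \<in> alg_dual R" if "l \<in> space \<mu>" for l
    using that top_dual_subset subspace_findim[OF R]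
    by (intro restrict_alg_dual[of R UNIV]) (auto simp: space_\<mu>)
qed (rule measurable_eval)

text \<open>The marginal of \<open>\<mu>\<close> has the right characteristic function since \<open>l \<xi>\<close> depends only on the restriction
  of \<open>l\<close> to \<open>R\<close> when \<open>\<xi> \<in> R\<close>; so it is the measure that the description operator selects.\<close>

lemma fd_measure_eq:
  assumes R: "R \<in> findim_subspaces"
  shows "fd_measure chi R = distr \<mu> (dual_borel R) (\<lambda>l. restrict l R)"
  unfolding fd_measure_def
proof (rule the_equality)
  let ?D = "distr \<mu> (dual_borel R) (\<lambda>l. restrict l R)"
  note u = measurable_restrict_\<mu>[OF R]
  have "chi \<xi> = (CLINT l|?D. iexp (l \<xi>))" if "\<xi> \<in> R" for \<xi>
  proof -
    have [measurable]: "(\<lambda>l. l \<xi>) \<in> borel_measurable (dual_borel R)"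
      using that by (rule measurable_eval_dual_borel)
    have "(CLINT l|?D. iexp (l \<xi>)) = (CLINT l|\<mu>. iexp (restrict l R \<xi>))"
      by (rule integral_distr[OF u]) measurable
    then show ?thesis using char_\<mu> that by (simp add: has_char_function_on_def)
  qed
  then show D: "sets ?D = sets (dual_borel R) \<and> has_char_function_on ?D chi R"
    using finite_measure_distr[OF u] by (simp add: has_char_function_on_def)
  show "M = ?D" if "sets M = sets (dual_borel R) \<and> has_char_function_on M chi R" for M
    using fd_char_function_unique[OF R] that D by blast
qed

lemma
  assumes R: "R \<in> findim_subspaces"
  shows sets_fd: "sets (fd_measure chi R) = sets (dual_borel R)"
    and space_fd: "space (fd_measure chi R) = alg_dual R"
    and measurable_\<phi>: "(\<lambda>l. restrict l R) \<in> measurable \<mu> (fd_measure chi R)"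
    and distr_\<phi>: "distr \<mu> (fd_measure chi R) (\<lambda>l. restrict l R) = fd_measure chi R"
    and finite_measure_fd: "finite_measure (fd_measure chi R)"
proof -
  note eq = fd_measure_eq[OF R] and u = measurable_restrict_\<mu>[OF R]
  show s: "sets (fd_measure chi R) = sets (dual_borel R)" by (simp add: eq)
  show "space (fd_measure chi R) = alg_dual R" by (simp add: eq)
  show "(\<lambda>l. restrict l R) \<in> measurable \<mu> (fd_measure chi R)"
    using u measurable_cong_sets[OF refl s] by blast
  show "distr \<mu> (fd_measure chi R) (\<lambda>l. restrict l R) = fd_measure chi R"
    using distr_cong[OF refl s] eq by metis
  show "finite_measure (fd_measure chi R)" unfolding eq by (rule finite_measure_distr[OF u])
qed

lemma
  assumes R: "R \<in> findim_subspaces" and F: "F \<in> findim_subspaces" and RF: "R \<subseteq> F"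
  shows measurable_\<pi>: "(\<lambda>l. restrict l R) \<in> measurable (fd_measure chi F) (fd_measure chi R)"
    and distr_\<pi>: "distr (fd_measure chi F) (fd_measure chi R) (\<lambda>l. restrict l R) = fd_measure chi R"
proof -
  have "(\<lambda>l. restrict l R) \<in> measurable (dual_borel F) (dual_borel R)"
    using R
  proof (rule measurable_restrict_dual_borel)
    show "restrict l R \<in> alg_dual R" if "l \<in> space (dual_borel F)" for l
      using that by (intro restrict_alg_dual[OF subspace_findim[OF R] RF]) simp
    show "(\<lambda>l. l \<xi>) \<in> borel_measurable (dual_borel F)" if "\<xi> \<in> R" for \<xi>
      using that RF by (intro measurable_eval_dual_borel) auto
  qed
  then show m: "(\<lambda>l. restrict l R) \<in> measurable (fd_measure chi F) (fd_measure chi R)"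
    using measurable_cong_sets[OF sets_fd[OF F] sets_fd[OF R]] by blast
  have "distr (fd_measure chi F) (fd_measure chi R) (\<lambda>l. restrict l R)
      = distr \<mu> (fd_measure chi R) ((\<lambda>l. restrict l R) \<circ> (\<lambda>l. restrict l F))"
    using distr_distr[OF m measurable_\<phi>[OF F]] by (simp only: distr_\<phi>[OF F])
  also have "\<dots> = fd_measure chi R"
    using distr_\<phi>[OF R] by (simp add: comp_def Int_absorb1[OF RF])
  finally show "distr (fd_measure chi F) (fd_measure chi R) (\<lambda>l. restrict l R) = fd_measure chi R" .
qed

lemma Lp_fd_locale: "R \<in> findim_subspaces \<Longrightarrow> Lp_finite p (fd_measure chi R)"
  by (simp add: Lp_finite_def Lp_def p finite_measure_fd)

abbreviation Lp_fun_fd :: "'e set \<Rightarrow> (('e \<Rightarrow> real) \<Rightarrow> real) set" where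
  "Lp_fun_fd R \<equiv> Lp_fun p (fd_measure chi R)"

abbreviation Lp_class_fd :: "'e set \<Rightarrow> (('e \<Rightarrow> real) \<Rightarrow> real) \<Rightarrow> (('e \<Rightarrow> real) \<Rightarrow> real) set" where
  "Lp_class_fd R \<equiv> Lp_class p (fd_measure chi R)"

lemma carrier_fd: "R \<in> findim_subspaces \<Longrightarrow> vcarrier (Lp_fd p chi R) = Lp_class_fd R ` Lp_fun_fd R"
  unfolding Lp_fd_def using Lp.carrier_Lp[of p] p by (simp add: Lp_def)

lemma phi_pull_class:
  assumes "R \<in> findim_subspaces" "h \<in> Lp_fun_fd R"
  shows "(\<lambda>l. h (restrict l R)) \<in> Lp_fun p \<mu>"
    and "phi_pull p \<mu> R (Lp_class_fd R h) = Lp_class p \<mu> (\<lambda>l. h (restrict l R))"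
  using Lp_pull_class[OF p measurable_\<phi>[OF assms(1)] distr_\<phi>[OF assms(1)] assms(2)]
  by (simp_all add: phi_pull_def comp_def)

lemma pi_pull_class:
  assumes "R \<in> findim_subspaces" "F \<in> findim_subspaces" "R \<subseteq> F" "h \<in> Lp_fun_fd R"
  shows "(\<lambda>l. h (restrict l R)) \<in> Lp_fun_fd F"
    and "pi_pull p chi R F (Lp_class_fd R h) = Lp_class_fd F (\<lambda>l. h (restrict l R))"
  using Lp_pull_class[OF p measurable_\<pi>[OF assms(1-3)] distr_\<pi>[OF assms(1-3)] assms(4)]
  by (simp_all add: pi_pull_def comp_def)

lemma codiagram_Lp: "codiagram findim_subspaces (Lp_fd p chi) (pi_pull p chi)"
  unfolding codiagram_def
proof (intro conjI ballI impI)
  fix R :: "'e set" assume R: "R \<in> findim_subspaces"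
  interpret R: Lp_finite p "fd_measure chi R" by (rule Lp_fd_locale[OF R])
  show "banach_space (Lp_fd p chi R)" unfolding Lp_fd_def by (rule R.banach_Lp)
  show "pi_pull p chi R R x = x" if x: "x \<in> vcarrier (Lp_fd p chi R)" for x
  proof -
    obtain h where h: "h \<in> Lp_fun_fd R" "x = Lp_class_fd R h" using x carrier_fd[OF R] by blast
    have "restrict l R = l" if "l \<in> space (fd_measure chi R)" for l
      using that by (auto simp: space_fd[OF R] alg_dual_def extensional_restrict)
    then have "Lp_class_fd R (\<lambda>l. h (restrict l R)) = Lp_class_fd R h"
      using pi_pull_class(1)[OF R R order_refl h(1)] h(1)
      by (subst R.Lp_class_eq_iff) (auto intro!: AE_I2)
    then show ?thesis using pi_pull_class(2)[OF R R order_refl h(1)] h(2) by simp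
  qed
  fix F :: "'e set" assume F: "F \<in> findim_subspaces"
  show "lin_isometry (Lp_fd p chi R) (Lp_fd p chi F) (pi_pull p chi R F)" if RF: "R \<le> F"
    unfolding Lp_fd_def pi_pull_def
    by (rule lin_isometry_Lp_pull[OF p measurable_\<pi>[OF R F RF] distr_\<pi>[OF R F RF]])
  fix G :: "'e set" and x
  assume G: "G \<in> findim_subspaces" and RF: "R \<le> F" and FG: "F \<le> G" and x: "x \<in> vcarrier (Lp_fd p chi R)"
  obtain h where h: "h \<in> Lp_fun_fd R" "x = Lp_class_fd R h" using x carrier_fd[OF R] by blast
  show "pi_pull p chi F G (pi_pull p chi R F x) = pi_pull p chi R G x"
    using pi_pull_class[OF R F RF h(1)] pi_pull_class[OF F G FG] pi_pull_class[OF R G order_trans[OF RF FG] h(1)]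
    by (simp add: h(2) Int_absorb1[OF RF])
qed

lemma cocone_Lp: "cocone findim_subspaces (Lp_fd p chi) (pi_pull p chi) (Lp_space p \<mu>) (phi_pull p \<mu>)"
  unfolding cocone_def
proof (intro conjI ballI impI)
  show "banach_space (Lp_space p \<mu>)" by (rule banach_Lp)
  fix R :: "'e set" assume R: "R \<in> findim_subspaces"
  show "lin_isometry (Lp_fd p chi R) (Lp_space p \<mu>) (phi_pull p \<mu> R)"
    unfolding Lp_fd_def phi_pull_def by (rule lin_isometry_Lp_pull[OF p measurable_\<phi>[OF R] distr_\<phi>[OF R]])
  fix F :: "'e set" and x
  assume F: "F \<in> findim_subspaces" and RF: "R \<le> F" and x: "x \<in> vcarrier (Lp_fd p chi R)"
  obtain h where h: "h \<in> Lp_fun_fd R" "x = Lp_class_fd R h" using x carrier_fd[OF R] by blast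
  show "phi_pull p \<mu> R x = phi_pull p \<mu> F (pi_pull p chi R F x)"
    using phi_pull_class[OF R h(1)] pi_pull_class[OF R F RF h(1)] phi_pull_class[OF F]
    by (simp add: h(2) Int_absorb1[OF RF])
qed

section \<open>Density of the cylinder functions\<close>

text \<open>Membership in the closure of the union of the ranges of the isometries \<open>\<phi>\<^sub>R\<^sup>*\<close>, stated for functions
  rather than classes.\<close>

definition cylinder_approx :: "(('e \<Rightarrow> real) \<Rightarrow> real) \<Rightarrow> bool" where
  "cylinder_approx f \<longleftrightarrow> f \<in> Lp_fun p \<mu> \<and>
    (\<forall>e>0. \<exists>R\<in>findim_subspaces. \<exists>h\<in>Lp_fun_fd R. Lp_norm p \<mu> (\<lambda>l. f l - h (restrict l R)) < e)"

lemma cylinder_approxD: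
  assumes "cylinder_approx f" "e > 0"
  obtains R h where "R \<in> findim_subspaces" "h \<in> Lp_fun_fd R"
    "Lp_norm p \<mu> (\<lambda>l. f l - h (restrict l R)) < e"
  using assms by (auto simp: cylinder_approx_def)

lemma cylinder_approx_cylinder:
  assumes "R \<in> findim_subspaces" "h \<in> Lp_fun_fd R"
  shows "cylinder_approx (\<lambda>l. h (restrict l R))"
  unfolding cylinder_approx_def
  using assms phi_pull_class(1)[OF assms] p by (auto simp: Lp_norm_def intro!: bexI[of _ R] bexI[of _ h])

lemma cylinder_approx_limit:
  assumes f: "f \<in> Lp_fun p \<mu>" and s: "\<And>i. cylinder_approx (s i)"
    and lim: "(\<lambda>i. Lp_norm p \<mu> (\<lambda>l. s i l - f l)) \<longlonglongrightarrow> 0"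
  shows "cylinder_approx f"
  unfolding cylinder_approx_def
proof (intro conjI f allI impI)
  fix e :: real assume "e > 0"
  then have e: "e/2 > 0" by simp
  obtain i where i: "Lp_norm p \<mu> (\<lambda>l. s i l - f l) < e/2"
    using lim[THEN LIMSEQ_D, OF e] Lp_norm_nonneg by auto
  obtain R h where R: "R \<in> findim_subspaces" "h \<in> Lp_fun_fd R"
    and h: "Lp_norm p \<mu> (\<lambda>l. s i l - h (restrict l R)) < e/2"
    by (rule cylinder_approxD[OF s[of i] e])
  have "s i \<in> Lp_fun p \<mu>" using s by (simp add: cylinder_approx_def)
  from Lp_norm_diff_triangle[OF f this phi_pull_class(1)[OF R]]
  have "Lp_norm p \<mu> (\<lambda>l. f l - h (restrict l R)) < e" using i h Lp_norm_minus[of f "s i"] by simp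
  then show "\<exists>R\<in>findim_subspaces. \<exists>h\<in>Lp_fun_fd R. Lp_norm p \<mu> (\<lambda>l. f l - h (restrict l R)) < e"
    using R by blast
qed

lemma cylinder_approx_scale:
  assumes f: "cylinder_approx f"
  shows "cylinder_approx (\<lambda>l. a * f l)"
  unfolding cylinder_approx_def
proof (intro conjI allI impI)
  have "f \<in> Lp_fun p \<mu>" using f by (simp add: cylinder_approx_def)
  then show "(\<lambda>l. a * f l) \<in> Lp_fun p \<mu>" by (rule Lp_fun_scale)
  fix e :: real assume "e > 0"
  then have "e / (\<bar>a\<bar> + 1) > 0" by (simp add: add_nonneg_pos)
  then obtain R h where R: "R \<in> findim_subspaces" "h \<in> Lp_fun_fd R"
    and h: "Lp_norm p \<mu> (\<lambda>l. f l - h (restrict l R)) < e / (\<bar>a\<bar> + 1)"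
    by (rule cylinder_approxD[OF f])
  have "Lp_norm p \<mu> (\<lambda>l. a * f l - a * h (restrict l R)) = \<bar>a\<bar> * Lp_norm p \<mu> (\<lambda>l. f l - h (restrict l R))"
    using Lp_norm_scale[of a "\<lambda>l. f l - h (restrict l R)"] by (simp add: right_diff_distrib)
  also have "\<dots> \<le> (\<bar>a\<bar> + 1) * Lp_norm p \<mu> (\<lambda>l. f l - h (restrict l R))"
    by (intro mult_right_mono Lp_norm_nonneg) simp
  also have "\<dots> < e" using h by (simp add: pos_less_divide_eq add_nonneg_pos mult.commute)
  finally have "Lp_norm p \<mu> (\<lambda>l. a * f l - a * h (restrict l R)) < e" .
  moreover have "(\<lambda>l. a * h l) \<in> Lp_fun_fd R"
    using Lp.Lp_fun_scale[of p] p R(2) by (simp add: Lp_def)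
  ultimately show "\<exists>R\<in>findim_subspaces. \<exists>h\<in>Lp_fun_fd R. Lp_norm p \<mu> (\<lambda>l. a * f l - h (restrict l R)) < e"
    using R(1) by (intro bexI[of _ R] bexI[of _ "\<lambda>l. a * h l"]) auto
qed

lemma cylinder_approx_add:
  assumes f: "cylinder_approx f" and g: "cylinder_approx g"
  shows "cylinder_approx (\<lambda>l. f l + g l)"
  unfolding cylinder_approx_def
proof (intro conjI allI impI)
  have fg: "f \<in> Lp_fun p \<mu>" "g \<in> Lp_fun p \<mu>" using f g by (simp_all add: cylinder_approx_def)
  then show "(\<lambda>l. f l + g l) \<in> Lp_fun p \<mu>" by (rule Lp_fun_add)
  fix e :: real assume "e > 0"
  then have e: "e/2 > 0" by simp
  obtain R h where R: "R \<in> findim_subspaces" "h \<in> Lp_fun_fd R"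
    and h: "Lp_norm p \<mu> (\<lambda>l. f l - h (restrict l R)) < e/2" by (rule cylinder_approxD[OF f e])
  obtain S k where S: "S \<in> findim_subspaces" "k \<in> Lp_fun_fd S"
    and k: "Lp_norm p \<mu> (\<lambda>l. g l - k (restrict l S)) < e/2" by (rule cylinder_approxD[OF g e])
  obtain F where F: "F \<in> findim_subspaces" "R \<subseteq> F" "S \<subseteq> F" using findim_directed[OF R(1) S(1)] by blast
  interpret F: Lp_finite p "fd_measure chi F" by (rule Lp_fd_locale[OF F(1)])
  let ?m = "\<lambda>l. h (restrict l R) + k (restrict l S)"
  have "?m \<in> Lp_fun_fd F"
    by (intro F.Lp_fun_add pi_pull_class(1) R S F)
  moreover have "Lp_norm p \<mu> (\<lambda>l. f l + g l - ?m (restrict l F)) < e"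
  proof -
    have "Lp_norm p \<mu> (\<lambda>l. f l + g l - ?m (restrict l F))
        = Lp_norm p \<mu> (\<lambda>l. (f l - h (restrict l R)) + (g l - k (restrict l S)))"
      by (simp add: Int_absorb1 F algebra_simps)
    also have "\<dots> \<le> Lp_norm p \<mu> (\<lambda>l. f l - h (restrict l R)) + Lp_norm p \<mu> (\<lambda>l. g l - k (restrict l S))"
      by (intro Lp_norm_triangle Lp_fun_diff fg phi_pull_class(1) R S)
    finally show ?thesis using h k by simp
  qed
  ultimately show "\<exists>R\<in>findim_subspaces. \<exists>h\<in>Lp_fun_fd R. Lp_norm p \<mu> (\<lambda>l. f l + g l - h (restrict l R)) < e"
    using F(1) by (intro bexI[of _ F] bexI[of _ ?m]) auto
qed

lemma cylinder_approx_cong: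
  assumes f: "cylinder_approx f" and g: "g \<in> borel_measurable \<mu>" and eq: "\<And>l. l \<in> top_dual \<Longrightarrow> f l = g l"
  shows "cylinder_approx g"
proof (rule cylinder_approx_limit[OF _ f])
  have fL: "f \<in> Lp_fun p \<mu>" using f by (simp add: cylinder_approx_def)
  show gL: "g \<in> Lp_fun p \<mu>"
    by (rule Lp_fun_bound[OF fL g]) (auto intro!: AE_I2 simp: space_\<mu> eq)
  have "Lp_norm p \<mu> (\<lambda>l. f l - g l) = 0"
    by (subst Lp_norm_eq_0_iff[OF Lp_fun_diff[OF fL gL]]) (auto intro!: AE_I2 simp: space_\<mu> eq)
  then show "(\<lambda>i. Lp_norm p \<mu> (\<lambda>l. f l - g l)) \<longlonglongrightarrow> 0" by simp
qed

lemma cylinder_approx_sum: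
  "finite A \<Longrightarrow> (\<And>i. i \<in> A \<Longrightarrow> cylinder_approx (f i)) \<Longrightarrow> cylinder_approx (\<lambda>l. \<Sum>i\<in>A. f i l)"
proof (induction A rule: finite_induct)
  case empty
  have R: "span {} \<in> findim_subspaces" by (rule findim_span) simp
  interpret R: Lp_finite p "fd_measure chi (span {})" by (rule Lp_fd_locale[OF R])
  show ?case using cylinder_approx_cylinder[OF R R.Lp_fun_zero] by simp
next
  case (insert x F)
  then show ?case by (simp add: cylinder_approx_add)
qed

definition cylinder_sets :: "('e \<Rightarrow> real) set set" where
  "cylinder_sets = {(\<lambda>l. restrict l R) -` B \<inter> top_dual |R B. R \<in> findim_subspaces \<and> B \<in> sets (dual_borel R)}"

lemma cylinder_setsE:
  assumes "A \<in> cylinder_sets"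
  obtains R B where "R \<in> findim_subspaces" "B \<in> sets (dual_borel R)" "A = (\<lambda>l. restrict l R) -` B \<inter> top_dual"
  using assms by (auto simp: cylinder_sets_def)

lemma cylinder_sets_subset: "cylinder_sets \<subseteq> Pow top_dual"
  by (auto simp: cylinder_sets_def)

lemma cylinder_sets_in_\<mu>: "cylinder_sets \<subseteq> sets \<mu>"
proof
  fix A assume "A \<in> cylinder_sets"
  then obtain R B where R: "R \<in> findim_subspaces" "B \<in> sets (dual_borel R)"
    and A: "A = (\<lambda>l. restrict l R) -` B \<inter> top_dual" by (rule cylinder_setsE)
  show "A \<in> sets \<mu>"
    using measurable_sets[OF measurable_restrict_\<mu>[OF R(1)] R(2)] by (simp add: A space_\<mu>)
qed

text \<open>Two cylinder sets can be written as cylinder sets over a common finite dimensional space.\<close>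

lemma Int_stable_cylinder_sets: "Int_stable cylinder_sets"
proof (rule Int_stableI)
  fix A A' assume "A \<in> cylinder_sets" "A' \<in> cylinder_sets"
  obtain R B where R: "R \<in> findim_subspaces" "B \<in> sets (dual_borel R)"
    "A = (\<lambda>l. restrict l R) -` B \<inter> top_dual"
    using \<open>A \<in> cylinder_sets\<close> by (rule cylinder_setsE)
  obtain R' B' where R': "R' \<in> findim_subspaces" "B' \<in> sets (dual_borel R')"
    "A' = (\<lambda>l. restrict l R') -` B' \<inter> top_dual"
    using \<open>A' \<in> cylinder_sets\<close> by (rule cylinder_setsE)
  obtain F where F: "F \<in> findim_subspaces" "R \<subseteq> F" "R' \<subseteq> F" using findim_directed[OF R(1) R'(1)] by blast
  have lift: "(\<lambda>l. restrict l S) -` C \<inter> alg_dual F \<in> sets (dual_borel F)"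
    if "S \<in> findim_subspaces" "S \<subseteq> F" "C \<in> sets (dual_borel S)" for S C
    using measurable_sets[OF measurable_\<pi>[OF that(1) F(1) that(2)], of C] that F(1)
    by (simp add: sets_fd space_fd)
  have "(\<lambda>l. restrict l F) ` top_dual \<subseteq> alg_dual F"
    using measurable_space[OF measurable_restrict_\<mu>[OF F(1)]] by (auto simp: space_\<mu>)
  then have "A \<inter> A' = (\<lambda>l. restrict l F) -` (((\<lambda>l. restrict l R) -` B \<inter> alg_dual F)
      \<inter> ((\<lambda>l. restrict l R') -` B' \<inter> alg_dual F)) \<inter> top_dual"
    unfolding R(3) R'(3) by (auto simp: Int_absorb1 F)
  then show "A \<inter> A' \<in> cylinder_sets"
    unfolding cylinder_sets_def using lift[OF R(1) F(2) R(2)] lift[OF R'(1) F(3) R'(2)] F(1)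
    by blast
qed

text \<open>A set \<open>{l. l \<xi> \<in> B}\<close> from the definition of the \<open>\<sigma>\<close>-algebra is a cylinder set over the span of \<open>\<xi>\<close>.\<close>

lemma sets_\<mu>_eq: "sets \<mu> = sigma_sets top_dual cylinder_sets"
proof
  show "sigma_sets top_dual cylinder_sets \<subseteq> sets \<mu>"
    using sets.sigma_sets_subset[OF cylinder_sets_in_\<mu>] by (simp add: space_\<mu>)
  let ?G = "{(\<lambda>l. l \<xi>) -` B \<inter> alg_dual UNIV |\<xi> B. B \<in> sets borel} :: ('e \<Rightarrow> real) set set"
  have "sets \<mu> = {(\<lambda>l. l) -` A \<inter> top_dual |A. A \<in> sigma_sets (alg_dual UNIV) ?G}"
    unfolding sets_\<mu> sets_restrict_space sets_dual_algebra by auto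
  also have "\<dots> = sigma_sets top_dual {(\<lambda>l. l) -` A \<inter> top_dual |A. A \<in> ?G}"
    using top_dual_subset by (intro sigma_sets_vimage_commute) auto
  also have "\<dots> \<subseteq> sigma_sets top_dual cylinder_sets"
  proof (rule sigma_sets_mono', safe)
    fix \<xi> :: 'e and B :: "real set" assume B: "B \<in> sets borel"
    have R: "span {\<xi>} \<in> findim_subspaces" by (rule findim_span) simp
    let ?C = "(\<lambda>l. l \<xi>) -` B \<inter> alg_dual (span {\<xi>})"
    have \<xi>: "\<xi> \<in> span {\<xi>}" by (simp add: span_base)
    have "?C \<in> sets (dual_borel (span {\<xi>}))"
      using measurable_sets[OF measurable_eval_dual_borel[OF \<xi>] B] by simp
    moreover have "(\<lambda>l. restrict l (span {\<xi>})) ` top_dual \<subseteq> alg_dual (span {\<xi>})"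
      using measurable_space[OF measurable_restrict_\<mu>[OF R]] by (auto simp: space_\<mu>)
    then have "(\<lambda>l. l) -` ((\<lambda>l. l \<xi>) -` B \<inter> alg_dual UNIV) \<inter> top_dual
        = (\<lambda>l. restrict l (span {\<xi>})) -` ?C \<inter> top_dual"
      using \<xi> top_dual_subset by auto
    ultimately show "(\<lambda>l. l) -` ((\<lambda>l. l \<xi>) -` B \<inter> alg_dual UNIV) \<inter> top_dual \<in> cylinder_sets"
      unfolding cylinder_sets_def using R by blast
  qed
  finally show "sets \<mu> \<subseteq> sigma_sets top_dual cylinder_sets" .
qed

text \<open>The sets with approximable indicator function form a Dynkin system: complements correspond to
  differences and disjoint unions to dominated limits.  It contains the cylinder sets, which are stable
  under intersection.\<close>

lemma cylinder_approx_indicator: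
  assumes "A \<in> sets \<mu>"
  shows "cylinder_approx (indicator A)"
proof -
  have cyl: "cylinder_approx (indicator A)" if A: "A \<in> cylinder_sets" for A
  proof -
    obtain R B where R: "R \<in> findim_subspaces" "B \<in> sets (dual_borel R)"
      and A': "A = (\<lambda>l. restrict l R) -` B \<inter> top_dual" using A by (rule cylinder_setsE)
    interpret R: Lp_finite p "fd_measure chi R" by (rule Lp_fd_locale[OF R(1)])
    have "indicator B \<in> Lp_fun_fd R"
      using R sets_fd[OF R(1)] by (intro R.Lp_fun_bounded[of _ 1]) (auto simp: indicator_def)
    from cylinder_approx_cylinder[OF R(1) this] show ?thesis
      by (rule cylinder_approx_cong) (use A cylinder_sets_in_\<mu> in \<open>auto simp: A' indicator_def\<close>)
  qed
  have top: "top_dual \<in> cylinder_sets"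
  proof -
    have R: "span {} \<in> findim_subspaces" by (rule findim_span) simp
    have "top_dual = (\<lambda>l. restrict l (span {})) -` alg_dual (span {}) \<inter> (top_dual :: ('e \<Rightarrow> real) set)"
      using measurable_space[OF measurable_restrict_\<mu>[OF R]] by (auto simp: space_\<mu>)
    moreover have "alg_dual (span {}) \<in> sets (dual_borel (span {} :: 'e set))"
      using sets.top[of "dual_borel (span {} :: 'e set)"] by simp
    ultimately show ?thesis unfolding cylinder_sets_def using R by blast
  qed
  have "A \<in> sigma_sets top_dual cylinder_sets" using assms sets_\<mu>_eq by simp
  with Int_stable_cylinder_sets cylinder_sets_subset show ?thesis
  proof (induction rule: sigma_sets_induct_disjoint)
    case (basic A)
    then show ?case by (rule cyl)
  next
    case empty
    show ?case using cylinder_approx_sum[of "{}" undefined] by (simp add: indicator_def)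
  next
    case (compl A)
    have "cylinder_approx (\<lambda>l. indicator top_dual l + (-1) * indicator A l)"
      using compl cyl[OF top] by (intro cylinder_approx_add cylinder_approx_scale)
    then show ?case
    proof (rule cylinder_approx_cong)
      have "top_dual - A \<in> sets \<mu>" using compl(1) sets.compl_sets[of A \<mu>] by (simp add: sets_\<mu>_eq[symmetric] space_\<mu>)
      then show "indicator (top_dual - A) \<in> borel_measurable \<mu>" by simp
    qed (auto simp: indicator_def)
  next
    case (union A)
    have A: "A i \<in> sets \<mu>" for i using union by (auto simp: sets_\<mu>_eq)
    let ?s = "\<lambda>n l. \<Sum>i<n. indicator (A i) l :: real"
    have s: "?s n l = indicator (\<Union>i<n. A i) l" for n l
    proof -
      have "disjoint_family_on A {..<n}" using union(1) by (rule disjoint_family_on_mono[rotated]) simp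
      then show "?s n l = indicator (\<Union>i<n. A i) l" by (simp add: indicator_UN_disjoint)
    qed
    show ?case
    proof (rule cylinder_approx_limit)
      show "cylinder_approx (?s n)" for n using union by (intro cylinder_approx_sum) auto
      show "indicator (\<Union>i. A i) \<in> Lp_fun p \<mu>"
        using A by (intro Lp_fun_bounded[of _ 1]) (auto simp: indicator_def)
      show "(\<lambda>n. Lp_norm p \<mu> (\<lambda>l. ?s n l - indicator (\<Union>i. A i) l)) \<longlonglongrightarrow> 0"
      proof (rule Lp_dominated_convergence)
        show "(\<lambda>l. 1) \<in> Lp_fun p \<mu>" by (intro Lp_fun_bounded[of _ 1]) auto
        show "AE l in \<mu>. (\<lambda>n. ?s n l) \<longlonglongrightarrow> indicator (\<Union>i. A i) l"
          unfolding s by (intro AE_I2 LIMSEQ_indicator_UN)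
        show "AE l in \<mu>. \<bar>?s n l - indicator (\<Union>i. A i) l\<bar> \<le> \<bar>1\<bar>" for n
          unfolding s by (auto simp: indicator_def)
      qed (use A in auto)
    qed
  qed
qed

text \<open>Simple functions are combinations of indicator functions, and every \<open>f\<close> in \<open>L\<^sup>p\<close> is a limit of
  simple functions bounded by \<open>2 \<bar>f\<bar>\<close>.\<close>

theorem cylinder_functions_dense:
  assumes f: "f \<in> Lp_fun p \<mu>"
  shows "cylinder_approx f"
proof -
  have [measurable]: "f \<in> borel_measurable \<mu>" by (rule Lp_fun_measurable[OF f])
  obtain s where s: "\<And>i. simple_function \<mu> (s i)" "\<And>l. l \<in> space \<mu> \<Longrightarrow> (\<lambda>i. s i l) \<longlonglongrightarrow> f l"
    and bound: "\<And>i l. l \<in> space \<mu> \<Longrightarrow> dist (s i l) 0 \<le> 2 * dist (f l) 0"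
    using borel_measurable_implies_sequence_metric[OF \<open>f \<in> borel_measurable \<mu>\<close>, of 0] by blast
  have meas: "s i \<in> borel_measurable \<mu>" for i by (rule borel_measurable_simple_function[OF s(1)])
  show ?thesis
  proof (rule cylinder_approx_limit[OF f])
    fix i
    have "cylinder_approx (\<lambda>l. indicator A l *\<^sub>R y)" if "A \<in> sets \<mu>" for A y
      using cylinder_approx_scale[OF cylinder_approx_indicator[OF that], of y] by (simp add: mult.commute)
    then have "cylinder_approx (\<lambda>l. \<Sum>y\<in>s i ` space \<mu>. indicator (s i -` {y} \<inter> space \<mu>) l *\<^sub>R y)"
      using simple_functionD[OF s(1)] by (intro cylinder_approx_sum) auto
    then show "cylinder_approx (s i)"
    proof (rule cylinder_approx_cong[OF _ meas])
      fix l assume "l \<in> (top_dual :: ('e \<Rightarrow> real) set)"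
      then have "l \<in> space \<mu>" by (simp add: space_\<mu>)
      from simple_function_indicator_representation_banach[OF s(1)[of i] this]
      show "(\<Sum>y\<in>s i ` space \<mu>. indicator (s i -` {y} \<inter> space \<mu>) l *\<^sub>R y) = s i l" ..
    qed
  next
    show "(\<lambda>i. Lp_norm p \<mu> (\<lambda>l. s i l - f l)) \<longlonglongrightarrow> 0"
    proof (rule Lp_dominated_convergence[OF Lp_fun_scale[OF f, of 3]])
      have "\<bar>s i l - f l\<bar> \<le> \<bar>3 * f l\<bar>" if "l \<in> space \<mu>" for i l
        using bound[OF that, of i] by (simp add: abs_mult)
      then show "AE l in \<mu>. \<bar>s i l - f l\<bar> \<le> \<bar>3 * f l\<bar>" for i by (intro AE_I2)
      show "AE l in \<mu>. (\<lambda>i. s i l) \<longlonglongrightarrow> f l" using s(2) by (intro AE_I2)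
    qed (use meas in auto)
  qed
qed

section \<open>Convergence of the conditional expectations\<close>

lemma subalgebra_cyl:
  assumes R: "R \<in> findim_subspaces"
  shows "subalgebra \<mu> (cyl_algebra R)"
  unfolding subalgebra_def
proof
  have u: "(\<lambda>l. restrict l R) \<in> top_dual \<rightarrow> space (dual_borel R)"
    using measurable_space[OF measurable_restrict_\<mu>[OF R]] by (auto simp: space_\<mu>)
  show "space (cyl_algebra R) = space \<mu>" by (simp add: cyl_algebra_def space_\<mu>)
  show "sets (cyl_algebra R) \<subseteq> sets \<mu>"
    unfolding cyl_algebra_def sets_vimage_algebra2[OF u]
    using measurable_sets[OF measurable_restrict_\<mu>[OF R]] by (auto simp: space_\<mu>)
qed

lemma Lp_subalgebra_cyl: "R \<in> findim_subspaces \<Longrightarrow> Lp_subalgebra p \<mu> (cyl_algebra R)"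
  by (intro Lp_subalgebra.intro finite_measure_subalgebra.intro finite_measure_subalgebra_axioms.intro
      subalgebra_cyl Lp_axioms finite_measure_axioms)

lemma cond_E_class:
  assumes R: "R \<in> findim_subspaces" and f: "f \<in> Lp_fun p \<mu>"
  shows "cond_E p \<mu> R (Lp_class p \<mu> f) = Lp_class p \<mu> (real_cond_exp \<mu> (cyl_algebra R) f)"
  unfolding cond_E_def by (rule Lp_subalgebra.Lp_cond_exp_class[OF Lp_subalgebra_cyl[OF R] f])

text \<open>The conditional expectation is measurable for the preimage \<open>\<sigma>\<close>-algebra, hence of the form
  \<open>g \<circ> \<phi>\<^sub>R\<close>, and \<open>g\<close> is in \<open>L\<^sup>p\<close> because \<open>\<phi>\<^sub>R\<close> is measure preserving.\<close>

lemma cond_E_in_range: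
  assumes R: "R \<in> findim_subspaces" and x: "x \<in> vcarrier (Lp_space p \<mu>)"
  shows "cond_E p \<mu> R x \<in> phi_pull p \<mu> R ` vcarrier (Lp_fd p chi R)"
proof -
  interpret S: Lp_subalgebra p \<mu> "cyl_algebra R" by (rule Lp_subalgebra_cyl[OF R])
  interpret R: Lp_finite p "fd_measure chi R" by (rule Lp_fd_locale[OF R])
  obtain f where f: "f \<in> Lp_fun p \<mu>" "x = Lp_class p \<mu> f" using x by (auto simp: carrier_Lp)
  have u: "(\<lambda>l. restrict l R) \<in> top_dual \<rightarrow> space (dual_borel R)"
    using measurable_space[OF measurable_restrict_\<mu>[OF R]] by (auto simp: space_\<mu>)
  have "S.E f \<in> borel_measurable (vimage_algebra top_dual (\<lambda>l. restrict l R) (dual_borel R))"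
    using borel_measurable_cond_exp unfolding cyl_algebra_def by blast
  then obtain g where g: "g \<in> borel_measurable (dual_borel R)"
    and fg: "\<And>l. l \<in> top_dual \<Longrightarrow> S.E f l = g (restrict l R)"
    using factor_through_vimage_algebra[OF _ u] by blast
  have g' [measurable]: "g \<in> borel_measurable (fd_measure chi R)"
    using g measurable_cong_sets[OF sets_fd[OF R] refl] by blast
  have "integrable \<mu> (\<lambda>l. \<bar>S.E f l\<bar> powr p)"
    by (rule Lp_fun_integrable[OF S.cond_exp_contraction(1)[OF f(1)]])
  then have "integrable \<mu> (\<lambda>l. \<bar>g (restrict l R)\<bar> powr p)"
    by (subst (asm) Bochner_Integration.integrable_cong[OF refl, of \<mu> _ "\<lambda>l. \<bar>g (restrict l R)\<bar> powr p"])
      (simp_all add: fg space_\<mu>)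
  then have "integrable (distr \<mu> (fd_measure chi R) (\<lambda>l. restrict l R)) (\<lambda>l. \<bar>g l\<bar> powr p)"
    using measurable_\<phi>[OF R] by (subst integrable_distr_eq) auto
  then have gL: "g \<in> Lp_fun_fd R" by (simp add: distr_\<phi>[OF R] Lp_fun_def)
  have "Lp_class p \<mu> (S.E f) = Lp_class p \<mu> (\<lambda>l. g (restrict l R))"
    using phi_pull_class(1)[OF R gL] S.cond_exp_contraction(1)[OF f(1)]
    by (subst Lp_class_eq_iff) (auto intro!: AE_I2 simp: fg space_\<mu>)
  then have "cond_E p \<mu> R x = phi_pull p \<mu> R (Lp_class_fd R g)"
    by (simp only: f(2) cond_E_class[OF R f(1)] phi_pull_class(2)[OF R gL])
  moreover have "Lp_class_fd R g \<in> vcarrier (Lp_fd p chi R)"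
    unfolding carrier_fd[OF R] using gL by blast
  ultimately show ?thesis by blast
qed

sublocale diagram: directed_cocone findim_subspaces "Lp_fd p chi" "pi_pull p chi" "Lp_space p \<mu>" "phi_pull p \<mu>"
proof
  show "codiagram findim_subspaces (Lp_fd p chi) (pi_pull p chi)" by (rule codiagram_Lp)
  show "findim_subspaces \<noteq> {}" using findim_span[of "{}"] by blast
  show "\<exists>F\<in>findim_subspaces. R \<le> F \<and> S \<le> F"
    if "R \<in> findim_subspaces" "S \<in> findim_subspaces" for R S :: "'e set"
    using findim_directed[OF that] .
  show "cocone findim_subspaces (Lp_fd p chi) (pi_pull p chi) (Lp_space p \<mu>) (phi_pull p \<mu>)"
    by (rule cocone_Lp)
qed

text \<open>Approximate \<open>f\<close> by \<open>g = h \<circ> \<phi>\<^sub>R\<^sub>0\<close>.  If \<open>R\<close> contains \<open>R0\<close> then \<open>g\<close> is measurable for the \<open>\<sigma>\<close>-algebra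
  of \<open>R\<close>, and \<open>\<parallel>\<E>\<^sub>R(f) - f\<parallel> \<le> 2 \<parallel>f - g\<parallel>\<close>.\<close>

lemma cond_E_limit:
  assumes x: "x \<in> vcarrier (Lp_space p \<mu>)"
  shows "vlimit (Lp_space p \<mu>) (\<lambda>R. cond_E p \<mu> R x) x (net findim_subspaces)"
  unfolding diagram.W.limitin_metric
proof (intro conjI x allI impI)
  obtain f where f: "f \<in> Lp_fun p \<mu>" "x = Lp_class p \<mu> f" using x by (auto simp: carrier_Lp)
  fix e :: real assume "e > 0"
  then have e: "e/2 > 0" by simp
  obtain R0 h where R0: "R0 \<in> findim_subspaces" "h \<in> Lp_fun_fd R0"
    and h: "Lp_norm p \<mu> (\<lambda>l. f l - h (restrict l R0)) < e/2"
    by (rule cylinder_approxD[OF cylinder_functions_dense[OF f(1)] e])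
  let ?g = "\<lambda>l. h (restrict l R0)"
  show "eventually (\<lambda>R. cond_E p \<mu> R x \<in> vcarrier (Lp_space p \<mu>)
      \<and> vdist (Lp_space p \<mu>) (cond_E p \<mu> R x) x < e) (net findim_subspaces)"
  proof (rule diagram.eventually_netI[OF R0(1)])
    fix R :: "'e set" assume R: "R \<in> findim_subspaces" and R0R: "R0 \<le> R"
    interpret S: Lp_subalgebra p \<mu> "cyl_algebra R" by (rule Lp_subalgebra_cyl[OF R])
    interpret R: Lp_finite p "fd_measure chi R" by (rule Lp_fd_locale[OF R])
    have u: "(\<lambda>l. restrict l R) \<in> measurable (cyl_algebra R) (dual_borel R)"
      unfolding cyl_algebra_def
      using measurable_space[OF measurable_restrict_\<mu>[OF R]]
      by (intro measurable_vimage_algebra1) (auto simp: space_\<mu>)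
    have "?g \<in> borel_measurable (fd_measure chi R)"
      by (rule R.Lp_fun_measurable[OF pi_pull_class(1)[OF R0(1) R R0R R0(2)]])
    then have "?g \<in> borel_measurable (dual_borel R)"
      using measurable_cong_sets[OF sets_fd[OF R] refl] by blast
    from measurable_compose[OF u this] have "?g \<in> borel_measurable (cyl_algebra R)"
      by (simp add: Int_absorb1[OF R0R])
    from S.cond_exp_close[OF f(1) phi_pull_class(1)[OF R0] this]
    have "Lp_norm p \<mu> (\<lambda>l. S.E f l - f l) < e" using h by simp
    then show "cond_E p \<mu> R x \<in> vcarrier (Lp_space p \<mu>)
        \<and> vdist (Lp_space p \<mu>) (cond_E p \<mu> R x) x < e"
      using S.cond_exp_contraction(1)[OF f(1)]
      by (simp only: f(2) cond_E_class[OF R f(1)] dist_Lp[OF _ f(1)] Lp_class_closed simp_thms)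
  qed
qed

section \<open>The colimit of the \<open>L\<^sup>p\<close> spaces\<close>

abbreviation cond_family :: "(('e \<Rightarrow> real) \<Rightarrow> real) set \<Rightarrow> 'e set \<Rightarrow> (('e \<Rightarrow> real) \<Rightarrow> real) set" where
  "cond_family x \<equiv> \<lambda>R\<in>findim_subspaces.
     inv_into (vcarrier (Lp_fd p chi R)) (phi_pull p \<mu> R) (cond_E p \<mu> R x)"

lemma cond_family_limit:
  assumes x: "x \<in> vcarrier (Lp_space p \<mu>)"
  shows "cond_family x \<in> (\<Pi>\<^sub>E R\<in>findim_subspaces. vcarrier (Lp_fd p chi R))"
    and "vlimit (Lp_space p \<mu>) (\<lambda>R. phi_pull p \<mu> R (cond_family x R)) x (net findim_subspaces)"
proof -
  show "cond_family x \<in> (\<Pi>\<^sub>E R\<in>findim_subspaces. vcarrier (Lp_fd p chi R))"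
    using inv_into_into[OF cond_E_in_range[OF _ x]] by auto
  show "vlimit (Lp_space p \<mu>) (\<lambda>R. phi_pull p \<mu> R (cond_family x R)) x (net findim_subspaces)"
    by (rule diagram.vlimit_cong_I[OF _ cond_E_limit[OF x]])
      (simp add: f_inv_into_f[OF cond_E_in_range[OF _ x]])
qed

sublocale diagram: approximating_cocone findim_subspaces "Lp_fd p chi" "pi_pull p chi" "Lp_space p \<mu>" "phi_pull p \<mu>"
  by unfold_locales (use cond_family_limit in blast)

lemma frakL_eq: "frakL p \<mu> = diagram.limit_map"
  by (rule ext) (simp add: frakL_def has_phi_limit_def diagram.limit_map_def)

lemma frakL_inv_eq: "frakL_inv p chi \<mu> x = diagram.cls (cond_family x)"
  by (simp add: frakL_inv_def)

lemma frakL_frakL_inv: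
  assumes x: "x \<in> vcarrier (Lp_space p \<mu>)"
  shows "frakL_inv p chi \<mu> x \<in> vcarrier (scriptL p chi)" "frakL p \<mu> (frakL_inv p chi \<mu> x) = x"
  unfolding frakL_eq frakL_inv_eq by (rule diagram.family_cls[OF cond_family_limit[OF x]])+

lemma frakL_inv_frakL:
  assumes X: "X \<in> vcarrier (scriptL p chi)"
  shows "frakL_inv p chi \<mu> (frakL p \<mu> X) = X"
proof -
  have bij: "bij_betw (frakL p \<mu>) (vcarrier (scriptL p chi)) (vcarrier (Lp_space p \<mu>))"
    unfolding frakL_eq by (rule diagram.limit_map_bij)
  then have "frakL p \<mu> X \<in> vcarrier (Lp_space p \<mu>)" using X by (auto simp: bij_betw_def)
  from frakL_frakL_inv[OF this] show ?thesis
    using bij X by (auto simp: bij_betw_def inj_on_def)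
qed

end

theorem theorem4p4:
  fixes chi :: "'e::topological_real_vector \<Rightarrow> complex"
    and \<mu> :: "('e \<Rightarrow> real) measure"
    and p :: real
  assumes "nuclear_tvs TYPE('e)"
    and "characteristic_function chi"
    and "continuous_on UNIV chi"
    and "chi 0 = 1"
    and "corresponding_measure chi \<mu>"
    and "1 \<le> p"
  shows
    "colimit TYPE('w) findim_subspaces (Lp_fd p chi) (pi_pull p chi) (Lp_space p \<mu>) (phi_pull p \<mu>)
     \<and> colimit TYPE('w) findim_subspaces (Lp_fd p chi) (pi_pull p chi) (scriptL p chi) (psi p chi)
     \<and> (\<forall>X\<in>vcarrier (scriptL p chi). \<forall>f\<in>X. has_phi_limit p \<mu> f (frakL p \<mu> X))
     \<and> cocone_iso findim_subspaces (Lp_fd p chi) (scriptL p chi) (psi p chi)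
         (Lp_space p \<mu>) (phi_pull p \<mu>) (frakL p \<mu>)
     \<and> (\<forall>R\<in>findim_subspaces. \<forall>f\<in>vcarrier (Lp_space p \<mu>).
          cond_E p \<mu> R f \<in> phi_pull p \<mu> R ` vcarrier (Lp_fd p chi R))
     \<and> cocone_iso findim_subspaces (Lp_fd p chi) (Lp_space p \<mu>) (phi_pull p \<mu>)
         (scriptL p chi) (psi p chi) (frakL_inv p chi \<mu>)
     \<and> (\<forall>X\<in>vcarrier (scriptL p chi). frakL_inv p chi \<mu> (frakL p \<mu> X) = X)
     \<and> (\<forall>f\<in>vcarrier (Lp_space p \<mu>). frakL p \<mu> (frakL_inv p chi \<mu> f) = f)"
proof -
  interpret dual_measure chi \<mu> p by unfold_locales fact+
  show ?thesis
  proof (intro conjI ballI)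
    show "colimit TYPE('w) findim_subspaces (Lp_fd p chi) (pi_pull p chi) (Lp_space p \<mu>) (phi_pull p \<mu>)"
      by (rule diagram.colimit_Y)
    show "colimit TYPE('w) findim_subspaces (Lp_fd p chi) (pi_pull p chi) (scriptL p chi) (psi p chi)"
      by (rule diagram.colimit_co_Cauchy_space)
    show "has_phi_limit p \<mu> f (frakL p \<mu> X)" if "X \<in> vcarrier (scriptL p chi)" "f \<in> X" for X f
      unfolding has_phi_limit_def frakL_eq using that by (rule diagram.limit_map_limit)
    show "cocone_iso findim_subspaces (Lp_fd p chi) (scriptL p chi) (psi p chi)
         (Lp_space p \<mu>) (phi_pull p \<mu>) (frakL p \<mu>)"
      unfolding frakL_eq by (rule diagram.limit_map_iso)
    show "cond_E p \<mu> R f \<in> phi_pull p \<mu> R ` vcarrier (Lp_fd p chi R)"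
      if "R \<in> findim_subspaces" "f \<in> vcarrier (Lp_space p \<mu>)" for R f
      using that by (rule cond_E_in_range)
    show "cocone_iso findim_subspaces (Lp_fd p chi) (Lp_space p \<mu>) (phi_pull p \<mu>)
         (scriptL p chi) (psi p chi) (frakL_inv p chi \<mu>)"
      by (rule diagram.inverse_iso) (use frakL_inv_frakL in \<open>simp add: frakL_eq\<close>)
    show "frakL_inv p chi \<mu> (frakL p \<mu> X) = X" if "X \<in> vcarrier (scriptL p chi)" for X
      using that by (rule frakL_inv_frakL)
    show "frakL p \<mu> (frakL_inv p chi \<mu> f) = f" if "f \<in> vcarrier (Lp_space p \<mu>)" for f
      using that by (rule frakL_frakL_inv)
  qed
qed

end
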